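(* Let $\Theta$ be the variety of groups defined by the identities $x^4=1$, $((x_1,x_2),(x_3,x_4))=1$ and $((((x_1,x_2),x_3),x_4),x_5)=1$. Let $\Theta^0$ be the category of its free groups on finite subsets of a fixed countably infinite set of symbols, $\mathfrak{A}$ the group of all automorphisms of $\Theta^0$, $\mathfrak{Y}$ the normal subgroup of all inner automorphisms, and $\mathfrak{S}$ the subgroup of all strongly stable automorphisms. For $0\le\alpha<4$ let $\Phi_\alpha\in\mathfrak{S}$ be the strongly stable automorphism corresponding to the applicable system of words $W_\alpha=\{w_1=1,\ w_{-1}(x)=x^{-1},\ w_\cdot(x,y)=xy(y,x)^\alpha\}$. Then $$\mathfrak{S}\cap\mathfrak{Y}=\{\Phi_0,\Phi_1\}\quad\text{and}\quad |\mathfrak{A}/\mathfrak{Y}|=2 .$$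
   Context: Commutators: $(x,y)=x^{-1}y^{-1}xy$. Groups are universal algebras with signature $\Omega=\{1,-1,\cdot\}$ (unit, inverse, multiplication). Fix a countably infinite set $X_0$ of symbols. The objects of the category $\Theta^0$ are the free groups $F(X)=F_\Theta(X)$ of the variety $\Theta$ freely generated by finite subsets $X\subset X_0$ (including $X=\varnothing$, giving the trivial group); the morphisms are all group homomorphisms between them. An automorphism of $\Theta^0$ is an invertible functor $\Theta^0\to\Theta^0$. An automorphism $\Upsilon$ of $\Theta^0$ is inner if it is isomorphic as a functor to the identity functor, i.e. for every object $F$ there is an isomorphism $\sigma_F:F\to\Upsilon(F)$ such that $\Upsilon(\mu)=\sigma_{F_2}\mu\sigma_{F_1}^{-1}$ for every morphism $\mu:F_1\to F_2$. An automorphism $\Phi$ of $\Theta^0$ is strongly stable if $\Phi(F)=F$ for every object $F$ and there is a system of bijections $\{s_F:F\to F\}_{F\in\mathrm{Ob}\,\Theta^0}$ such that $\Phi(\psi)=s_B\psi s_A^{-1}$ for every morphism $\psi:A\to B$, and $s_{F}|_X=\mathrm{id}_X$ for every object $F=F(X)$. A system of words is $W=\{w_1,w_{-1}(x),w_\cdot(x,y)\}$ with $w_1\in F_\Theta(\varnothing)$, $w_{-1}(x)\in F_\Theta(x)$, $w_\cdot(x,y)\in F_\Theta(x,y)$. For $H\in\Theta$, $H_W^*$ denotes the algebra of signature $\Omega$ with the same underlying set as $H$ in which the unit, inverse and multiplication are realized by $w_1$, $h\mapsto w_{-1}(h)$ and $(h_1,h_2)\mapsto w_\cdot(h_1,h_2)$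 (the words being evaluated in the group $H$). The system $W$ is applicable if for every object $F=F(X)$ of $\Theta^0$ there is an isomorphism of algebras $s_F:F\to F_W^*$ with $s_F|_X=\mathrm{id}_X$; this isomorphism is then unique. The strongly stable automorphism corresponding to an applicable system $W$ is the one that fixes all objects and acts on morphisms $\psi:A\to B$ by $\psi\mapsto s_B\psi s_A^{-1}$ (this gives a bijection between applicable systems of words and $\mathfrak{S}$). All the systems $W_\alpha$, $0\le\alpha<4$, are applicable. *)

theory Defs
  imports "HOL-Algebra.Coset" "HOL-Library.FuncSet" "HOL-Library.Countable_Set"
begin

section \<open>The variety\<close>

definition gcomm :: "('a, 'm) monoid_scheme \<Rightarrow> 'a \<Rightarrow> 'a \<Rightarrow> 'a" where
  "gcomm G x y = inv\<^bsub>G\<^esub> x \<otimes>\<^bsub>G\<^esub> inv\<^bsub>G\<^esub> y \<otimes>\<^bsub>G\<^esub> x \<otimes>\<^bsub>G\<^esub> y"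

definition Theta_group :: "('a, 'm) monoid_scheme \<Rightarrow> bool" where
  "Theta_group G \<longleftrightarrow> group G \<and>
     (\<forall>x \<in> carrier G. x [^]\<^bsub>G\<^esub> (4::nat) = \<one>\<^bsub>G\<^esub>) \<and>
     (\<forall>a \<in> carrier G. \<forall>b \<in> carrier G. \<forall>c \<in> carrier G. \<forall>d \<in> carrier G.
        gcomm G (gcomm G a b) (gcomm G c d) = \<one>\<^bsub>G\<^esub>) \<and>
     (\<forall>a \<in> carrier G. \<forall>b \<in> carrier G. \<forall>c \<in> carrier G. \<forall>d \<in> carrier G. \<forall>e \<in> carrier G.
        gcomm G (gcomm G (gcomm G (gcomm G a b) c) d) e = \<one>\<^bsub>G\<^esub>)"


section \<open>Free groups of the variety\<close>

text \<open>The free groups are obtained as term algebras modulo the fully invariant congruence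
  generated by the group axioms and the identities of the variety.\<close>

datatype 'x gterm = Var 'x | One | Inv "'x gterm" | Mul "'x gterm" "'x gterm"

definition tcomm :: "'x gterm \<Rightarrow> 'x gterm \<Rightarrow> 'x gterm" where
  "tcomm s t = Mul (Mul (Mul (Inv s) (Inv t)) s) t"

primrec tpow :: "'x gterm \<Rightarrow> nat \<Rightarrow> 'x gterm" where
  "tpow t 0 = One"
| "tpow t (Suc n) = Mul (tpow t n) t"

inductive Theta_eq :: "'x gterm \<Rightarrow> 'x gterm \<Rightarrow> bool" where
  refl: "Theta_eq t t"
| sym: "Theta_eq s t \<Longrightarrow> Theta_eq t s"
| trans: "Theta_eq s t \<Longrightarrow> Theta_eq t u \<Longrightarrow> Theta_eq s u"
| cong_Inv: "Theta_eq s t \<Longrightarrow> Theta_eq (Inv s) (Inv t)"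
| cong_Mul: "Theta_eq s s' \<Longrightarrow> Theta_eq t t' \<Longrightarrow> Theta_eq (Mul s t) (Mul s' t')"
| assoc: "Theta_eq (Mul (Mul s t) u) (Mul s (Mul t u))"
| l_one: "Theta_eq (Mul One t) t"
| l_inv: "Theta_eq (Mul (Inv t) t) One"
| exponent: "Theta_eq (tpow t 4) One"
| metabelian: "Theta_eq (tcomm (tcomm a b) (tcomm c d)) One"
| nilpotent: "Theta_eq (tcomm (tcomm (tcomm (tcomm a b) c) d) e) One"

lemma equivp_Theta_eq: "equivp (Theta_eq :: 'x gterm \<Rightarrow> _)"
  by (rule equivpI) (auto intro!: reflpI sympI transpI intro: Theta_eq.intros)

quotient_type 'x Theta_elt = "'x gterm" / Theta_eq
  by (rule equivp_Theta_eq)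

lift_definition gen :: "'x \<Rightarrow> 'x Theta_elt" is Var .

lift_definition fone :: "'x Theta_elt" is One .

lift_definition finv :: "'x Theta_elt \<Rightarrow> 'x Theta_elt" is Inv
  by (rule Theta_eq.cong_Inv)

lift_definition fmul :: "'x Theta_elt \<Rightarrow> 'x Theta_elt \<Rightarrow> 'x Theta_elt" is Mul
  by (rule Theta_eq.cong_Mul)

type_synonym 'x grp = "'x Theta_elt monoid"

definition free_grp :: "'x set \<Rightarrow> 'x grp" where
  "free_grp X = \<lparr>carrier = abs_Theta_elt ` {t. set_gterm t \<subseteq> X}, mult = fmul, one = fone\<rparr>"

primrec gval :: "('a, 'm) monoid_scheme \<Rightarrow> ('x \<Rightarrow> 'a) \<Rightarrow> 'x gterm \<Rightarrow> 'a" where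
  "gval G v (Var x) = v x"
| "gval G v One = \<one>\<^bsub>G\<^esub>"
| "gval G v (Inv t) = inv\<^bsub>G\<^esub> (gval G v t)"
| "gval G v (Mul s t) = gval G v s \<otimes>\<^bsub>G\<^esub> gval G v t"

text \<open>For \<^prop>\<open>Theta_group G\<close> and \<open>v\<close> with values in \<^term>\<open>carrier G\<close> the value of an
  element does not depend on the representing term (see \<open>gval_cong\<close> below).\<close>

definition word_val :: "('a, 'm) monoid_scheme \<Rightarrow> ('x \<Rightarrow> 'a) \<Rightarrow> 'x Theta_elt \<Rightarrow> 'a" where
  "word_val G v w = gval G v (rep_Theta_elt w)"

subsection \<open>Freeness\<close>

lemma free_grp_simps [simp]:
  "carrier (free_grp X) = abs_Theta_elt ` {t. set_gterm t \<subseteq> X}"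
  "mult (free_grp X) = fmul" "one (free_grp X) = fone"
  by (simp_all add: free_grp_def)

lemma gen_in_free_grp: "x \<in> X \<Longrightarrow> gen x \<in> carrier (free_grp X)"
  by (auto simp: gen.abs_eq)

lemma fone_in_free_grp: "fone \<in> carrier (free_grp X)"
  by (auto simp: fone_def)

lemma finv_in_free_grp: "a \<in> carrier (free_grp X) \<Longrightarrow> finv a \<in> carrier (free_grp X)"
  by (auto simp: finv.abs_eq intro!: imageI)

lemma fmul_in_free_grp:
  "a \<in> carrier (free_grp X) \<Longrightarrow> b \<in> carrier (free_grp X) \<Longrightarrow> fmul a b \<in> carrier (free_grp X)"
  by (auto simp: fmul.abs_eq intro!: imageI)

lemma fmul_assoc: "fmul (fmul a b) c = fmul a (fmul b c)"
  by transfer (rule Theta_eq.assoc)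

lemma fmul_fone: "fmul fone a = a"
  by transfer (rule Theta_eq.l_one)

lemma fmul_finv: "fmul (finv a) a = fone"
  by transfer (rule Theta_eq.l_inv)

lemma group_free_grp: "group (free_grp X)"
proof (rule groupI)
  fix a assume "a \<in> carrier (free_grp X)"
  then show "\<exists>b \<in> carrier (free_grp X). b \<otimes>\<^bsub>free_grp X\<^esub> a = \<one>\<^bsub>free_grp X\<^esub>"
    using finv_in_free_grp fmul_finv by (intro bexI[of _ "finv a"]) auto
qed (auto simp: fmul_assoc fmul_fone simp del: free_grp_simps(1) intro: fmul_in_free_grp fone_in_free_grp)

lemma inv_free_grp:
  assumes "a \<in> carrier (free_grp X)"
  shows "inv\<^bsub>free_grp X\<^esub> a = finv a"
proof -
  interpret group "free_grp X" by (rule group_free_grp)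
  show ?thesis
    using assms finv_in_free_grp fmul_finv by (intro inv_equality) auto
qed

lemma gcomm_free_grp:
  assumes "set_gterm s \<subseteq> X" "set_gterm t \<subseteq> X"
  shows "gcomm (free_grp X) (abs_Theta_elt s) (abs_Theta_elt t) = abs_Theta_elt (tcomm s t)"
proof -
  have "inv\<^bsub>free_grp X\<^esub> abs_Theta_elt u = abs_Theta_elt (Inv u)" if "set_gterm u \<subseteq> X" for u
    using inv_free_grp[of "abs_Theta_elt u" X] that by (auto simp: finv.abs_eq)
  then show ?thesis
    using assms by (simp add: gcomm_def tcomm_def fmul.abs_eq)
qed

lemma pow_free_grp: "abs_Theta_elt t [^]\<^bsub>free_grp X\<^esub> n = abs_Theta_elt (tpow t n)" for n :: nat
  by (induction n) (simp_all add: fone.abs_eq fmul.abs_eq nat_pow_def)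

lemma set_tcomm [simp]: "set_gterm (tcomm s t) = set_gterm s \<union> set_gterm t"
  by (auto simp: tcomm_def)

theorem Theta_group_free_grp: "Theta_group (free_grp X)"
proof -
  have eq: "abs_Theta_elt s = fone" if "Theta_eq s One" for s :: "'x gterm"
    using that by (simp add: fone.abs_eq Theta_elt.abs_eq_iff)
  show ?thesis
    unfolding Theta_group_def
    by (auto simp: group_free_grp pow_free_grp gcomm_free_grp
        intro!: eq Theta_eq.exponent Theta_eq.metabelian Theta_eq.nilpotent)
qed

lemma gval_closed:
  assumes "group G" "\<And>x. x \<in> set_gterm t \<Longrightarrow> v x \<in> carrier G"
  shows "gval G v t \<in> carrier G"
proof -
  interpret group G by fact
  show ?thesis using assms(2) by (induction t) auto
qed

lemma gval_tpow: "gval G v (tpow t n) = gval G v t [^]\<^bsub>G\<^esub> n"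
  by (induction n) (simp_all add: nat_pow_def)

lemma gval_tcomm: "gval G v (tcomm s t) = gcomm G (gval G v s) (gval G v t)"
  by (simp add: tcomm_def gcomm_def)

lemma gval_cong:
  assumes "Theta_group G" "\<And>x. v x \<in> carrier G" "Theta_eq s t"
  shows "gval G v s = gval G v t"
proof -
  interpret group G using assms(1) by (simp add: Theta_group_def)
  have [simp]: "gval G v u \<in> carrier G" for u
    using assms(2) by (intro gval_closed) (auto intro: group_axioms)
  show ?thesis
    using assms(3) assms(1)
    by (induction rule: Theta_eq.induct)
      (simp_all add: m_assoc gval_tpow gval_tcomm Theta_group_def)
qed

lemma word_val_abs:
  assumes "Theta_group G" "\<And>x. v x \<in> carrier G"
  shows "word_val G v (abs_Theta_elt t) = gval G v t"
  unfolding word_val_def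
  by (rule gval_cong[OF assms]) (rule Quotient3_rep_abs[OF Quotient3_Theta_elt Theta_eq.refl])

lemma abs_Theta_elt_cases: obtains t where "a = abs_Theta_elt t"
  by (induction a) blast

text \<open>The universal property of \<^term>\<open>free_grp X\<close>.\<close>

theorem free_grp_universal:
  assumes G: "Theta_group G" and v: "\<And>x. x \<in> X \<Longrightarrow> v x \<in> carrier G"
  shows "\<exists>!f. f \<in> hom (free_grp X) G \<and> f \<in> extensional (carrier (free_grp X)) \<and>
              (\<forall>x \<in> X. f (gen x) = v x)"
proof -
  interpret G: group G using G by (simp add: Theta_group_def)
  define v' where "v' = (\<lambda>x. if x \<in> X then v x else \<one>\<^bsub>G\<^esub>)"
  have v': "v' x \<in> carrier G" for x using v by (auto simp: v'_def)
  define f where "f = restrict (word_val G v') (carrier (free_grp X))"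
  have f_abs: "f (abs_Theta_elt t) = gval G v' t" if "set_gterm t \<subseteq> X" for t
    using that by (auto simp: f_def word_val_abs[OF G v'])
  have cl: "gval G v' t \<in> carrier G" for t
    using v' by (intro gval_closed G.group_axioms)
  have "f \<in> hom (free_grp X) G"
    by (rule homI) (auto simp: f_abs cl fmul.abs_eq)
  moreover have "f (gen x) = v x" if "x \<in> X" for x
    using that by (simp add: gen.abs_eq f_abs v'_def)
  moreover have "f \<in> extensional (carrier (free_grp X))" by (simp add: f_def)
  moreover have "g = f" if g: "g \<in> hom (free_grp X) G" "g \<in> extensional (carrier (free_grp X))"
      "\<forall>x \<in> X. g (gen x) = v x" for g
  proof (rule extensionalityI[OF g(2)])
    show "f \<in> extensional (carrier (free_grp X))" by (simp add: f_def)
    interpret g: group_hom "free_grp X" G g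
      using g(1) G.group_axioms group_free_grp by (simp add: group_hom_def group_hom_axioms_def)
    have "g (abs_Theta_elt t) = gval G v' t" if "set_gterm t \<subseteq> X" for t
      using that
    proof (induction t)
      case (Var x)
      then show ?case using g(3) by (simp add: v'_def gen.abs_eq[symmetric])
    next
      case One
      then show ?case using g.hom_one by (simp add: fone.abs_eq[symmetric])
    next
      case (Inv t)
      then have "abs_Theta_elt t \<in> carrier (free_grp X)" by auto
      then show ?case
        using Inv g.hom_inv[of "abs_Theta_elt t"] inv_free_grp[of "abs_Theta_elt t" X]
        by (simp add: finv.abs_eq)
    next
      case (Mul s t)
      then have "abs_Theta_elt s \<in> carrier (free_grp X)" "abs_Theta_elt t \<in> carrier (free_grp X)"
        by auto
      then show ?case
        using Mul g.hom_mult[of "abs_Theta_elt s" "abs_Theta_elt t"]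
        by (simp add: fmul.abs_eq)
    qed
    then show "g a = f a" if "a \<in> carrier (free_grp X)" for a
      using that by (auto simp: f_abs)
  qed
  ultimately show ?thesis by blast
qed

lemma gen_in_free_grp_iff: "gen x \<in> carrier (free_grp X) \<longleftrightarrow> x \<in> X"
proof
  assume "gen x \<in> carrier (free_grp X)"
  then obtain t where t: "set_gterm t \<subseteq> X" "Theta_eq (Var x) t"
    by (auto simp: gen.abs_eq Theta_elt.abs_eq_iff)
  define B :: "bool monoid" where "B = \<lparr>carrier = UNIV, mult = (\<noteq>), one = False\<rparr>"
  interpret B: comm_group B
    by (rule comm_groupI) (auto simp: B_def)
  have inv: "inv\<^bsub>B\<^esub> b = b" for b by (rule B.inv_equality) (auto simp: B_def)
  have "Theta_group B"
    by (simp add: Theta_group_def B.group_axioms gcomm_def inv) (auto simp: B_def numeral_eq_Suc)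
  then have "gval B (\<lambda>y. y = x) (Var x) = gval B (\<lambda>y. y = x) t"
    using t(2) by (intro gval_cong) (simp_all add: B_def)
  moreover have "\<not> gval B (\<lambda>y. y = x) t" if "x \<notin> X"
    using t(1) that by (induction t) (auto simp: inv, auto simp: B_def)
  ultimately show "x \<in> X" by auto
qed (rule gen_in_free_grp)

theorem free_grp_inj: "free_grp X = free_grp Y \<longleftrightarrow> X = Y"
proof
  assume "free_grp X = free_grp Y"
  then have "{x. gen x \<in> carrier (free_grp X)} = {x. gen x \<in> carrier (free_grp Y)}" by simp
  then show "X = Y" by (simp only: gen_in_free_grp_iff Collect_mem_eq)
qed simp


section \<open>The category of free groups of finite rank and its automorphisms\<close>

definition objects :: "'x set \<Rightarrow> 'x grp set" where
  "objects X0 = free_grp ` {X. finite X \<and> X \<subseteq> X0}"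

text \<open>An arrow is a triple (source, map, target); the map is extensional, so that equality of
  arrows is equality of homomorphisms.\<close>

type_synonym 'x arrow = "'x grp \<times> ('x Theta_elt \<Rightarrow> 'x Theta_elt) \<times> 'x grp"

definition arrows :: "'x set \<Rightarrow> 'x arrow set" where
  "arrows X0 = {(A, f, B). A \<in> objects X0 \<and> B \<in> objects X0 \<and>
                           f \<in> hom A B \<and> f \<in> extensional (carrier A)}"

definition source :: "'x arrow \<Rightarrow> 'x grp" where
  "source m = fst m"

definition target :: "'x arrow \<Rightarrow> 'x grp" where
  "target m = snd (snd m)"

definition id_arrow :: "'x grp \<Rightarrow> 'x arrow" where
  "id_arrow A = (A, \<lambda>a \<in> carrier A. a, A)"

definition comp_arrow :: "'x arrow \<Rightarrow> 'x arrow \<Rightarrow> 'x arrow" where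
  "comp_arrow n m = (source m, compose (carrier (source m)) (fst (snd n)) (fst (snd m)), target n)"

text \<open>An endofunctor is a pair (action on objects, action on arrows), both extensional.\<close>

type_synonym 'x endofun = "('x grp \<Rightarrow> 'x grp) \<times> ('x arrow \<Rightarrow> 'x arrow)"

definition endofunctors :: "'x set \<Rightarrow> 'x endofun set" where
  "endofunctors X0 = {(P, Q).
     P \<in> objects X0 \<rightarrow>\<^sub>E objects X0 \<and> Q \<in> arrows X0 \<rightarrow>\<^sub>E arrows X0 \<and>
     (\<forall>m \<in> arrows X0. source (Q m) = P (source m) \<and> target (Q m) = P (target m)) \<and>
     (\<forall>A \<in> objects X0. Q (id_arrow A) = id_arrow (P A)) \<and>
     (\<forall>m \<in> arrows X0. \<forall>n \<in> arrows X0. source n = target m \<longrightarrow>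
        Q (comp_arrow n m) = comp_arrow (Q n) (Q m))}"

definition End_Theta0 :: "'x set \<Rightarrow> 'x endofun monoid" where
  "End_Theta0 X0 = \<lparr>carrier = endofunctors X0,
     mult = (\<lambda>S T. (compose (objects X0) (fst S) (fst T), compose (arrows X0) (snd S) (snd T))),
     one = (\<lambda>A \<in> objects X0. A, \<lambda>m \<in> arrows X0. m)\<rparr>"

definition Aut_Theta0 :: "'x set \<Rightarrow> 'x endofun monoid" where
  "Aut_Theta0 X0 = units_of (End_Theta0 X0)"

lemma id_arrow_in: "A \<in> objects X0 \<Longrightarrow> id_arrow A \<in> arrows X0"
  by (auto simp: arrows_def id_arrow_def hom_def objects_def fmul_in_free_grp
      simp del: free_grp_simps(1))

lemma comp_arrow_in:
  assumes "m \<in> arrows X0" "n \<in> arrows X0" "source n = target m"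
  shows "comp_arrow n m \<in> arrows X0"
proof -
  obtain A f B g C where m: "m = (A, f, B)" and n: "n = (B, g, C)"
    using assms(3) by (cases m, cases n) (auto simp: source_def target_def)
  obtain X where "A = free_grp X"
    using assms(1) by (auto simp: m arrows_def objects_def)
  then have "group A" using group_free_grp by simp
  then have "compose (carrier A) g f \<in> hom A C"
    using assms(1,2) group.hom_compose[of A f B g C]
    by (auto simp: m n arrows_def compose_def hom_def group.is_monoid Pi_iff
        intro: monoid.m_closed)
  then show ?thesis
    using assms(1,2) by (auto simp: m n arrows_def comp_arrow_def source_def target_def)
qed

lemma source_in: "m \<in> arrows X0 \<Longrightarrow> source m \<in> objects X0"
  and target_in: "m \<in> arrows X0 \<Longrightarrow> target m \<in> objects X0"
  by (auto simp: arrows_def source_def target_def)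

lemma comp_endofunctor:
  assumes "(P, Q) \<in> endofunctors X0" "(P', Q') \<in> endofunctors X0"
  shows "(compose (objects X0) P P', compose (arrows X0) Q Q') \<in> endofunctors X0"
proof -
  have Q': "Q' m \<in> arrows X0" if "m \<in> arrows X0" for m
    using assms(2) that by (auto simp: endofunctors_def)
  have "compose (objects X0) P P' \<in> objects X0 \<rightarrow>\<^sub>E objects X0"
    using assms by (auto simp: endofunctors_def compose_def)
  moreover have "compose (arrows X0) Q Q' \<in> arrows X0 \<rightarrow>\<^sub>E arrows X0"
    using assms(1) Q' by (auto simp: endofunctors_def compose_def simp del: split_paired_All)
  moreover have "\<forall>m \<in> arrows X0.
      source (compose (arrows X0) Q Q' m) = compose (objects X0) P P' (source m) \<and>
      target (compose (arrows X0) Q Q' m) = compose (objects X0) P P' (target m)"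
    using assms Q' by (simp add: endofunctors_def compose_eq source_in target_in)
  moreover have "\<forall>A \<in> objects X0. compose (arrows X0) Q Q' (id_arrow A) =
      id_arrow (compose (objects X0) P P' A)"
    using assms by (auto simp: endofunctors_def compose_eq id_arrow_in)
  moreover have "compose (arrows X0) Q Q' (comp_arrow n m) =
      comp_arrow (compose (arrows X0) Q Q' n) (compose (arrows X0) Q Q' m)"
    if "m \<in> arrows X0" "n \<in> arrows X0" "source n = target m" for m n
  proof -
    have "source (Q' n) = target (Q' m)" "Q' (comp_arrow n m) = comp_arrow (Q' n) (Q' m)"
      using assms(2) that by (simp_all add: endofunctors_def)
    then show ?thesis
      using assms(1) that Q' by (simp add: endofunctors_def compose_eq comp_arrow_in)
  qed
  ultimately show ?thesis by (simp add: endofunctors_def)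
qed

lemma monoid_End_Theta0: "monoid (End_Theta0 X0)"
proof (rule monoidI)
  fix S T assume "S \<in> carrier (End_Theta0 X0)" "T \<in> carrier (End_Theta0 X0)"
  then show "S \<otimes>\<^bsub>End_Theta0 X0\<^esub> T \<in> carrier (End_Theta0 X0)"
    by (cases S, cases T) (simp add: End_Theta0_def comp_endofunctor)
next
  show "\<one>\<^bsub>End_Theta0 X0\<^esub> \<in> carrier (End_Theta0 X0)"
    by (simp add: End_Theta0_def endofunctors_def id_arrow_in comp_arrow_in source_in target_in)
next
  fix S T U
  assume "S \<in> carrier (End_Theta0 X0)" "T \<in> carrier (End_Theta0 X0)" "U \<in> carrier (End_Theta0 X0)"
  then show "S \<otimes>\<^bsub>End_Theta0 X0\<^esub> T \<otimes>\<^bsub>End_Theta0 X0\<^esub> U =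
             S \<otimes>\<^bsub>End_Theta0 X0\<^esub> (T \<otimes>\<^bsub>End_Theta0 X0\<^esub> U)"
    by (auto simp: End_Theta0_def endofunctors_def intro!: compose_assoc[symmetric])
next
  fix S assume "S \<in> carrier (End_Theta0 X0)"
  then obtain P Q where S: "S = (P, Q)"
    "P \<in> objects X0 \<rightarrow> objects X0" "P \<in> extensional (objects X0)"
    "Q \<in> arrows X0 \<rightarrow> arrows X0" "Q \<in> extensional (arrows X0)"
    by (cases S) (simp add: End_Theta0_def endofunctors_def PiE_def)
  then show "\<one>\<^bsub>End_Theta0 X0\<^esub> \<otimes>\<^bsub>End_Theta0 X0\<^esub> S = S" "S \<otimes>\<^bsub>End_Theta0 X0\<^esub> \<one>\<^bsub>End_Theta0 X0\<^esub> = S"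
    using Id_compose[OF S(2,3)] compose_Id[OF S(2,3)] Id_compose[OF S(4,5)] compose_Id[OF S(4,5)]
    by (simp_all add: End_Theta0_def)
qed

theorem group_Aut_Theta0: "group (Aut_Theta0 X0)"
  unfolding Aut_Theta0_def by (rule monoid.units_group[OF monoid_End_Theta0])


subsection \<open>Inner and strongly stable automorphisms\<close>

text \<open>For \<open>f : A \<rightarrow> B\<close> and bijections \<open>s A : A \<rightarrow> A'\<close>, \<open>s B : B \<rightarrow> B'\<close> this is the arrow
  \<open>s B \<circ> f \<circ> (s A)\<^sup>-\<^sup>1 : A' \<rightarrow> B'\<close>.\<close>

definition conj_arrow ::
  "('x grp \<Rightarrow> 'x Theta_elt \<Rightarrow> 'x Theta_elt) \<Rightarrow> ('x grp \<Rightarrow> 'x grp) \<Rightarrow> 'x arrow \<Rightarrow> 'x arrow" where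
  "conj_arrow s P = (\<lambda>(A, f, B).
     (P A, \<lambda>a \<in> carrier (P A). s B (f (inv_into (carrier A) (s A) a)), P B))"

definition inner_auts :: "'x set \<Rightarrow> 'x endofun set" where
  "inner_auts X0 = {(P, Q) \<in> carrier (Aut_Theta0 X0).
     \<exists>s. (\<forall>A \<in> objects X0. s A \<in> iso A (P A)) \<and>
         (\<forall>m \<in> arrows X0. Q m = conj_arrow s P m)}"

definition strongly_stable_auts :: "'x set \<Rightarrow> 'x endofun set" where
  "strongly_stable_auts X0 = {(P, Q) \<in> carrier (Aut_Theta0 X0).
     (\<forall>A \<in> objects X0. P A = A) \<and>
     (\<exists>s. (\<forall>A \<in> objects X0. bij_betw (s A) (carrier A) (carrier A)) \<and>
          (\<forall>m \<in> arrows X0. Q m = conj_arrow s P m) \<and>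
          (\<forall>X. finite X \<and> X \<subseteq> X0 \<longrightarrow> (\<forall>x \<in> X. s (free_grp X) (gen x) = gen x)))}"


section \<open>Systems of words\<close>

text \<open>The letters \<open>x\<close>, \<open>y\<close> of the words are the variables \<open>0\<close>, \<open>1\<close>.\<close>

record word_system =
  w_one :: "nat Theta_elt"
  w_inv :: "nat Theta_elt"
  w_mul :: "nat Theta_elt"

definition is_word_system :: "word_system \<Rightarrow> bool" where
  "is_word_system W \<longleftrightarrow> w_one W \<in> carrier (free_grp {}) \<and> w_inv W \<in> carrier (free_grp {0}) \<and>
     w_mul W \<in> carrier (free_grp {0, 1})"

text \<open>The unit, inverse and multiplication of \<open>H\<^sub>W\<^sup>*\<close>. The values of the assignments on letters
  not occurring in the words are irrelevant.\<close>

definition star_one :: "word_system \<Rightarrow> ('a, 'm) monoid_scheme \<Rightarrow> 'a" where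
  "star_one W H = word_val H (\<lambda>_. \<one>\<^bsub>H\<^esub>) (w_one W)"

definition star_inv :: "word_system \<Rightarrow> ('a, 'm) monoid_scheme \<Rightarrow> 'a \<Rightarrow> 'a" where
  "star_inv W H h = word_val H (\<lambda>_. h) (w_inv W)"

definition star_mul :: "word_system \<Rightarrow> ('a, 'm) monoid_scheme \<Rightarrow> 'a \<Rightarrow> 'a \<Rightarrow> 'a" where
  "star_mul W H h k = word_val H (\<lambda>i. if i = 0 then h else k) (w_mul W)"

text \<open>Isomorphisms of algebras \<open>H \<rightarrow> H\<^sub>W\<^sup>*\<close>, for the signature of unit, inverse and
  multiplication.\<close>

definition star_iso :: "word_system \<Rightarrow> ('a, 'm) monoid_scheme \<Rightarrow> ('a \<Rightarrow> 'a) set" where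
  "star_iso W H = {s. bij_betw s (carrier H) (carrier H) \<and>
     s \<one>\<^bsub>H\<^esub> = star_one W H \<and>
     (\<forall>h \<in> carrier H. s (inv\<^bsub>H\<^esub> h) = star_inv W H (s h)) \<and>
     (\<forall>h \<in> carrier H. \<forall>k \<in> carrier H. s (h \<otimes>\<^bsub>H\<^esub> k) = star_mul W H (s h) (s k))}"

definition applicable :: "'x set \<Rightarrow> word_system \<Rightarrow> bool" where
  "applicable X0 W \<longleftrightarrow> is_word_system W \<and>
     (\<forall>X. finite X \<and> X \<subseteq> X0 \<longrightarrow>
        (\<exists>s \<in> star_iso W (free_grp X). \<forall>x \<in> X. s (gen x) = gen x))"

text \<open>The unique \<open>s\<^sub>F\<close> of an applicable system \<open>W\<close>; recall that \<open>X\<close> is determined by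
  \<^term>\<open>free_grp X\<close>.\<close>

definition word_bij :: "word_system \<Rightarrow> 'x grp \<Rightarrow> 'x Theta_elt \<Rightarrow> 'x Theta_elt" where
  "word_bij W A = (THE s. s \<in> extensional (carrier A) \<and> s \<in> star_iso W A \<and>
     (\<forall>X. A = free_grp X \<longrightarrow> (\<forall>x \<in> X. s (gen x) = gen x)))"

theorem word_bij:
  assumes "applicable X0 W" "finite X" "X \<subseteq> X0"
  shows "word_bij W (free_grp X) \<in> star_iso W (free_grp X)"
    and "x \<in> X \<Longrightarrow> word_bij W (free_grp X) (gen x) = gen x"
proof -
  let ?F = "free_grp X"
  let ?P = "\<lambda>s. s \<in> extensional (carrier ?F) \<and> s \<in> star_iso W ?F \<and>
     (\<forall>Y. ?F = free_grp Y \<longrightarrow> (\<forall>x \<in> Y. s (gen x) = gen x))"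
  have cl: "abs_Theta_elt t \<in> carrier ?F" if "set_gterm t \<subseteq> X" for t
    using that by auto
  interpret group ?F by (rule group_free_grp)
  obtain s where s: "s \<in> star_iso W ?F" "\<forall>x \<in> X. s (gen x) = gen x"
    using assms unfolding applicable_def by blast
  define r where "r = restrict s (carrier ?F)"
  have r: "r a = s a" if "a \<in> carrier ?F" for a
    using that by (simp only: r_def restrict_apply if_True)
  have s': "bij_betw s (carrier ?F) (carrier ?F)" "s \<one>\<^bsub>?F\<^esub> = star_one W ?F"
    "\<And>h. h \<in> carrier ?F \<Longrightarrow> s (inv\<^bsub>?F\<^esub> h) = star_inv W ?F (s h)"
    "\<And>h k. h \<in> carrier ?F \<Longrightarrow> k \<in> carrier ?F \<Longrightarrow> s (h \<otimes>\<^bsub>?F\<^esub> k) = star_mul W ?F (s h) (s k)"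
    using s(1) unfolding star_iso_def by (simp_all only: mem_Collect_eq)
  have "bij_betw r (carrier ?F) (carrier ?F)"
    using s'(1) by (simp only: bij_betw_cong[OF r])
  then have "r \<in> star_iso W ?F"
    unfolding star_iso_def mem_Collect_eq
    by (intro conjI ballI) (simp_all only: r s' one_closed m_closed inv_closed)
  moreover have "r (gen x) = gen x" if "x \<in> X" for x
    using s(2) r[OF gen_in_free_grp[OF that]] that by simp
  moreover have "r \<in> extensional (carrier ?F)"
    unfolding r_def by (rule restrict_extensional)
  ultimately have Pr: "?P r"
    by (simp only: free_grp_inj) blast
  have uniq: "f = g" if f: "?P f" and g: "?P g" for f g
  proof (rule extensionalityI)
    have gens: "f (gen x) = g (gen x)" if "x \<in> X" for x
      using conjunct2[OF conjunct2[OF f]] conjunct2[OF conjunct2[OF g]] that by simp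
    have ops: "h \<one>\<^bsub>?F\<^esub> = star_one W ?F"
      "\<And>a. a \<in> carrier ?F \<Longrightarrow> h (inv\<^bsub>?F\<^esub> a) = star_inv W ?F (h a)"
      "\<And>a b. a \<in> carrier ?F \<Longrightarrow> b \<in> carrier ?F \<Longrightarrow> h (a \<otimes>\<^bsub>?F\<^esub> b) = star_mul W ?F (h a) (h b)"
      if "h \<in> star_iso W ?F" for h
      using that unfolding star_iso_def by (simp_all only: mem_Collect_eq)
    note f' = ops[OF conjunct1[OF conjunct2[OF f]]] and g' = ops[OF conjunct1[OF conjunct2[OF g]]]
    have "f (abs_Theta_elt t) = g (abs_Theta_elt t)" if "set_gterm t \<subseteq> X" for t
      using that
    proof (induction t)
      case (Var x)
      then show ?case using gens by (simp add: gen.abs_eq[symmetric])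
    next
      case One
      then show ?case using f'(1) g'(1) by (simp add: fone.abs_eq[symmetric])
    next
      case (Inv t)
      then have "abs_Theta_elt (Inv t) = inv\<^bsub>?F\<^esub> abs_Theta_elt t" "abs_Theta_elt t \<in> carrier ?F"
        using inv_free_grp[OF cl, of t] by (simp_all add: finv.abs_eq)
      moreover have "f (abs_Theta_elt t) = g (abs_Theta_elt t)" using Inv by simp
      ultimately show ?case by (simp only: f' g')
    next
      case (Mul t u)
      then have "abs_Theta_elt (Mul t u) = abs_Theta_elt t \<otimes>\<^bsub>?F\<^esub> abs_Theta_elt u"
        "abs_Theta_elt t \<in> carrier ?F" "abs_Theta_elt u \<in> carrier ?F"
        by (simp_all add: fmul.abs_eq)
      moreover have "f (abs_Theta_elt t) = g (abs_Theta_elt t)"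
        "f (abs_Theta_elt u) = g (abs_Theta_elt u)"
        using Mul by simp_all
      ultimately show ?case by (simp only: f' g')
    qed
    then show "f a = g a" if "a \<in> carrier ?F" for a
      using that by auto
    show "f \<in> extensional (carrier ?F)" "g \<in> extensional (carrier ?F)"
      by (rule conjunct1[OF f], rule conjunct1[OF g])
  qed
  have P: "?P (word_bij W ?F)"
    unfolding word_bij_def
  proof (rule theI[where P = ?P])
    show "?P r" by (rule Pr)
    show "h = r" if "?P h" for h by (rule uniq[OF that Pr])
  qed
  show "word_bij W ?F \<in> star_iso W ?F"
    using P by (rule conjunct1[OF conjunct2])
  show "x \<in> X \<Longrightarrow> word_bij W ?F (gen x) = gen x"
    using conjunct2[OF conjunct2[OF P]] by simp
qed

definition word_aut :: "'x set \<Rightarrow> word_system \<Rightarrow> 'x endofun" where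
  "word_aut X0 W = (\<lambda>A \<in> objects X0. A,
     \<lambda>m \<in> arrows X0. conj_arrow (word_bij W) (\<lambda>A. A) m)"

definition W_alpha :: "nat \<Rightarrow> word_system" where
  "W_alpha \<alpha> = \<lparr>w_one = fone, w_inv = finv (gen 0),
     w_mul = abs_Theta_elt (Mul (Mul (Var 0) (Var 1)) (tpow (tcomm (Var 1) (Var 0)) \<alpha>))\<rparr>"

definition Phi :: "'x set \<Rightarrow> nat \<Rightarrow> 'x endofun" where
  "Phi X0 \<alpha> = word_aut X0 (W_alpha \<alpha>)"

lemma is_word_system_W_alpha: "is_word_system (W_alpha \<alpha>)"
proof -
  have "set_gterm (tpow t n) \<subseteq> set_gterm t" for t :: "nat gterm" and n
    by (induction n) auto
  from this[of "tcomm (Var 1) (Var 0)" \<alpha>] show ?thesis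
    using fone_in_free_grp[of "{}"] finv_in_free_grp[OF gen_in_free_grp[of 0 "{0}"]]
    by (auto simp: is_word_system_def W_alpha_def intro!: imageI)
qed

lemma star_W_alpha:
  assumes "Theta_group H" "h \<in> carrier H" "k \<in> carrier H"
  shows "star_one (W_alpha \<alpha>) H = \<one>\<^bsub>H\<^esub>" "star_inv (W_alpha \<alpha>) H h = inv\<^bsub>H\<^esub> h"
    "star_mul (W_alpha \<alpha>) H h k = h \<otimes>\<^bsub>H\<^esub> k \<otimes>\<^bsub>H\<^esub> gcomm H k h [^]\<^bsub>H\<^esub> \<alpha>"
proof -
  interpret group H using assms(1) by (simp add: Theta_group_def)
  show "star_one (W_alpha \<alpha>) H = \<one>\<^bsub>H\<^esub>" "star_inv (W_alpha \<alpha>) H h = inv\<^bsub>H\<^esub> h"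
    "star_mul (W_alpha \<alpha>) H h k = h \<otimes>\<^bsub>H\<^esub> k \<otimes>\<^bsub>H\<^esub> gcomm H k h [^]\<^bsub>H\<^esub> \<alpha>"
    unfolding star_one_def star_inv_def star_mul_def W_alpha_def
    using assms by (simp_all add: word_val_abs fone.abs_eq gen.abs_eq finv.abs_eq gval_tpow gval_tcomm)
qed

end

theory Submission
  imports Defs "HOL-Algebra.Generated_Groups" "HOL-Library.Numeral_Type"
begin

text \<open>An automorphism of the category acts on homomorphisms as conjugation by bijections \<open>s\<close> between the
  objects and their images, since the elements of a group are the homomorphisms into it from a free group
  of rank one, which the automorphism must preserve (\<open>aut_rank_one\<close>, \<open>aut_is_conjugation\<close>). These
  bijections turn the multiplication into the operation of some word \<open>w(x, y)\<close> (\<open>aut_mult_word\<close>), and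
  this operation has to be associative and unital in all groups of the variety.

  Which words are possible is a computation in the two-generated free group. Every element has a normal
  form \<open>x\<^sup>a y\<^sup>b\<close> times a product of powers of commutators of weight at most four in \<open>x\<close> and \<open>y\<close>
  (\<open>generate_normal_form\<close>), and for \<open>c = (y, x)\<close> the exponent \<open>4\<close> forces \<open>c\<^sup>2 = (c, x, x) (c, x, y) (c, y, y)\<close>.
  The unit laws give \<open>a = b = 1\<close>. Associativity in one group of order \<open>64\<close>, consisting of affine maps over
  \<open>(\<int>/4)[\<surd>(-2)]\<close>, leaves only the words \<open>xy(y, x)\<^sup>n\<close> with \<open>0 \<le> n < 4\<close> (\<open>associative_word\<close>).

  Conversely, the square of a commutator is central in groups of the variety and bilinear in the two
  arguments (\<open>commsq_mult_right\<close>). Hence \<open>xy(y, x)\<^sup>2\<close> is again a multiplication with the identities of the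
  variety, and repeating this twist restores the group (\<open>twist_twist\<close>). The same holds for
  \<open>xy(y, x) = yx\<close>, the opposite multiplication. So the words with \<open>n \<le> 2\<close> give automorphisms of order at
  most two.

  The word \<open>yx\<close> gives an inner automorphism because inversion is an isomorphism onto the opposite group that
  commutes with all homomorphisms; in the same way \<open>n = 3\<close> reduces to \<open>n = 2\<close>. On the other hand, a family
  of bijections that commutes with all homomorphisms consists of the maps \<open>a \<mapsto> a\<close> or \<open>a \<mapsto> a\<^sup>-\<^sup>1\<close>, so
  the bijections of a strongly stable automorphism that is inner are multiplicative or reverse products
  (\<open>inner_imp_hom_twist\<close>). This excludes \<open>n = 2\<close>, as commutators of order \<open>4\<close> exist. It follows that every
  automorphism is inner or becomes inner after composition with \<open>Phi X0 2\<close>, which is not inner itself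
  (\<open>aut_cases\<close>, \<open>Phi_2_not_inner\<close>).\<close>

section \<open>Commutator identities of the variety\<close>

context group
begin

lemma inv_m_cancel [simp]:
  assumes "x \<in> carrier G" "y \<in> carrier G"
  shows "inv x \<otimes> (x \<otimes> y) = y" "x \<otimes> (inv x \<otimes> y) = y"
  using assms by (simp_all add: m_assoc[symmetric])

lemma gcomm_closed [simp]:
  "\<lbrakk>x \<in> carrier G; y \<in> carrier G\<rbrakk> \<Longrightarrow> gcomm G x y \<in> carrier G"
  by (simp add: gcomm_def)

lemma gcomm_one [simp]:
  assumes "x \<in> carrier G"
  shows "gcomm G x \<one> = \<one>" "gcomm G \<one> x = \<one>" "gcomm G x x = \<one>"
  using assms by (simp_all add: gcomm_def m_assoc)

lemma gcomm_swap:
  assumes "x \<in> carrier G" "y \<in> carrier G"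
  shows "x \<otimes> y = y \<otimes> x \<otimes> gcomm G x y"
  using assms by (simp add: gcomm_def m_assoc)

lemma inv_gcomm:
  assumes "x \<in> carrier G" "y \<in> carrier G"
  shows "inv (gcomm G x y) = gcomm G y x"
  using assms by (simp add: gcomm_def m_assoc inv_mult_group)

lemma gcomm_eq_one_iff:
  assumes "x \<in> carrier G" "y \<in> carrier G"
  shows "gcomm G x y = \<one> \<longleftrightarrow> x \<otimes> y = y \<otimes> x"
  using assms r_cancel_one'[of "y \<otimes> x" "gcomm G x y"] by (auto simp: gcomm_swap[of x y])

definition conj_by :: "'a \<Rightarrow> 'a \<Rightarrow> 'a" where
  "conj_by g a = inv g \<otimes> a \<otimes> g"

lemma conj_closed [simp]: "\<lbrakk>g \<in> carrier G; a \<in> carrier G\<rbrakk> \<Longrightarrow> conj_by g a \<in> carrier G"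
  by (simp add: conj_by_def)

lemma conj_mult:
  assumes "g \<in> carrier G" "a \<in> carrier G" "b \<in> carrier G"
  shows "conj_by g (a \<otimes> b) = conj_by g a \<otimes> conj_by g b"
  using assms by (simp add: conj_by_def m_assoc)

lemma conj_pow:
  assumes "g \<in> carrier G" "a \<in> carrier G"
  shows "conj_by g (a [^] (n::nat)) = conj_by g a [^] n"
proof (induction n)
  case 0
  then show ?case using assms by (simp add: conj_by_def)
next
  case (Suc n)
  then show ?case using assms by (simp add: conj_mult)
qed

lemma conj_conj:
  assumes "g \<in> carrier G" "h \<in> carrier G" "a \<in> carrier G"
  shows "conj_by h (conj_by g a) = conj_by (g \<otimes> h) a"
  using assms by (simp add: conj_by_def m_assoc inv_mult_group)

lemma conj_eq_mult_gcomm: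
  assumes "g \<in> carrier G" "a \<in> carrier G"
  shows "conj_by g a = a \<otimes> gcomm G a g"
  using assms by (simp add: conj_by_def gcomm_def m_assoc)

lemma mult_conj:
  assumes "g \<in> carrier G" "a \<in> carrier G"
  shows "a \<otimes> g = g \<otimes> conj_by g a"
  using assms by (simp add: conj_by_def m_assoc)

lemma gcomm_mult_left:
  assumes "x \<in> carrier G" "y \<in> carrier G" "z \<in> carrier G"
  shows "gcomm G (x \<otimes> y) z = conj_by y (gcomm G x z) \<otimes> gcomm G y z"
  using assms by (simp add: conj_by_def gcomm_def m_assoc inv_mult_group)

end

locale theta_group = group +
  assumes exponent4: "x \<in> carrier G \<Longrightarrow> x [^] (4::nat) = \<one>"
    and gcomm_gcomm_eq_one:
      "\<lbrakk>a \<in> carrier G; b \<in> carrier G; c \<in> carrier G; d \<in> carrier G\<rbrakk>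
        \<Longrightarrow> gcomm G (gcomm G a b) (gcomm G c d) = \<one>"
    and nilpotent4:
      "\<lbrakk>a \<in> carrier G; b \<in> carrier G; c \<in> carrier G; d \<in> carrier G; e \<in> carrier G\<rbrakk>
        \<Longrightarrow> gcomm G (gcomm G (gcomm G (gcomm G a b) c) d) e = \<one>"

lemma Theta_group_iff: "Theta_group G \<longleftrightarrow> theta_group G"
  by (auto simp: Theta_group_def theta_group_def theta_group_axioms_def)

context theta_group
begin

lemma pow_mod_4:
  assumes "x \<in> carrier G"
  shows "x [^] (n::nat) = x [^] (n mod 4)"
proof -
  have "x [^] n = x [^] (4 * (n div 4) + n mod 4)" by simp
  also have "\<dots> = (x [^] (4::nat)) [^] (n div 4) \<otimes> x [^] (n mod 4)"
    using assms by (simp only: nat_pow_mult[symmetric] nat_pow_pow)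
  finally show ?thesis using assms by (simp add: exponent4 del: mult_div_mod_eq)
qed

lemma inv_eq_cube:
  assumes "x \<in> carrier G"
  shows "inv x = x [^] (3::nat)"
  using exponent4[OF assms] assms
  by (intro inv_equality) (simp_all add: numeral_eq_Suc)

definition commutators :: "'a set" where
  "commutators = {gcomm G x y |x y. x \<in> carrier G \<and> y \<in> carrier G}"

definition K :: "'a set" where
  "K = generate G commutators"

lemma commutators_subset: "commutators \<subseteq> carrier G"
  by (auto simp: commutators_def)

lemma K_subset: "K \<subseteq> carrier G"
  unfolding K_def using commutators_subset generate_in_carrier by blast

lemma K_carrier [simp]: "a \<in> K \<Longrightarrow> a \<in> carrier G"
  using K_subset by blast

lemma gcomm_in_K [simp]: "\<lbrakk>x \<in> carrier G; y \<in> carrier G\<rbrakk> \<Longrightarrow> gcomm G x y \<in> K"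
  unfolding K_def by (rule generate.incl) (auto simp: commutators_def)

lemma subgroup_K: "subgroup K G"
  unfolding K_def by (rule generate_is_subgroup[OF commutators_subset])

lemma one_in_K [simp]: "\<one> \<in> K"
  and mult_in_K [simp]: "\<lbrakk>a \<in> K; b \<in> K\<rbrakk> \<Longrightarrow> a \<otimes> b \<in> K"
  using subgroup_K by (auto simp: subgroup_def)

lemma pow_in_K [simp]: "a \<in> K \<Longrightarrow> a [^] (n::nat) \<in> K"
  by (induction n) auto

lemma K_commute:
  assumes "a \<in> K" "b \<in> K"
  shows "a \<otimes> b = b \<otimes> a"
proof -
  have *: "a \<otimes> x = x \<otimes> a" if "a \<in> generate G S" "S \<subseteq> carrier G" "x \<in> carrier G"
    "\<And>y. y \<in> S \<Longrightarrow> y \<otimes> x = x \<otimes> y" for a x S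
    using that(1)
  proof (induction rule: generate.induct)
    case (inv h)
    then have h: "h \<in> carrier G" "h \<otimes> x = x \<otimes> h" using that by auto
    then have "inv h \<otimes> (x \<otimes> h) \<otimes> inv h = inv h \<otimes> (h \<otimes> x) \<otimes> inv h" by simp
    then show ?case using h(1) that(3) by (simp add: m_assoc)
  next
    case (eng h1 h2)
    then have "h1 \<in> carrier G" "h2 \<in> carrier G"
      using that(2) generate_in_carrier by blast+
    then show ?case using eng(3,4) that(3) by (metis m_assoc)
  qed (use that in auto)
  have 1: "k \<otimes> x = x \<otimes> k" if "k \<in> K" "x \<in> commutators" for k x
    using that(1) unfolding K_def
  proof (rule *)
    show "x \<in> carrier G" using that commutators_subset by blast
    show "y \<otimes> x = x \<otimes> y" if "y \<in> commutators" for y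
      using that \<open>x \<in> commutators\<close> gcomm_gcomm_eq_one
      by (auto simp: commutators_def gcomm_eq_one_iff)
  qed (rule commutators_subset)
  show ?thesis
    using assms(1) unfolding K_def
  proof (rule *)
    show "y \<otimes> b = b \<otimes> y" if "y \<in> commutators" for y using 1[OF assms(2) that] by simp
  qed (use assms commutators_subset in auto)
qed

lemma K_lcommute:
  assumes "a \<in> K" "b \<in> K" "z \<in> carrier G"
  shows "a \<otimes> (b \<otimes> z) = b \<otimes> (a \<otimes> z)"
  using assms K_commute[OF assms(1,2)] by (metis K_carrier m_assoc)

lemma K_mult_pow:
  assumes "a \<in> K" "b \<in> K"
  shows "(a \<otimes> b) [^] (n::nat) = a [^] n \<otimes> b [^] n"
  using assms by (intro pow_mult_distrib K_commute) auto

lemma conj_in_K [simp]: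
  assumes "g \<in> carrier G" "a \<in> K"
  shows "conj_by g a \<in> K"
  using assms by (simp add: conj_eq_mult_gcomm)

lemma conj_K:
  assumes "a \<in> K" "b \<in> K"
  shows "conj_by a b = b"
  using assms K_commute[of b a] by (simp add: conj_by_def m_assoc)

text \<open>Conjugation on \<open>K\<close> factors through the abelian quotient by \<open>K\<close>, since the elements of
  \<open>K\<close> commute with each other.\<close>

lemma conj_K_commute:
  assumes "a \<in> K" "x \<in> carrier G" "y \<in> carrier G"
  shows "conj_by x (conj_by y a) = conj_by y (conj_by x a)"
proof -
  have "conj_by x (conj_by y a) = conj_by (x \<otimes> y \<otimes> gcomm G y x) a"
    using assms by (simp add: conj_conj gcomm_swap[of y x])
  also have "\<dots> = conj_by (gcomm G y x) (conj_by (x \<otimes> y) a)"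
    using assms by (simp add: conj_conj)
  also have "\<dots> = conj_by y (conj_by x a)"
    using assms by (simp add: conj_K conj_conj)
  finally show ?thesis .
qed

lemma gcomm_commutator_commute:
  assumes "c \<in> K" "x \<in> carrier G" "y \<in> carrier G"
  shows "gcomm G (gcomm G c x) y = gcomm G (gcomm G c y) x"
proof -
  have e: "conj_by t (conj_by s c) = c \<otimes> gcomm G c t \<otimes> (gcomm G c s \<otimes> gcomm G (gcomm G c s) t)"
    if "s \<in> carrier G" "t \<in> carrier G" for s t
    using assms that by (simp add: conj_eq_mult_gcomm[of s c] conj_mult)
      (simp add: conj_eq_mult_gcomm)
  have "c \<otimes> gcomm G c y \<otimes> gcomm G c x \<otimes> gcomm G (gcomm G c x) y =
      c \<otimes> gcomm G c x \<otimes> gcomm G c y \<otimes> gcomm G (gcomm G c y) x"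
    using assms conj_K_commute[of c y x] e[of x y] e[of y x] by (simp add: m_assoc)
  moreover have "c \<otimes> gcomm G c x \<otimes> gcomm G c y = c \<otimes> gcomm G c y \<otimes> gcomm G c x"
    using assms K_commute[of "gcomm G c x" "gcomm G c y"] by (simp add: m_assoc)
  ultimately show ?thesis
    using assms by simp
qed

text \<open>Let \<open>c = (a, b)\<close>. Expanding \<open>(zc)\<^sup>4 = 1\<close> in the abelian normal subgroup \<open>K\<close> gives, in additive
  notation, \<open>(1 + t + t\<^sup>2 + t\<^sup>3) c = 0\<close>, where \<open>t = 1 + N\<close> is conjugation by \<open>z\<close>. The left hand side is
  \<open>4c + 6Nc + 4N\<^sup>2c + N\<^sup>3c\<close>, in which \<open>N\<^sup>3c\<close> vanishes by nilpotency and multiples of \<open>4\<close> by the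
  exponent, so \<open>2Nc = 0\<close>.\<close>

lemma gcomm_commutator_square:
  assumes "a \<in> carrier G" "b \<in> carrier G" "z \<in> carrier G"
  shows "gcomm G (gcomm G a b) z [^] (2::nat) = \<one>"
proof -
  define c where "c = gcomm G a b"
  define p where "p = gcomm G c z"
  define q where "q = gcomm G p z"
  have K: "c \<in> K" "p \<in> K" "q \<in> K" using assms by (simp_all add: c_def p_def q_def)
  have G: "c \<in> carrier G" "p \<in> carrier G" "q \<in> carrier G" using K by simp_all
  have cc: "conj_by z c = c \<otimes> p" using G assms by (simp add: p_def conj_eq_mult_gcomm)
  have cp: "conj_by z p = p \<otimes> q" using G assms by (simp add: q_def conj_eq_mult_gcomm)
  have cq: "conj_by z q = q"
    using G assms nilpotent4[of a b z z z] by (simp add: q_def p_def c_def conj_eq_mult_gcomm)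
  note K_ac = m_assoc K_commute K_lcommute
  have "\<one> = (z \<otimes> c) [^] (4::nat)" using G assms exponent4 by simp
  also have "\<dots> = z [^] (4::nat) \<otimes> (conj_by z (conj_by z (conj_by z c)) \<otimes> conj_by z (conj_by z c) \<otimes> conj_by z c \<otimes> c)"
    using G assms by (simp add: numeral_eq_Suc conj_by_def m_assoc)
  also have "\<dots> = conj_by z (conj_by z (conj_by z c)) \<otimes> conj_by z (conj_by z c) \<otimes> conj_by z c \<otimes> c"
    using G assms exponent4 by simp
  also have "\<dots> = c [^] (4::nat) \<otimes> p [^] (4::nat) \<otimes> p [^] (2::nat) \<otimes> q [^] (4::nat)"
    using K G assms by (simp add: cc conj_mult cp cq numeral_eq_Suc K_ac)
  also have "\<dots> = p [^] (2::nat)" using G exponent4 by simp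
  finally show ?thesis by (simp add: p_def c_def)
qed

text \<open>The square of a commutator is central, because conjugation changes the commutator by a factor of
  order two; consequently it depends bilinearly on the two arguments. The order of the arguments is
  that of \<open>(y, x)\<close> in the words \<open>xy(y, x)\<^sup>n\<close>.\<close>

definition commsq :: "'a \<Rightarrow> 'a \<Rightarrow> 'a" where
  "commsq x y = gcomm G y x [^] (2::nat)"

lemma commsq_in_K [simp]: "\<lbrakk>x \<in> carrier G; y \<in> carrier G\<rbrakk> \<Longrightarrow> commsq x y \<in> K"
  by (simp add: commsq_def)

lemma conj_commsq:
  assumes "x \<in> carrier G" "y \<in> carrier G" "z \<in> carrier G"
  shows "conj_by z (commsq x y) = commsq x y"
proof -
  have "conj_by z (commsq x y) = (gcomm G y x \<otimes> gcomm G (gcomm G y x) z) [^] (2::nat)"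
    using assms by (simp add: commsq_def conj_pow) (simp add: conj_eq_mult_gcomm)
  then show ?thesis
    using assms by (simp add: commsq_def K_mult_pow gcomm_commutator_square)
qed

lemma commsq_central:
  assumes "x \<in> carrier G" "y \<in> carrier G" "z \<in> carrier G"
  shows "commsq x y \<otimes> z = z \<otimes> commsq x y"
  using assms by (simp add: mult_conj[of z] conj_commsq)

lemma commsq_square:
  assumes "x \<in> carrier G" "y \<in> carrier G"
  shows "commsq x y \<otimes> commsq x y = \<one>"
  using assms exponent4[of "gcomm G y x"] by (simp add: commsq_def numeral_eq_Suc m_assoc)

lemma inv_commsq:
  assumes "x \<in> carrier G" "y \<in> carrier G"
  shows "inv (commsq x y) = commsq x y"
  using assms commsq_square by (intro inv_equality) auto

lemma commsq_sym:
  assumes "x \<in> carrier G" "y \<in> carrier G"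
  shows "commsq y x = commsq x y"
  using assms inv_commsq[of x y] by (simp add: commsq_def nat_pow_inv[symmetric] inv_gcomm)

lemma commsq_mult_right:
  assumes "x \<in> carrier G" "y \<in> carrier G" "z \<in> carrier G"
  shows "commsq x (y \<otimes> z) = commsq x y \<otimes> commsq x z"
proof -
  have "conj_by z (gcomm G y x) [^] (2::nat) = gcomm G y x [^] (2::nat)"
    using assms conj_commsq[of x y z] by (simp add: commsq_def conj_pow)
  then show ?thesis
    using assms by (simp add: commsq_def gcomm_mult_left K_mult_pow)
qed

lemma commsq_mult_left:
  assumes "x \<in> carrier G" "y \<in> carrier G" "z \<in> carrier G"
  shows "commsq (x \<otimes> y) z = commsq x z \<otimes> commsq y z"
  using assms commsq_mult_right[of z x y] by (simp add: commsq_sym[of z])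

lemma commsq_one [simp]: "x \<in> carrier G \<Longrightarrow> commsq x \<one> = \<one>" "x \<in> carrier G \<Longrightarrow> commsq \<one> x = \<one>"
  by (simp_all add: commsq_def)

lemma commsq_self [simp]: "x \<in> carrier G \<Longrightarrow> commsq x x = \<one>"
  by (simp add: commsq_def)

lemma commsq_inv:
  assumes "x \<in> carrier G" "y \<in> carrier G"
  shows "commsq x (inv y) = commsq x y" "commsq (inv x) y = commsq x y"
proof -
  have *: "commsq a (inv b) = commsq a b" if "a \<in> carrier G" "b \<in> carrier G" for a b
  proof -
    have "commsq a (inv b) \<otimes> commsq a b = \<one>"
      using that commsq_mult_right[of a "inv b" b] by simp
    then have "inv (commsq a b) = commsq a (inv b)"
      using that by (intro inv_equality) auto
    then show ?thesis using that by (simp add: inv_commsq)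
  qed
  show "commsq x (inv y) = commsq x y" using assms * by simp
  show "commsq (inv x) y = commsq x y"
    using assms *[of y x] by (simp add: commsq_sym[of y])
qed

lemma commsq_commsq:
  assumes "x \<in> carrier G" "y \<in> carrier G" "z \<in> carrier G"
  shows "commsq z (commsq x y) = \<one>" "commsq (commsq x y) z = \<one>"
proof -
  have "gcomm G (commsq x y) z = \<one>"
    using commsq_central[OF assms] assms by (simp add: gcomm_eq_one_iff)
  then show "commsq z (commsq x y) = \<one>" by (simp add: commsq_def)
  then show "commsq (commsq x y) z = \<one>" using assms by (simp add: commsq_sym[of z])
qed

end

section \<open>Twisted multiplications\<close>

text \<open>The multiplication of \<open>H\<^sub>W\<^sup>*\<close> for the word \<open>xy(y, x)\<^sup>n\<close>.\<close>

definition twist :: "nat \<Rightarrow> ('a, 'm) monoid_scheme \<Rightarrow> 'a monoid" where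
  "twist n G = \<lparr>carrier = carrier G,
     mult = \<lambda>x y. x \<otimes>\<^bsub>G\<^esub> y \<otimes>\<^bsub>G\<^esub> gcomm G y x [^]\<^bsub>G\<^esub> n, one = \<one>\<^bsub>G\<^esub>\<rparr>"

lemma twist_simps [simp]:
  "carrier (twist n G) = carrier G"
  "x \<otimes>\<^bsub>twist n G\<^esub> y = x \<otimes>\<^bsub>G\<^esub> y \<otimes>\<^bsub>G\<^esub> gcomm G y x [^]\<^bsub>G\<^esub> n"
  "\<one>\<^bsub>twist n G\<^esub> = \<one>\<^bsub>G\<^esub>"
  by (simp_all add: twist_def)

lemma hom_gcomm:
  assumes "group G" "group H" "f \<in> hom G H" "x \<in> carrier G" "y \<in> carrier G"
  shows "f (gcomm G x y) = gcomm H (f x) (f y)"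
proof -
  interpret group_hom G H f
    using assms by (simp add: group_hom_def group_hom_axioms_def)
  show ?thesis using assms by (simp add: gcomm_def)
qed

lemma hom_twist:
  assumes "group G" "group H" "f \<in> hom G H"
  shows "f \<in> hom (twist n G) (twist n H)"
proof -
  interpret group_hom G H f
    using assms by (simp add: group_hom_def group_hom_axioms_def)
  show ?thesis
    by (rule homI) (simp_all add: hom_nat_pow hom_gcomm[OF assms])
qed

context theta_group
begin

lemma twist_1_mult:
  "\<lbrakk>x \<in> carrier G; y \<in> carrier G\<rbrakk> \<Longrightarrow> x \<otimes>\<^bsub>twist 1 G\<^esub> y = y \<otimes> x"
  by (simp add: gcomm_swap[of y x])

lemma twist_2_mult: "x \<otimes>\<^bsub>twist 2 G\<^esub> y = x \<otimes> y \<otimes> commsq x y"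
  by (simp add: commsq_def)

lemma twist_3_mult:
  assumes "x \<in> carrier G" "y \<in> carrier G"
  shows "x \<otimes>\<^bsub>twist 3 G\<^esub> y = y \<otimes> x \<otimes> commsq x y"
  using assms by (simp add: gcomm_swap[of y x] commsq_def numeral_eq_Suc m_assoc)

text \<open>Associativity is the cocycle identity for \<^const>\<open>commsq\<close>, which is bilinear with central values on
  which it vanishes in turn.\<close>

lemma group_twist_2: "group (twist 2 G)"
proof (rule groupI)
  show "x \<otimes>\<^bsub>twist 2 G\<^esub> y \<otimes>\<^bsub>twist 2 G\<^esub> z = x \<otimes>\<^bsub>twist 2 G\<^esub> (y \<otimes>\<^bsub>twist 2 G\<^esub> z)"
    if "x \<in> carrier (twist 2 G)" "y \<in> carrier (twist 2 G)" "z \<in> carrier (twist 2 G)" for x y z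
  proof -
    have xyz: "x \<in> carrier G" "y \<in> carrier G" "z \<in> carrier G" using that by simp_all
    then show ?thesis
      by (simp add: twist_2_mult commsq_mult_left commsq_mult_right commsq_commsq m_assoc
          commsq_central[of x y z] K_commute K_lcommute del: twist_simps(2))
  qed
  show "\<exists>y\<in>carrier (twist 2 G). y \<otimes>\<^bsub>twist 2 G\<^esub> x = \<one>\<^bsub>twist 2 G\<^esub>"
    if "x \<in> carrier (twist 2 G)" for x
    using that
    by (intro bexI[of _ "inv x"]) (simp_all add: twist_2_mult commsq_inv del: twist_simps(2))
qed (simp_all add: twist_2_mult del: twist_simps(2))

lemma inv_twist_2: "x \<in> carrier G \<Longrightarrow> inv\<^bsub>twist 2 G\<^esub> x = inv x"
  by (intro group.inv_equality[OF group_twist_2])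
    (simp_all add: twist_2_mult commsq_inv del: twist_simps(2))

text \<open>The correction terms collected along a commutator amount to \<open>commsq x y\<close> taken twice.\<close>

lemma gcomm_twist_2:
  assumes "x \<in> carrier G" "y \<in> carrier G"
  shows "gcomm (twist 2 G) x y = gcomm G x y"
proof -
  let ?z = "commsq x y"
  have z: "?z \<in> carrier G" "?z \<otimes> ?z = \<one>" using assms by (simp_all add: commsq_square)
  have "gcomm (twist 2 G) x y = inv x \<otimes> inv y \<otimes> ?z \<otimes> x \<otimes> ?z \<otimes> y"
    using assms z
    by (simp add: gcomm_def inv_twist_2 twist_2_mult commsq_mult_left commsq_inv commsq_commsq
        commsq_sym[of y x] del: twist_simps(2))
  also have "\<dots> = inv x \<otimes> inv y \<otimes> x \<otimes> ?z \<otimes> ?z \<otimes> y"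
    using assms z by (simp add: m_assoc commsq_central[of x y x])
  also have "\<dots> = gcomm G x y"
    using assms z by (simp add: gcomm_def m_assoc)
  finally show ?thesis .
qed

lemma pow_twist_2: "x \<in> carrier G \<Longrightarrow> x [^]\<^bsub>twist 2 G\<^esub> (n::nat) = x [^] n"
proof (induction n)
  case (Suc n)
  have "gcomm G x (x [^] n) = \<one>"
    using Suc.prems by (simp add: gcomm_eq_one_iff nat_pow_Suc2[symmetric])
  then show ?case using Suc by simp
qed simp

lemma theta_group_twist_2: "theta_group (twist 2 G)"
  by (intro theta_group.intro group_twist_2 theta_group_axioms.intro)
    (simp_all add: gcomm_twist_2 pow_twist_2 exponent4 gcomm_gcomm_eq_one nilpotent4)

end

text \<open>Identities pass to homomorphic images. This gives the opposite group, the case \<open>n = 1\<close>, as the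
  image of the group under inversion.\<close>

lemma theta_group_surj_hom:
  assumes "theta_group G" "group H" "f \<in> hom G H" "f ` carrier G = carrier H"
  shows "theta_group H"
proof -
  interpret theta_group G by fact
  interpret group_hom G H f
    using assms by (simp add: group_hom_def group_hom_axioms_def group_axioms)
  have gc: "f (gcomm G x y) = gcomm H (f x) (f y)" if "x \<in> carrier G" "y \<in> carrier G" for x y
    using that hom_gcomm[OF _ assms(2,3)] assms(1) by (simp add: theta_group_def)
  have 1: "f x [^]\<^bsub>H\<^esub> (4::nat) = \<one>\<^bsub>H\<^esub>" if "x \<in> carrier G" for x
    using that exponent4[of x] hom_nat_pow[of x 4] by simp
  have 2: "gcomm H (gcomm H (f a) (f b)) (gcomm H (f c) (f d)) = \<one>\<^bsub>H\<^esub>"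
    if "a \<in> carrier G" "b \<in> carrier G" "c \<in> carrier G" "d \<in> carrier G" for a b c d
    using that gcomm_gcomm_eq_one[of a b c d] by (simp add: gc[symmetric])
  have 3: "gcomm H (gcomm H (gcomm H (gcomm H (f a) (f b)) (f c)) (f d)) (f e) = \<one>\<^bsub>H\<^esub>"
    if "a \<in> carrier G" "b \<in> carrier G" "c \<in> carrier G" "d \<in> carrier G" "e \<in> carrier G"
    for a b c d e
    using that nilpotent4[of a b c d e] by (simp add: gc[symmetric])
  show ?thesis
    by (intro theta_group.intro theta_group_axioms.intro assms(2))
      (auto simp: assms(4)[symmetric] 1 2 3)
qed

context theta_group
begin

lemma theta_group_twist_0: "theta_group (twist 0 G)"
proof (rule theta_group_surj_hom[OF theta_group_axioms])
  show "group (twist 0 G)"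
    by (rule groupI) (auto simp: m_assoc intro: bexI[of _ "inv _"])
  show "(\<lambda>x. x) \<in> hom G (twist 0 G)"
    by (rule homI) simp_all
qed simp

lemma inv_hom_twist_1: "(\<lambda>x. inv x) \<in> hom G (twist 1 G)"
  by (rule homI) (simp_all only: twist_1_mult inv_closed inv_mult_group twist_simps(1))

lemma theta_group_twist_1: "theta_group (twist 1 G)"
proof (rule theta_group_surj_hom[OF theta_group_axioms _ inv_hom_twist_1])
  note [simp] = twist_1_mult and [simp del] = twist_simps(2)
  show "group (twist 1 G)"
  proof (rule groupI)
    show "\<exists>y\<in>carrier (twist 1 G). y \<otimes>\<^bsub>twist 1 G\<^esub> x = \<one>\<^bsub>twist 1 G\<^esub>"
      if "x \<in> carrier (twist 1 G)" for x
      using that by (intro bexI[of _ "inv x"]) (simp_all del: One_nat_def)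
  qed (simp_all add: m_assoc del: One_nat_def)
  show "(\<lambda>x. inv x) ` carrier G = carrier (twist 1 G)"
    by (auto intro!: image_eqI[where x = "inv _"])
qed

text \<open>For \<open>n = 2\<close>, twisting does not change commutators, and the factor \<open>commsq x y\<close> of order two is applied
  twice.\<close>

lemma twist_twist:
  assumes "n \<le> 2" "x \<in> carrier G" "y \<in> carrier G"
  shows "x \<otimes>\<^bsub>twist n (twist n G)\<^esub> y = x \<otimes> y"
proof -
  consider "n = 0" | "n = 1" | "n = 2" using assms(1) by linarith
  then show ?thesis
  proof cases
    case 1
    then show ?thesis using assms by simp
  next
    case 2
    interpret t: theta_group "twist 1 G" by (rule theta_group_twist_1)
    show ?thesis
      using assms t.twist_1_mult[of x y] twist_1_mult[of y x] by (simp only: 2 twist_simps(1))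
  next
    case 3
    interpret t: theta_group "twist 2 G" by (rule theta_group_twist_2)
    have e: "t.commsq x y = commsq x y"
      using assms by (simp add: t.commsq_def commsq_def gcomm_twist_2 pow_twist_2)
    have "x \<otimes>\<^bsub>twist 2 (twist 2 G)\<^esub> y = x \<otimes> y \<otimes> commsq x y \<otimes> commsq x y \<otimes> commsq (x \<otimes> y \<otimes> commsq x y) (commsq x y)"
      by (simp only: t.twist_2_mult e) (simp only: twist_2_mult)
    also have "\<dots> = x \<otimes> y"
      using assms by (simp add: m_assoc commsq_square commsq_commsq)
    finally show ?thesis by (simp only: 3)
  qed
qed

lemma theta_group_twist: "n \<le> 2 \<Longrightarrow> theta_group (twist n G)"
  using theta_group_twist_0 theta_group_twist_1 theta_group_twist_2
  by (metis One_nat_def le_SucE le_zero_eq numeral_2_eq_2)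

end

section \<open>Normal forms in two-generated groups\<close>

text \<open>The exponents belong to \<open>c = (y, x)\<close>, \<open>(c, x)\<close>, \<open>(c, y)\<close>, \<open>(c, x, x)\<close>, \<open>(c, x, y)\<close>, \<open>(c, y, y)\<close>. Under
  conjugation by \<open>x\<close> and \<open>y\<close> they change linearly, so that these words fill up the commutator subgroup of
  the group generated by \<open>x\<close> and \<open>y\<close>.\<close>

definition kword :: "('a, 'm) monoid_scheme \<Rightarrow> 'a \<Rightarrow> 'a \<Rightarrow> nat \<Rightarrow> nat \<Rightarrow> nat \<Rightarrow> nat \<Rightarrow> nat \<Rightarrow> nat \<Rightarrow> 'a" where
  "kword G x y i j k l m n =
     (let c = gcomm G y x; p = gcomm G c x; q = gcomm G c y in
      c [^]\<^bsub>G\<^esub> i \<otimes>\<^bsub>G\<^esub> p [^]\<^bsub>G\<^esub> j \<otimes>\<^bsub>G\<^esub> q [^]\<^bsub>G\<^esub> k \<otimes>\<^bsub>G\<^esub>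
      gcomm G p x [^]\<^bsub>G\<^esub> l \<otimes>\<^bsub>G\<^esub> gcomm G p y [^]\<^bsub>G\<^esub> m \<otimes>\<^bsub>G\<^esub> gcomm G q y [^]\<^bsub>G\<^esub> n)"

lemma hom_kword:
  assumes "group G" "group H" "f \<in> hom G H" "x \<in> carrier G" "y \<in> carrier G"
  shows "f (kword G x y i j k l m n) = kword H (f x) (f y) i j k l m n"
proof -
  interpret group_hom G H f
    using assms by (simp add: group_hom_def group_hom_axioms_def)
  show ?thesis
    using assms by (simp add: kword_def Let_def hom_gcomm[OF assms(1-3)] hom_nat_pow)
qed

lemma (in group) kword_one:
  "x \<in> carrier G \<Longrightarrow> kword G x \<one> i j k l m n = \<one>" "x \<in> carrier G \<Longrightarrow> kword G \<one> x i j k l m n = \<one>"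
  by (simp_all add: kword_def)

context theta_group
begin

context
  fixes x y
  assumes x: "x \<in> carrier G" and y: "y \<in> carrier G"
begin

private definition "c = gcomm G y x"
private definition "p = gcomm G c x"
private definition "q = gcomm G c y"
private definition "r = gcomm G p x"
private definition "u = gcomm G p y"
private definition "v = gcomm G q y"

private lemma in_K: "c \<in> K" "p \<in> K" "q \<in> K" "r \<in> K" "u \<in> K" "v \<in> K"
  using x y by (simp_all add: c_def p_def q_def r_def u_def v_def)

private lemmas in_G = in_K[THEN K_carrier]

private lemma kword_eq:
  "kword G x y i j k l m n =
    c [^] i \<otimes> p [^] j \<otimes> q [^] k \<otimes> r [^] l \<otimes> u [^] m \<otimes> v [^] n"
  by (simp add: kword_def Let_def c_def p_def q_def r_def u_def v_def)

private lemma conj_x: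
  "conj_by x c = c \<otimes> p" "conj_by x p = p \<otimes> r" "conj_by x q = q \<otimes> u" "conj_by x r = r" "conj_by x u = u" "conj_by x v = v"
  using x y in_G nilpotent4[of y x] gcomm_commutator_commute[of c x y]
  by (simp_all add: conj_eq_mult_gcomm c_def p_def q_def r_def u_def v_def)

private lemma conj_y:
  "conj_by y c = c \<otimes> q" "conj_by y p = p \<otimes> u" "conj_by y q = q \<otimes> v" "conj_by y r = r" "conj_by y u = u" "conj_by y v = v"
  using x y in_G nilpotent4[of y x]
  by (simp_all add: conj_eq_mult_gcomm c_def p_def q_def r_def u_def v_def)

private lemmas K_ac = m_assoc K_commute K_lcommute

private lemma squares:
  "p \<otimes> p = \<one>" "q \<otimes> q = \<one>" "r \<otimes> r = \<one>" "u \<otimes> u = \<one>" "v \<otimes> v = \<one>"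
  using x y gcomm_commutator_square
  by (simp_all add: p_def q_def r_def u_def v_def c_def numeral_eq_Suc)

private lemma kword_in_K [simp]: "kword G x y i j k l m n \<in> K"
  using in_K by (simp add: kword_eq)

private lemma kword_mult:
  "kword G x y i j k l m n \<otimes> kword G x y i' j' k' l' m' n' =
   kword G x y (i + i') (j + j') (k + k') (l + l') (m + m') (n + n')"
  using in_K in_G by (simp add: kword_eq nat_pow_mult[symmetric] K_ac)

private lemma conj_x_kword:
  "conj_by x (kword G x y i j k l m n) = kword G x y i (i + j) k (j + l) (k + m) n"
  using x in_K in_G
  by (simp add: kword_eq conj_mult conj_pow conj_x nat_pow_mult[symmetric] K_mult_pow K_ac)

private lemma conj_y_kword:
  "conj_by y (kword G x y i j k l m n) = kword G x y i j (i + k) l (j + m) (k + n)"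
  using y in_K in_G
  by (simp add: kword_eq conj_mult conj_pow conj_y nat_pow_mult[symmetric] K_mult_pow K_ac)

private lemma gcomm_pow_kword:
  "\<exists>i j k l m n. gcomm G (y [^] (s::nat)) x = kword G x y i j k l m n"
proof (induction s)
  case 0
  have "gcomm G (y [^] (0::nat)) x = kword G x y 0 0 0 0 0 0"
    using x by (simp add: kword_eq)
  then show ?case by blast
next
  case (Suc s)
  then obtain i j k l m n where "gcomm G (y [^] s) x = kword G x y i j k l m n" by blast
  moreover have "gcomm G y x = kword G x y 1 0 0 0 0 0"
    using in_G by (simp add: kword_eq) (simp add: c_def)
  ultimately have "gcomm G (y [^] Suc s) x = conj_by y (kword G x y i j k l m n) \<otimes> kword G x y 1 0 0 0 0 0"
    using x y by (simp add: gcomm_mult_left)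
  then show ?case unfolding conj_y_kword kword_mult by blast
qed

text \<open>This set contains the subgroup generated by \<open>x\<close> and \<open>y\<close> as soon as it is closed under multiplication
  by \<open>x\<close> and \<open>y\<close> from the right, because inverses are cubes.\<close>

private definition normal_forms :: "'a set" where
  "normal_forms = {x [^] (a::nat) \<otimes> y [^] (b::nat) \<otimes> kword G x y i j k l m n |a b i j k l m n. True}"

private lemma normal_forms_mult_y: "g \<in> normal_forms \<Longrightarrow> g \<otimes> y \<in> normal_forms"
proof -
  assume "g \<in> normal_forms"
  then obtain a b :: nat and i j k l m n
    where g: "g = x [^] a \<otimes> y [^] b \<otimes> kword G x y i j k l m n"
    by (auto simp: normal_forms_def)
  have "g \<otimes> y = x [^] a \<otimes> y [^] Suc b \<otimes> conj_by y (kword G x y i j k l m n)"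
    using x y mult_conj[of y "kword G x y i j k l m n"] by (simp add: g m_assoc)
  then show ?thesis
    unfolding conj_y_kword normal_forms_def by blast
qed

private lemma normal_forms_mult_x: "g \<in> normal_forms \<Longrightarrow> g \<otimes> x \<in> normal_forms"
proof -
  assume "g \<in> normal_forms"
  then obtain a b :: nat and i j k l m n
    where g: "g = x [^] a \<otimes> y [^] b \<otimes> kword G x y i j k l m n"
    by (auto simp: normal_forms_def)
  obtain i' j' k' l' m' n' where e: "gcomm G (y [^] b) x = kword G x y i' j' k' l' m' n'"
    using gcomm_pow_kword by blast
  have "g \<otimes> x = x [^] a \<otimes> (y [^] b \<otimes> x) \<otimes> conj_by x (kword G x y i j k l m n)"
    using x y mult_conj[of x "kword G x y i j k l m n"] by (simp add: g m_assoc)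
  also have "y [^] b \<otimes> x = x \<otimes> y [^] b \<otimes> kword G x y i' j' k' l' m' n'"
    using x y by (simp add: gcomm_swap[of "y [^] b" x] e)
  also have "x [^] a \<otimes> (x \<otimes> y [^] b \<otimes> kword G x y i' j' k' l' m' n')
      \<otimes> conj_by x (kword G x y i j k l m n)
    = x [^] Suc a \<otimes> y [^] b \<otimes> (kword G x y i' j' k' l' m' n' \<otimes> conj_by x (kword G x y i j k l m n))"
    using x y by (simp add: m_assoc)
  finally show ?thesis
    unfolding conj_x_kword kword_mult normal_forms_def by blast
qed

private lemma generate_subset_normal_forms: "generate G {x, y} \<subseteq> normal_forms"
proof
  fix g assume "g \<in> generate G {x, y}"
  then have "\<forall>h \<in> normal_forms. h \<otimes> g \<in> normal_forms"
  proof (induction rule: generate.induct)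
    case one
    have "normal_forms \<subseteq> carrier G" using x y by (auto simp: normal_forms_def)
    then show ?case by (auto simp: subset_iff)
  next
    case (incl h)
    then show ?case using normal_forms_mult_x normal_forms_mult_y by auto
  next
    case (inv h)
    then have h: "h \<in> carrier G" using x y by auto
    have "f \<otimes> inv h = f \<otimes> h \<otimes> h \<otimes> h" if "f \<in> normal_forms" for f
      using h x y that by (auto simp: inv_eq_cube numeral_eq_Suc m_assoc normal_forms_def)
    then show ?case using inv normal_forms_mult_x normal_forms_mult_y by auto
  next
    case (eng g h)
    then have "g \<in> carrier G" "h \<in> carrier G"
      using x y generate_in_carrier[of "{x, y}"] by auto
    moreover have "normal_forms \<subseteq> carrier G" using x y by (auto simp: normal_forms_def)
    ultimately show ?case using eng.IH by (auto simp: m_assoc[symmetric] subset_iff)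
  qed
  moreover have "\<one> \<in> normal_forms"
  proof -
    have "\<one> = x [^] (0::nat) \<otimes> y [^] (0::nat) \<otimes> kword G x y 0 0 0 0 0 0"
      by (simp add: kword_eq)
    then show ?thesis unfolding normal_forms_def by blast
  qed
  moreover have "g \<in> carrier G"
    using x y \<open>g \<in> generate G {x, y}\<close> generate_in_carrier[of "{x, y}"] by auto
  ultimately show "g \<in> normal_forms" by fastforce
qed

private lemma kword_mod_2:
  "kword G x y i j k l m n = kword G x y i (j mod 2) (k mod 2) (l mod 2) (m mod 2) (n mod 2)"
proof -
  have *: "a [^] s = a [^] (s mod 2)" if "a \<in> carrier G" "a \<otimes> a = \<one>" for a and s :: nat
  proof -
    have "a [^] s = a [^] (2 * (s div 2) + s mod 2)" by simp
    also have "\<dots> = (a [^] (2::nat)) [^] (s div 2) \<otimes> a [^] (s mod 2)"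
      using that by (simp only: nat_pow_mult[symmetric] nat_pow_pow)
    finally show ?thesis using that by (simp add: numeral_2_eq_2)
  qed
  show ?thesis
    unfolding kword_eq using in_G squares *[of p j] *[of q k] *[of r l] *[of u m] *[of v n] by simp
qed

text \<open>With \<open>N\<^sub>x\<close>, \<open>N\<^sub>y\<close> for \<open>c \<mapsto> (c, x)\<close>, \<open>c \<mapsto> (c, y)\<close> in additive notation, \<open>(xy)\<^sup>4 = 1\<close> expands to
  \<open>(6 + 4N\<^sub>x + 14N\<^sub>y + N\<^sub>x\<^sup>2 + 11N\<^sub>xN\<^sub>y + 11N\<^sub>y\<^sup>2) c = 0\<close>; here \<open>4c\<close>, \<open>2N\<^sub>xc\<close> and \<open>2N\<^sub>yc\<close> are zero.\<close>

private lemma gcomm_square: "c [^] (2::nat) = kword G x y 0 0 0 1 1 1"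
proof -
  define d where "d = kword G x y 2 1 0 0 0 0"
  \<comment> \<open>The conjugates of \<open>y\<close> by \<open>x\<close>, \<open>x\<^sup>2\<close> and \<open>x\<^sup>3\<close> are \<open>yc\<close>, \<open>yd\<close> and \<open>ye\<close>.\<close>
  define e where "e = kword G x y 3 3 0 1 0 0"
  have de: "d \<in> carrier G" "e \<in> carrier G" by (simp_all add: d_def e_def)
  have c: "c = kword G x y 1 0 0 0 0 0" using in_G by (simp add: kword_eq)
  have yc: "conj_by x y = y \<otimes> c" using x y by (simp add: conj_eq_mult_gcomm c_def)
  have cd: "c \<otimes> conj_by x c = d"
    unfolding c d_def conj_x_kword kword_mult by (simp add: numeral_eq_Suc)
  have ce: "c \<otimes> conj_by x d = e"
    unfolding c d_def e_def conj_x_kword kword_mult by (simp add: numeral_eq_Suc)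
  have yd: "conj_by x (y \<otimes> c) = y \<otimes> d" "conj_by x (y \<otimes> d) = y \<otimes> e"
    using x y in_G de by (simp_all add: conj_mult yc m_assoc flip: cd ce)
  have "\<one> = (x \<otimes> y) [^] (4::nat)" using x y exponent4 by simp
  also have "\<dots> = x [^] (4::nat) \<otimes> (conj_by x (conj_by x (conj_by x y)) \<otimes> conj_by x (conj_by x y) \<otimes> conj_by x y \<otimes> y)"
    using x y by (simp add: numeral_eq_Suc conj_by_def m_assoc)
  also have "\<dots> = y \<otimes> e \<otimes> (y \<otimes> d) \<otimes> (y \<otimes> c) \<otimes> y"
    using x y in_G de exponent4 by (simp add: yc yd)
  also have "\<dots> = y [^] (4::nat) \<otimes> (conj_by y (conj_by y (conj_by y e)) \<otimes> conj_by y (conj_by y d) \<otimes> conj_by y c)"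
    using x y in_G de by (simp add: numeral_eq_Suc conj_by_def m_assoc)
  also have "\<dots> = kword G x y 6 4 14 1 11 11"
    using x y in_G de exponent4
    by (simp add: d_def e_def c conj_y_kword kword_mult)
  also have "\<dots> = kword G x y 6 0 0 1 1 1" by (subst kword_mod_2) simp
  also have "\<dots> = c [^] (2::nat) \<otimes> kword G x y 0 0 0 1 1 1"
    using in_G exponent4[of c] nat_pow_mult[of c 4 2] by (simp add: kword_eq m_assoc)
  finally have "c [^] (2::nat) \<otimes> kword G x y 0 0 0 1 1 1 = \<one>" by simp
  moreover have "kword G x y 0 0 0 1 1 1 \<otimes> kword G x y 0 0 0 1 1 1 = kword G x y 0 0 0 0 0 0"
    unfolding kword_mult by (subst kword_mod_2) simp
  then have "kword G x y 0 0 0 1 1 1 \<otimes> kword G x y 0 0 0 1 1 1 = \<one>"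
    by (simp add: kword_eq)
  ultimately have "c [^] (2::nat) \<otimes> kword G x y 0 0 0 1 1 1 =
      kword G x y 0 0 0 1 1 1 \<otimes> kword G x y 0 0 0 1 1 1" by simp
  then show ?thesis using in_G by (subst (asm) right_cancel) simp_all
qed

lemma gcomm_square_kword:
  "gcomm G y x [^] (2::nat) = kword G x y 0 0 0 1 1 1"
  using gcomm_square by (simp add: c_def)

text \<open>As \<open>c\<^sup>2\<close> is itself a product of commutators of weight four, exponents \<open>0\<close> and \<open>1\<close> suffice, also for
  \<open>c\<close>, which may have order \<open>4\<close>.\<close>

private lemma kword_reduce:
  "kword G x y i j k l m n =
    kword G x y (i mod 2) (j mod 2) (k mod 2)
      ((l + i div 2) mod 2) ((m + i div 2) mod 2) ((n + i div 2) mod 2)"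
proof -
  have "c [^] (2 * h) = kword G x y 0 0 0 h h h" for h
  proof (induction h)
    case (Suc h)
    have "c [^] (2 * Suc h) = c [^] (2 * h) \<otimes> c [^] (2::nat)"
      using in_G by (simp add: nat_pow_mult)
    then show ?case unfolding Suc gcomm_square kword_mult by simp
  qed (simp add: kword_eq)
  then have h: "kword G x y (2 * h) 0 0 0 0 0 = kword G x y 0 0 0 h h h" for h
    using in_G by (simp add: kword_eq[of "2 * h"])
  have "kword G x y i j k l m n = kword G x y (i mod 2) j k l m n \<otimes> kword G x y (2 * (i div 2)) 0 0 0 0 0"
    unfolding kword_mult by simp
  also have "\<dots> = kword G x y (i mod 2) j k (l + i div 2) (m + i div 2) (n + i div 2)"
    unfolding h kword_mult by simp
  also note kword_mod_2
  finally show ?thesis .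
qed

lemma generate_normal_form:
  assumes "g \<in> generate G {x, y}"
  obtains a b i j k l m n :: nat
  where "g = x [^] a \<otimes> y [^] b \<otimes> kword G x y i j k l m n"
    and "i < 2" "j < 2" "k < 2" "l < 2" "m < 2" "n < 2"
proof -
  obtain a b i j k l m n where "g = x [^] (a::nat) \<otimes> y [^] (b::nat) \<otimes> kword G x y i j k l m n"
    using assms generate_subset_normal_forms by (auto simp: normal_forms_def)
  then have "g = x [^] a \<otimes> y [^] b \<otimes> kword G x y (i mod 2) (j mod 2) (k mod 2)
      ((l + i div 2) mod 2) ((m + i div 2) mod 2) ((n + i div 2) mod 2)"
    by (simp only: kword_reduce[of i j k l m n])
  then show ?thesis by (rule that) simp_all
qed

end
end

lemma carrier_free_grp: "carrier (free_grp X) = generate (free_grp X) (gen ` X)"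
proof
  interpret group "free_grp X" by (rule group_free_grp)
  have "abs_Theta_elt t \<in> generate (free_grp X) (gen ` X)" if "set_gterm t \<subseteq> X" for t
    using that
  proof (induction t)
    case (Var x)
    then show ?case by (auto simp: gen.abs_eq[symmetric] intro: generate.incl)
  next
    case One
    then show ?case using generate.one[of "free_grp X"] by (simp add: fone.abs_eq)
  next
    case (Inv t)
    then have "abs_Theta_elt t \<in> generate (free_grp X) (gen ` X)" by simp
    then have "inv\<^bsub>free_grp X\<^esub> abs_Theta_elt t \<in> generate (free_grp X) (gen ` X)"
      by (rule generate_m_inv_closed[rotated]) (auto intro: gen_in_free_grp simp del: free_grp_simps)
    moreover have "abs_Theta_elt t \<in> carrier (free_grp X)" using Inv by auto
    ultimately show ?case by (simp add: inv_free_grp finv.abs_eq)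
  next
    case (Mul t u)
    then have "abs_Theta_elt t \<otimes>\<^bsub>free_grp X\<^esub> abs_Theta_elt u \<in> generate (free_grp X) (gen ` X)"
      by (intro generate.eng) auto
    then show ?case by (simp add: fmul.abs_eq)
  qed
  then show "carrier (free_grp X) \<subseteq> generate (free_grp X) (gen ` X)" by auto
  show "generate (free_grp X) (gen ` X) \<subseteq> carrier (free_grp X)"
    using generate_incl[of "gen ` X"] gen_in_free_grp[of _ X] by (simp add: image_subset_iff del: free_grp_simps)
qed

section \<open>A test group of order 64\<close>

text \<open>The pair \<open>(\<sigma>, v)\<close> stands for the affine map \<open>r \<mapsto> r\<sigma> + v\<close>, and products are compositions from left to
  right; the linear parts are the powers of the fixed element \<open>t\<close>.\<close>

definition affine_grp :: "'a::comm_ring_1 \<Rightarrow> ('a \<times> 'a) monoid" where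
  "affine_grp t = \<lparr>carrier = range ((^) t) \<times> UNIV,
     mult = \<lambda>(\<sigma>, v) (\<tau>, w). (\<sigma> * \<tau>, v * \<tau> + w), one = (1, 0)\<rparr>"

lemma affine_grp_simps [simp]:
  "carrier (affine_grp t) = range ((^) t) \<times> UNIV"
  "(\<sigma>, v) \<otimes>\<^bsub>affine_grp t\<^esub> (\<tau>, w) = (\<sigma> * \<tau>, v * \<tau> + w)"
  "\<one>\<^bsub>affine_grp t\<^esub> = (1, 0)"
  by (simp_all add: affine_grp_def)

text \<open>These conditions make \<open>1 + \<tau> + \<tau>\<^sup>2 + \<tau>\<^sup>3\<close> vanish for every power \<open>\<tau>\<close> of \<open>t\<close>, as the exponent \<open>4\<close>
  requires. They also imply \<open>(t - 1)\<^sup>4 = 0\<close>, which bounds the nilpotency class.\<close>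

locale affine =
  fixes t :: "'a::comm_ring_1"
  assumes four: "(4::'a) = 0" and geom: "1 + t + t ^ 2 + t ^ 3 = 0" and geom2: "2 * (1 + t ^ 2) = 0"
begin

lemma t_power4: "t ^ 4 = 1"
proof -
  have "t ^ 4 - 1 = (t - 1) * (1 + t + t ^ 2 + t ^ 3)" by (simp add: algebra_simps power_numeral_reduce)
  then show ?thesis by (simp add: geom)
qed

lemma t_minus_1_power4: "(t - 1) ^ 4 = 0"
proof -
  have "(t - 1) ^ 4 = (t ^ 4 - 1) + 4 * (2 * t ^ 2 - t - t ^ 3) + 2 * (1 + t ^ 2) - 4 * t ^ 2"
    by (simp add: algebra_simps power_numeral_reduce)
  then show ?thesis using geom2 by (simp add: t_power4 four distrib_left)
qed

lemma range_pow: "range ((^) t) = {1, t, t ^ 2, t ^ 3}"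
proof -
  have "t ^ n = t ^ (n mod 4)" for n
  proof -
    have "t ^ n = t ^ (4 * (n div 4) + n mod 4)" by simp
    then show ?thesis by (simp only: power_add power_mult t_power4) simp
  qed
  moreover have "n mod 4 \<in> {0, 1, 2, 3}" for n :: nat by auto
  ultimately have "t ^ n \<in> (^) t ` {0, 1, 2, 3}" for n by (metis imageI)
  then show ?thesis by (auto intro: range_eqI[of _ _ 0] range_eqI[of _ _ 1])
qed

lemma geom_unit: "\<tau> \<in> range ((^) t) \<Longrightarrow> 1 + \<tau> + \<tau> ^ 2 + \<tau> ^ 3 = 0"
proof -
  assume "\<tau> \<in> range ((^) t)"
  moreover have "t ^ 6 = t ^ 2" "t ^ 9 = t"
    using t_power4 power_add[of t 4 2] power_add[of t 4 5] power_add[of t 4 1] by simp_all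
  ultimately show ?thesis
    using geom geom2 four t_power4
    by (auto simp: range_pow power_mult[symmetric] algebra_simps)
qed

lemma unit_power4: "\<tau> \<in> range ((^) t) \<Longrightarrow> \<tau> ^ 4 = 1"
  by (auto simp: power_mult[symmetric] mult.commute[of _ 4]) (simp add: power_mult t_power4)

lemma t_minus_1_dvd: "\<tau> \<in> range ((^) t) \<Longrightarrow> t - 1 dvd \<tau> - 1"
  using power_diff_1_eq[of t] by (auto simp: dvd_def)

sublocale group "affine_grp t"
proof (rule groupI)
  show "\<exists>y\<in>carrier (affine_grp t). y \<otimes>\<^bsub>affine_grp t\<^esub> x = \<one>\<^bsub>affine_grp t\<^esub>"
    if "x \<in> carrier (affine_grp t)" for x
  proof -
    obtain \<sigma> v where x1: "x = (\<sigma>, v)" by (cases x)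
    then have x: "x = (\<sigma>, v)" "\<sigma> \<in> range ((^) t)" using that by simp_all
    then have "(\<sigma> ^ 3, - v * \<sigma> ^ 3) \<in> carrier (affine_grp t)"
      by (auto simp: power_mult[symmetric])
    moreover have "(\<sigma> ^ 3, - v * \<sigma> ^ 3) \<otimes>\<^bsub>affine_grp t\<^esub> x = \<one>\<^bsub>affine_grp t\<^esub>"
      using unit_power4[OF x(2)] power_add[of \<sigma> 3 1] by (simp add: x(1) mult.assoc)
    ultimately show ?thesis by blast
  qed
qed (auto simp: algebra_simps power_add[symmetric] intro: range_eqI[of _ _ 0])

lemma gcomm_affine:
  assumes "\<sigma> \<in> range ((^) t)" "\<tau> \<in> range ((^) t)"
  shows "gcomm (affine_grp t) (\<sigma>, v) (\<tau>, w) = (1, v * (\<tau> - 1) - w * (\<sigma> - 1))"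
proof -
  let ?A = "affine_grp t" and ?z = "(1, v * (\<tau> - 1) - w * (\<sigma> - 1))"
  have one: "1 \<in> range ((^) t)" by (rule range_eqI[of _ _ 0]) simp
  let ?b = "(\<tau>, w) \<otimes>\<^bsub>?A\<^esub> (\<sigma>, v)"
  have mem: "(\<sigma>, v) \<in> carrier ?A" "(\<tau>, w) \<in> carrier ?A" "?z \<in> carrier ?A"
    using assms one by simp_all
  then have "?b \<otimes>\<^bsub>?A\<^esub> gcomm ?A (\<sigma>, v) (\<tau>, w) = ?b \<otimes>\<^bsub>?A\<^esub> ?z"
    using gcomm_swap[of "(\<sigma>, v)" "(\<tau>, w)"] by (simp add: algebra_simps)
  moreover have "?b \<in> carrier ?A" "gcomm ?A (\<sigma>, v) (\<tau>, w) \<in> carrier ?A"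
    using mem by (simp_all only: gcomm_closed m_closed)
  ultimately show ?thesis
    using mem(3) Units_l_cancel[of ?b "gcomm ?A (\<sigma>, v) (\<tau>, w)" ?z] by (simp only: Units_eq)
qed

text \<open>Commutators are translations by elements of the ideal generated by \<open>t - 1\<close>, and each further commutator
  multiplies the translation by another multiple of \<open>t - 1\<close>.\<close>

lemma theta_group: "theta_group (affine_grp t)"
proof (intro theta_group.intro theta_group_axioms.intro is_group)
  let ?A = "affine_grp t"
  have one: "1 \<in> range ((^) t)" by (rule range_eqI[of _ _ 0]) simp
  show "x [^]\<^bsub>?A\<^esub> (4::nat) = \<one>\<^bsub>?A\<^esub>" if "x \<in> carrier ?A" for x
  proof -
    obtain \<sigma> v where x1: "x = (\<sigma>, v)" by (cases x)
    then have x: "x = (\<sigma>, v)" "\<sigma> \<in> range ((^) t)" using that by simp_all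
    have "x [^]\<^bsub>?A\<^esub> (4::nat) = (\<sigma> ^ 4, v * (1 + \<sigma> + \<sigma> ^ 2 + \<sigma> ^ 3))"
      by (simp add: x(1) numeral_eq_Suc algebra_simps)
    then show ?thesis using x(2) by (simp add: geom_unit unit_power4)
  qed
  show "gcomm ?A (gcomm ?A a b) (gcomm ?A c d) = \<one>\<^bsub>?A\<^esub>"
    if "a \<in> carrier ?A" "b \<in> carrier ?A" "c \<in> carrier ?A" "d \<in> carrier ?A" for a b c d
    using that one by (auto simp: gcomm_affine simp del: image_iff)
  show "gcomm ?A (gcomm ?A (gcomm ?A (gcomm ?A a b) c) d) e = \<one>\<^bsub>?A\<^esub>"
    if "a \<in> carrier ?A" "b \<in> carrier ?A" "c \<in> carrier ?A" "d \<in> carrier ?A" "e \<in> carrier ?A"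
    for a b c d e
  proof -
    obtain a1 a2 b1 b2 c1 c2 d1 d2 e1 e2 where e: "a = (a1, a2)" "b = (b1, b2)" "c = (c1, c2)"
      "d = (d1, d2)" "e = (e1, e2)" by (metis surj_pair)
    have u: "a1 \<in> range ((^) t)" "b1 \<in> range ((^) t)" "c1 \<in> range ((^) t)" "d1 \<in> range ((^) t)"
      "e1 \<in> range ((^) t)"
      using that by (simp_all add: e)
    have "(t - 1) * (t - 1) * (t - 1) * (t - 1) dvd
        (a2 * (b1 - 1) - b2 * (a1 - 1)) * (c1 - 1) * (d1 - 1) * (e1 - 1)"
      using u by (intro mult_dvd_mono dvd_diff dvd_mult t_minus_1_dvd)
    then have "(a2 * (b1 - 1) - b2 * (a1 - 1)) * (c1 - 1) * (d1 - 1) * (e1 - 1) = 0"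
      using t_minus_1_power4 by (simp add: power_numeral_reduce mult.assoc)
    then show ?thesis
      using u one by (simp add: e gcomm_affine)
  qed
qed

lemma one_unit: "1 \<in> range ((^) t)"
  by (rule range_eqI[of _ _ 0]) simp

lemma pow_affine: "(1, v) [^]\<^bsub>affine_grp t\<^esub> (n::nat) = (1, of_nat n * v)"
  by (induction n) (simp_all add: algebra_simps)

lemma kword_affine:
  assumes "\<sigma> \<in> range ((^) t)" "\<tau> \<in> range ((^) t)"
  shows "kword (affine_grp t) (\<sigma>, v) (\<tau>, w) i j k l m n =
    (1, (w * (\<sigma> - 1) - v * (\<tau> - 1)) *
        (of_nat i + of_nat j * (\<sigma> - 1) + of_nat k * (\<tau> - 1) + of_nat l * (\<sigma> - 1) ^ 2
         + of_nat m * ((\<sigma> - 1) * (\<tau> - 1)) + of_nat n * (\<tau> - 1) ^ 2))"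
  using assms by (simp add: kword_def gcomm_affine one_unit pow_affine)
    (simp add: algebra_simps power2_eq_square)

end

text \<open>The ring \<open>(\<int>/4)[\<surd>(-2)]\<close>. For \<open>t = 1 + \<surd>(-2)\<close> one has \<open>(t - 1)\<^sup>2 = -2\<close>, so commutators of order \<open>4\<close> and
  nontrivial commutators of weight four occur in the affine group, which has order \<open>4 \<cdot> 16\<close>.\<close>

datatype zsqrt = Zsqrt (re: 4) (im: 4)

instantiation zsqrt :: comm_ring_1
begin

definition "0 = Zsqrt 0 0"
definition "1 = Zsqrt 1 0"
definition "z + w = Zsqrt (re z + re w) (im z + im w)"
definition "z - w = Zsqrt (re z - re w) (im z - im w)"
definition "- z = Zsqrt (- re z) (- im z)"
definition "z * w = Zsqrt (re z * re w - 2 * (im z * im w)) (re z * im w + im z * re w)"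

instance
  by standard
    (auto simp: zero_zsqrt_def one_zsqrt_def plus_zsqrt_def minus_zsqrt_def uminus_zsqrt_def
      times_zsqrt_def zsqrt.expand algebra_simps)

end

lemmas zsqrt_simps = zero_zsqrt_def one_zsqrt_def plus_zsqrt_def minus_zsqrt_def uminus_zsqrt_def
      times_zsqrt_def power_numeral_reduce

lemma numeral_zsqrt: "numeral k = Zsqrt (numeral k) 0"
proof -
  have "of_nat n = Zsqrt (of_nat n) 0" for n by (induction n) (simp_all add: zsqrt_simps)
  from this[of "numeral k"] show ?thesis by simp
qed

interpretation M64: affine "Zsqrt 1 1"
  by standard (simp_all add: zsqrt_simps numeral_zsqrt)

definition "M64 = affine_grp (Zsqrt 1 1)"

definition kword_op :: "('a, 'm) monoid_scheme \<Rightarrow> nat \<Rightarrow> nat \<Rightarrow> nat \<Rightarrow> nat \<Rightarrow> nat \<Rightarrow> nat \<Rightarrow> 'a \<Rightarrow> 'a \<Rightarrow> 'a" where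
  "kword_op G i j k l m n x y = x \<otimes>\<^bsub>G\<^esub> y \<otimes>\<^bsub>G\<^esub> kword G x y i j k l m n"

text \<open>Let \<open>x\<close> be the translation by \<open>1\<close> and \<open>y\<close> the multiplication by \<open>1 + \<surd>(-2)\<close>. Associativity for the
  triples \<open>(x, y, y)\<close> and \<open>(y, x, y)\<close> alone excludes all other cases, by inspection of the \<open>64\<close>
  possibilities. The case \<open>l = m = n = 1\<close> remains because it describes a factor \<open>c\<^sup>2\<close>.\<close>

lemma associative_exponents:
  fixes i j k l m n :: nat
  assumes bound: "i < 2" "j < 2" "k < 2" "l < 2" "m < 2" "n < 2"
    and assoc: "\<And>x y z. x \<in> carrier M64 \<Longrightarrow> y \<in> carrier M64 \<Longrightarrow> z \<in> carrier M64 \<Longrightarrow>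
      kword_op M64 i j k l m n (kword_op M64 i j k l m n x y) z = kword_op M64 i j k l m n x (kword_op M64 i j k l m n y z)"
  shows "j = 0 \<and> k = 0 \<and> m = l \<and> n = l"
proof -
  let ?x = "(1, 1) :: zsqrt \<times> zsqrt" and ?y = "(Zsqrt 1 1, 0) :: zsqrt \<times> zsqrt"
  have u: "Zsqrt 1 1 \<in> range ((^) (Zsqrt 1 1))" "Zsqrt 1 1 * Zsqrt 1 1 \<in> range ((^) (Zsqrt 1 1))"
    by (rule range_eqI[of _ _ 1], simp, rule range_eqI[of _ _ 2], simp add: power2_eq_square)
  have M: "?x \<in> carrier M64" "?y \<in> carrier M64" using u M64.one_unit by (auto simp: M64_def)
  have 1: "kword_op M64 i j k l m n (kword_op M64 i j k l m n ?x ?y) ?y = kword_op M64 i j k l m n ?x (kword_op M64 i j k l m n ?y ?y)"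
    by (intro assoc M)
  have 2: "kword_op M64 i j k l m n (kword_op M64 i j k l m n ?y ?x) ?y = kword_op M64 i j k l m n ?y (kword_op M64 i j k l m n ?x ?y)"
    by (intro assoc M)
  have b: "i = 0 \<or> i = 1" "j = 0 \<or> j = 1" "k = 0 \<or> k = 1" "l = 0 \<or> l = 1" "m = 0 \<or> m = 1" "n = 0 \<or> n = 1"
    using bound by auto
  show ?thesis
    using b 1 2 unfolding kword_op_def M64_def
    by (simp add: M64.kword_affine u M64.one_unit)
      (elim disjE; simp add: zsqrt_simps numeral_zsqrt)
qed

declare free_grp_simps [simp del]

lemma theta_group_free_grp: "theta_group (free_grp X)"
  using Theta_group_free_grp by (simp add: Theta_group_iff)

lemma theta_group_M64: "theta_group M64"
  unfolding M64_def by (rule M64.theta_group)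

definition Mx :: "zsqrt \<times> zsqrt" where "Mx = (1, 1)"
definition My :: "zsqrt \<times> zsqrt" where "My = (Zsqrt 1 1, 0)"

lemma Mxy_in_M64 [simp]: "Mx \<in> carrier M64" "My \<in> carrier M64"
  unfolding Mx_def My_def M64_def by (auto intro: range_eqI[of _ _ 0] range_eqI[of _ _ 1])

lemma M64_distinct:
  "Mx \<otimes>\<^bsub>M64\<^esub> My \<noteq> My \<otimes>\<^bsub>M64\<^esub> Mx"
  "Mx \<otimes>\<^bsub>twist 2 M64\<^esub> My \<noteq> Mx \<otimes>\<^bsub>M64\<^esub> My"
  "Mx \<otimes>\<^bsub>twist 2 M64\<^esub> My \<noteq> My \<otimes>\<^bsub>M64\<^esub> Mx"
  "Mx \<otimes>\<^bsub>M64\<^esub> Mx \<noteq> \<one>\<^bsub>M64\<^esub>"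
proof -
  have "Zsqrt 1 1 \<in> range ((^) (Zsqrt 1 1))" by (rule range_eqI[of _ _ 1]) simp
  then show "Mx \<otimes>\<^bsub>M64\<^esub> My \<noteq> My \<otimes>\<^bsub>M64\<^esub> Mx"
  "Mx \<otimes>\<^bsub>twist 2 M64\<^esub> My \<noteq> Mx \<otimes>\<^bsub>M64\<^esub> My"
  "Mx \<otimes>\<^bsub>twist 2 M64\<^esub> My \<noteq> My \<otimes>\<^bsub>M64\<^esub> Mx"
  "Mx \<otimes>\<^bsub>M64\<^esub> Mx \<noteq> \<one>\<^bsub>M64\<^esub>"
    by (simp_all add: Mx_def My_def M64_def M64.gcomm_affine M64.one_unit M64.pow_affine)
     (simp_all add: zsqrt_simps numeral_zsqrt)
qed

section \<open>Homomorphisms from free groups and associative words\<close>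

lemma hom_free_eqI:
  assumes "theta_group H" "f \<in> hom (free_grp X) H" "g \<in> hom (free_grp X) H"
    and "\<And>x. x \<in> X \<Longrightarrow> f (gen x) = g (gen x)" "a \<in> carrier (free_grp X)"
  shows "f a = g a"
proof -
  let ?F = "free_grp X"
  interpret F: group ?F by (rule group_free_grp)
  let ?P = "\<lambda>h. h \<in> hom ?F H \<and> h \<in> extensional (carrier ?F) \<and> (\<forall>x \<in> X. h (gen x) = f (gen x))"
  have "\<exists>!h. ?P h"
    using assms(1,2) by (intro free_grp_universal) (auto simp: Theta_group_iff hom_def gen_in_free_grp)
  moreover have "restrict h (carrier ?F) \<in> hom ?F H" if "h \<in> hom ?F H" for h
    using that F.m_closed by (auto simp: hom_def)
  then have "?P (restrict f (carrier ?F))" "?P (restrict g (carrier ?F))"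
    using assms(2-4) by (simp_all add: gen_in_free_grp)
  ultimately have "restrict f (carrier ?F) = restrict g (carrier ?F)"
    by (blast elim: ex1E)
  then show ?thesis using assms(5) by (metis restrict_apply')
qed

definition free_hom :: "'x set \<Rightarrow> ('a, 'm) monoid_scheme \<Rightarrow> ('x \<Rightarrow> 'a) \<Rightarrow> 'x Theta_elt \<Rightarrow> 'a" where
  "free_hom X H v = (THE f. f \<in> hom (free_grp X) H \<and> f \<in> extensional (carrier (free_grp X)) \<and>
     (\<forall>x \<in> X. f (gen x) = v x))"

lemma free_hom:
  assumes "theta_group H" "\<And>x. x \<in> X \<Longrightarrow> v x \<in> carrier H"
  shows free_hom_in_hom: "free_hom X H v \<in> hom (free_grp X) H"
    and free_hom_extensional: "free_hom X H v \<in> extensional (carrier (free_grp X))"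
    and free_hom_gen: "x \<in> X \<Longrightarrow> free_hom X H v (gen x) = v x"
proof -
  have "\<exists>!f. f \<in> hom (free_grp X) H \<and> f \<in> extensional (carrier (free_grp X)) \<and>
     (\<forall>x \<in> X. f (gen x) = v x)"
    using assms by (intro free_grp_universal) (auto simp: Theta_group_iff)
  from theI'[OF this] show "free_hom X H v \<in> hom (free_grp X) H"
    "free_hom X H v \<in> extensional (carrier (free_grp X))" "x \<in> X \<Longrightarrow> free_hom X H v (gen x) = v x"
    unfolding free_hom_def[symmetric] by auto
qed

definition word_op ::
  "'x \<Rightarrow> 'x \<Rightarrow> 'x Theta_elt \<Rightarrow> ('a, 'm) monoid_scheme \<Rightarrow> 'a \<Rightarrow> 'a \<Rightarrow> 'a" where
  "word_op x y w H g h = free_hom {x, y} H (\<lambda>z. if z = x then g else h) w"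

lemma word_op_hom:
  assumes "theta_group H" "g \<in> carrier H" "h \<in> carrier H" "x \<noteq> y"
  obtains f where "f \<in> hom (free_grp {x, y}) H" "f (gen x) = g" "f (gen y) = h"
    "\<And>w. word_op x y w H g h = f w"
  using free_hom[of H "{x, y}" "\<lambda>z. if z = x then g else h"] assms
  by (intro that[of "free_hom {x, y} H (\<lambda>z. if z = x then g else h)"]) (auto simp: word_op_def)

lemma word_op_eqI:
  assumes "theta_group H" "f \<in> hom (free_grp {x, y}) H" "f (gen x) = g" "f (gen y) = h" "x \<noteq> y"
    "w \<in> carrier (free_grp {x, y})"
  shows "word_op x y w H g h = f w"
proof -
  have "g \<in> carrier H" "h \<in> carrier H" using assms by (auto simp: hom_def gen_in_free_grp)
  then obtain e where e: "e \<in> hom (free_grp {x, y}) H" "e (gen x) = g" "e (gen y) = h"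
    "\<And>w. word_op x y w H g h = e w"
    using word_op_hom assms(1,5) by metis
  show ?thesis
    unfolding e(4) using assms(1) e(1) assms(2) _ assms(6)
    by (rule hom_free_eqI) (use assms e in auto)
qed

lemma hom_word_op:
  assumes "theta_group H" "theta_group H'" "f \<in> hom H H'" "g \<in> carrier H" "h \<in> carrier H" "x \<noteq> y"
    "w \<in> carrier (free_grp {x, y})"
  shows "f (word_op x y w H g h) = word_op x y w H' (f g) (f h)"
proof -
  obtain e where e: "e \<in> hom (free_grp {x, y}) H" "e (gen x) = g" "e (gen y) = h"
    "\<And>w. word_op x y w H g h = e w"
    using word_op_hom assms(1,4-6) by metis
  have "f \<circ> e \<in> hom (free_grp {x, y}) H'"
    using e(1) assms(3) by (auto simp: hom_def Pi_iff)
  from word_op_eqI[OF assms(2) this _ _ assms(6,7)] show ?thesis by (simp add: e)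
qed

lemma word_op_closed:
  assumes "theta_group H" "g \<in> carrier H" "h \<in> carrier H" "x \<noteq> y" "w \<in> carrier (free_grp {x, y})"
  shows "word_op x y w H g h \<in> carrier H"
proof -
  obtain e where e: "e \<in> hom (free_grp {x, y}) H" "e (gen x) = g" "e (gen y) = h"
    "\<And>w. word_op x y w H g h = e w"
    using word_op_hom assms(1-4) by metis
  then show ?thesis using assms(5) by (auto simp: hom_def)
qed

lemma word_op_twist:
  assumes "theta_group H" "g \<in> carrier H" "h \<in> carrier H" "x \<noteq> y"
  shows "word_op x y (gen x \<otimes>\<^bsub>twist n (free_grp {x, y})\<^esub> gen y) H g h = g \<otimes>\<^bsub>twist n H\<^esub> h"
proof -
  obtain e where e: "e \<in> hom (free_grp {x, y}) H" "e (gen x) = g" "e (gen y) = h"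
    "\<And>w. word_op x y w H g h = e w"
    using word_op_hom assms by metis
  have "e \<in> hom (twist n (free_grp {x, y})) (twist n H)"
    using assms(1) e(1) by (intro hom_twist group_free_grp) (simp add: theta_group_def)
  then have "e (gen x \<otimes>\<^bsub>twist n (free_grp {x, y})\<^esub> gen y) = e (gen x) \<otimes>\<^bsub>twist n H\<^esub> e (gen y)"
    by (rule hom_mult) (simp_all add: gen_in_free_grp)
  then show ?thesis by (simp add: e)
qed

text \<open>The unit laws reduce the normal form of \<open>w\<close> to \<open>xy\<close> times a product of commutators, and associativity
  in the single group \<^const>\<open>M64\<close> restricts the exponents of that product.\<close>

lemma associative_word:
  assumes xy: "x \<noteq> y" and w: "w \<in> carrier (free_grp {x, y})"
    and unit: "word_op x y w (free_grp {x, y}) (gen x) \<one>\<^bsub>free_grp {x, y}\<^esub> = gen x"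
      "word_op x y w (free_grp {x, y}) \<one>\<^bsub>free_grp {x, y}\<^esub> (gen y) = gen y"
    and assoc: "\<And>g h k. g \<in> carrier M64 \<Longrightarrow> h \<in> carrier M64 \<Longrightarrow> k \<in> carrier M64 \<Longrightarrow>
      word_op x y w M64 (word_op x y w M64 g h) k = word_op x y w M64 g (word_op x y w M64 h k)"
  shows "\<exists>n < 4. w = gen x \<otimes>\<^bsub>twist n (free_grp {x, y})\<^esub> gen y"
proof -
  let ?F = "free_grp {x, y}"
  interpret F: theta_group ?F by (rule theta_group_free_grp)
  interpret M64: theta_group M64 by (rule theta_group_M64)
  have g [simp]: "gen x \<in> carrier ?F" "gen y \<in> carrier ?F" "\<one>\<^bsub>free_grp {x, y}\<^esub> \<in> carrier ?F"
    by (simp_all add: gen_in_free_grp)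
  have "w \<in> generate ?F {gen x, gen y}" using w carrier_free_grp[of "{x, y}"] by simp
  with g(1,2) obtain a b i j k l m n :: nat
    where w': "w = gen x [^]\<^bsub>?F\<^esub> a \<otimes>\<^bsub>?F\<^esub> gen y [^]\<^bsub>?F\<^esub> b \<otimes>\<^bsub>?F\<^esub> kword ?F (gen x) (gen y) i j k l m n"
      and bound: "i < 2" "j < 2" "k < 2" "l < 2" "m < 2" "n < 2"
    by (rule F.generate_normal_form)
  have kw: "kword ?F (gen x) (gen y) i j k l m n \<in> carrier ?F"
    by (simp add: kword_def Let_def)
  have word: "word_op x y w H g h = g [^]\<^bsub>H\<^esub> a \<otimes>\<^bsub>H\<^esub> h [^]\<^bsub>H\<^esub> b \<otimes>\<^bsub>H\<^esub> kword H g h i j k l m n"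
    if H: "theta_group H" "g \<in> carrier H" "h \<in> carrier H" for H :: "('b, 'c) monoid_scheme" and g h
  proof -
    interpret H: theta_group H by fact
    obtain e where e: "e \<in> hom ?F H" "e (gen x) = g" "e (gen y) = h"
      "\<And>w. word_op x y w H g h = e w"
      using word_op_hom[OF H xy] by metis
    interpret e: group_hom ?F H e
      by unfold_locales (rule e(1))
    show ?thesis
      unfolding e(4) w' using kw
      by (simp add: e.hom_nat_pow hom_kword[OF F.is_group H.is_group e(1)] e(2,3))
  qed
  have "gen x [^]\<^bsub>?F\<^esub> a = gen x" "gen y [^]\<^bsub>?F\<^esub> b = gen y"
    using unit by (simp_all add: word F.is_group F.theta_group_axioms F.kword_one F.nat_pow_one)
  then have w1: "w = gen x \<otimes>\<^bsub>?F\<^esub> gen y \<otimes>\<^bsub>?F\<^esub> kword ?F (gen x) (gen y) i j k l m n"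
    by (simp add: w')
  have "word_op x y w M64 g h = kword_op M64 i j k l m n g h" if gh: "g \<in> carrier M64" "h \<in> carrier M64" for g h
  proof -
    obtain e where e: "e \<in> hom ?F M64" "e (gen x) = g" "e (gen y) = h"
      "\<And>w. word_op x y w M64 g h = e w"
      using word_op_hom[OF M64.theta_group_axioms gh xy] by metis
    interpret e: group_hom ?F M64 e
      by unfold_locales (rule e(1))
    show ?thesis
      unfolding e(4) w1 kword_op_def using kw
      by (simp add: hom_kword[OF F.is_group M64.is_group e(1)] e(2,3))
  qed
  moreover have "kword_op M64 i j k l m n g h \<in> carrier M64" if "g \<in> carrier M64" "h \<in> carrier M64" for g h
    using word_op_closed[OF M64.theta_group_axioms that xy w] calculation[OF that] by simp
  ultimately have *: "j = 0 \<and> k = 0 \<and> m = l \<and> n = l"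
    using assoc by (intro associative_exponents[of i j k l m n] bound) simp
  have "kword ?F (gen x) (gen y) i 0 0 l l l = gcomm ?F (gen y) (gen x) [^]\<^bsub>?F\<^esub> (i + 2 * l)"
  proof (cases "l = 0")
    case False
    then have "l = 1" using bound by simp
    have "kword ?F (gen x) (gen y) i 0 0 1 1 1 =
        gcomm ?F (gen y) (gen x) [^]\<^bsub>?F\<^esub> i \<otimes>\<^bsub>?F\<^esub> kword ?F (gen x) (gen y) 0 0 0 1 1 1"
      by (simp add: kword_def Let_def F.m_assoc)
    then show ?thesis
      using F.gcomm_square_kword[OF g(1,2)] F.nat_pow_mult[of "gcomm ?F (gen y) (gen x)" i 2]
      by (simp add: \<open>l = 1\<close>)
  qed (simp add: kword_def Let_def)
  then show ?thesis
    using w1 * bound by (intro exI[of _ "i + 2 * l"]) simp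
qed

section \<open>Endofunctors\<close>

lemma theta_group_object: "A \<in> objects X0 \<Longrightarrow> theta_group A"
  by (auto simp: objects_def theta_group_free_grp)

lemma group_object: "A \<in> objects X0 \<Longrightarrow> group A"
  using theta_group_object by (auto simp: theta_group_def)

text \<open>The map underlying the image of the arrow \<open>f : A \<rightarrow> B\<close>.\<close>

definition amap :: "'x endofun \<Rightarrow> 'x grp \<Rightarrow> ('x Theta_elt \<Rightarrow> 'x Theta_elt) \<Rightarrow> 'x grp \<Rightarrow> 'x Theta_elt \<Rightarrow> 'x Theta_elt" where
  "amap S A f B = fst (snd (snd S (A, f, B)))"

lemma arrowsD:
  assumes "(A, f, B) \<in> arrows X0"
  shows "A \<in> objects X0" "B \<in> objects X0" "f \<in> hom A B" "f \<in> extensional (carrier A)"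
  using assms by (auto simp: arrows_def)

lemma arrowsI:
  "\<lbrakk>A \<in> objects X0; B \<in> objects X0; f \<in> hom A B; f \<in> extensional (carrier A)\<rbrakk> \<Longrightarrow> (A, f, B) \<in> arrows X0"
  by (auto simp: arrows_def)

lemma comp_arrow_eq: "comp_arrow (B, g, C) (A, f, B) = (A, compose (carrier A) g f, C)"
  by (simp add: comp_arrow_def source_def target_def)

lemma arrow_free_hom:
  assumes "finite X" "X \<subseteq> X0" "A \<in> objects X0" "\<And>x. x \<in> X \<Longrightarrow> v x \<in> carrier A"
  shows "(free_grp X, free_hom X A v, A) \<in> arrows X0"
  using assms theta_group_object[OF assms(3)]
  by (intro arrowsI free_hom_in_hom free_hom_extensional) (auto simp: objects_def)

context
  fixes X0 :: "'x set" and S :: "'x endofun"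
  assumes S: "S \<in> endofunctors X0"
begin

lemma endo_object: "A \<in> objects X0 \<Longrightarrow> fst S A \<in> objects X0"
  using S by (cases S) (auto simp: endofunctors_def)

lemma endo_arrow:
  assumes "(A, f, B) \<in> arrows X0"
  shows "snd S (A, f, B) = (fst S A, amap S A f B, fst S B)"
    and "(fst S A, amap S A f B, fst S B) \<in> arrows X0"
proof -
  obtain P Q where PQ: "S = (P, Q)" by (cases S)
  then have "Q (A, f, B) \<in> arrows X0" "source (Q (A, f, B)) = P A" "target (Q (A, f, B)) = P B"
    using S assms by (auto simp: endofunctors_def source_def target_def simp del: split_paired_All
        dest!: bspec)
  then show "snd S (A, f, B) = (fst S A, amap S A f B, fst S B)"
    by (simp add: PQ amap_def source_def target_def prod_eq_iff)
  then show "(fst S A, amap S A f B, fst S B) \<in> arrows X0"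
    using \<open>Q (A, f, B) \<in> arrows X0\<close> PQ by simp
qed

lemma amap_hom: "(A, f, B) \<in> arrows X0 \<Longrightarrow> amap S A f B \<in> hom (fst S A) (fst S B)"
  using endo_arrow(2) by (rule arrowsD(3))

lemma amap_extensional: "(A, f, B) \<in> arrows X0 \<Longrightarrow> amap S A f B \<in> extensional (carrier (fst S A))"
  using endo_arrow(2) by (rule arrowsD(4))

lemma amap_comp:
  assumes "(A, f, B) \<in> arrows X0" "(B, g, C) \<in> arrows X0"
  shows "(A, compose (carrier A) g f, C) \<in> arrows X0"
    and "amap S A (compose (carrier A) g f) C =
      compose (carrier (fst S A)) (amap S B g C) (amap S A f B)"
proof -
  have st: "source (B, g, C) = target (A, f, B)" by (simp add: source_def target_def)
  show 1: "(A, compose (carrier A) g f, C) \<in> arrows X0"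
    using comp_arrow_in[OF assms st] by (simp add: comp_arrow_eq)
  have "snd S (comp_arrow (B, g, C) (A, f, B)) = comp_arrow (snd S (B, g, C)) (snd S (A, f, B))"
    using S assms st by (cases S) (auto simp: endofunctors_def simp del: split_paired_All)
  then show "amap S A (compose (carrier A) g f) C =
      compose (carrier (fst S A)) (amap S B g C) (amap S A f B)"
    by (simp add: comp_arrow_eq endo_arrow(1)[OF assms(1)] endo_arrow(1)[OF assms(2)] endo_arrow(1)[OF 1])
qed

end

section \<open>Conjugation by bijections\<close>

text \<open>Inner and strongly stable automorphisms are both of this kind; they differ in what is demanded of the
  bijections \<open>s A\<close>.\<close>

definition conjugates ::
  "'x set \<Rightarrow> ('x grp \<Rightarrow> 'x Theta_elt \<Rightarrow> 'x Theta_elt) \<Rightarrow> 'x endofun \<Rightarrow> bool" where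
  "conjugates X0 s S \<longleftrightarrow>
     (\<forall>A \<in> objects X0. bij_betw (s A) (carrier A) (carrier (fst S A))) \<and>
     (\<forall>m \<in> arrows X0. snd S m = conj_arrow s (fst S) m)"

lemma conjugates_bij:
  "\<lbrakk>conjugates X0 s S; A \<in> objects X0\<rbrakk> \<Longrightarrow> bij_betw (s A) (carrier A) (carrier (fst S A))"
  by (simp add: conjugates_def)

lemma conjugates_in:
  "\<lbrakk>conjugates X0 s S; A \<in> objects X0; a \<in> carrier A\<rbrakk> \<Longrightarrow> s A a \<in> carrier (fst S A)"
  using conjugates_bij bij_betwE by blast

lemma conjugates_surj:
  assumes "conjugates X0 s S" "A \<in> objects X0" "b \<in> carrier (fst S A)"
  obtains a where "a \<in> carrier A" "s A a = b"
proof -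
  have "b \<in> s A ` carrier A"
    using bij_betw_imp_surj_on[OF conjugates_bij[OF assms(1,2)]] assms(3) by simp
  then show ?thesis using that by (elim imageE) simp
qed

lemma conjugates_inj:
  "\<lbrakk>conjugates X0 s S; A \<in> objects X0; a \<in> carrier A; b \<in> carrier A\<rbrakk> \<Longrightarrow> s A a = s A b \<longleftrightarrow> a = b"
  by (rule inj_on_eq_iff[OF bij_betw_imp_inj_on[OF conjugates_bij]])

lemma conjugates_amap:
  assumes "conjugates X0 s S" "(A, f, B) \<in> arrows X0" "a \<in> carrier A"
  shows "amap S A f B (s A a) = s B (f a)"
proof -
  have bij: "bij_betw (s A) (carrier A) (carrier (fst S A))"
    by (rule conjugates_bij[OF assms(1) arrowsD(1)[OF assms(2)]])
  have "snd S (A, f, B) = conj_arrow s (fst S) (A, f, B)"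
    using assms(1,2) unfolding conjugates_def by blast
  then have "amap S A f B = (\<lambda>b \<in> carrier (fst S A). s B (f (inv_into (carrier A) (s A) b)))"
    by (simp add: amap_def conj_arrow_def)
  then show ?thesis
    using bij_betwE[OF bij] bij_betw_inv_into_left[OF bij] assms(3) by simp
qed

lemma conjugatesI:
  assumes S: "S \<in> endofunctors X0"
    and bij: "\<And>A. A \<in> objects X0 \<Longrightarrow> bij_betw (s A) (carrier A) (carrier (fst S A))"
    and nat: "\<And>A f B a. \<lbrakk>(A, f, B) \<in> arrows X0; a \<in> carrier A\<rbrakk> \<Longrightarrow> amap S A f B (s A a) = s B (f a)"
  shows "conjugates X0 s S"
  unfolding conjugates_def
proof (intro conjI ballI)
  fix m assume "m \<in> arrows X0"
  then obtain A f B where m: "m = (A, f, B)" "(A, f, B) \<in> arrows X0" by (cases m) auto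
  have A: "A \<in> objects X0" using arrowsD(1) m(2) by blast
  have "amap S A f B = (\<lambda>a \<in> carrier (fst S A). s B (f (inv_into (carrier A) (s A) a)))"
  proof (rule extensionalityI[OF amap_extensional[OF S m(2)]])
    fix b assume "b \<in> carrier (fst S A)"
    then obtain a where "a \<in> carrier A" "b = s A a"
      using bij[OF A] by (auto simp: bij_betw_def)
    then show "amap S A f B b = (\<lambda>a \<in> carrier (fst S A). s B (f (inv_into (carrier A) (s A) a))) b"
      using bij[OF A] nat[OF m(2)] by (auto simp: bij_betw_def)
  qed simp
  then show "snd S m = conj_arrow s (fst S) m"
    by (simp add: m(1) endo_arrow(1)[OF S m(2)] conj_arrow_def)
qed (use bij in auto)

lemma conjugates_cong:
  assumes "conjugates X0 s S" "S \<in> endofunctors X0"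
    and "\<And>A a. A \<in> objects X0 \<Longrightarrow> a \<in> carrier A \<Longrightarrow> t A a = s A a"
  shows "conjugates X0 t S"
proof (rule conjugatesI[OF assms(2)])
  show "bij_betw (t A) (carrier A) (carrier (fst S A))" if "A \<in> objects X0" for A
    using conjugates_bij[OF assms(1) that] bij_betw_cong[of "carrier A" "t A" "s A"] assms(3)[OF that]
    by simp
  show "amap S A f B (t A a) = t B (f a)" if "(A, f, B) \<in> arrows X0" "a \<in> carrier A" for A f B a
  proof -
    have "f a \<in> carrier B" using arrowsD(3)[OF that(1)] that(2) by (auto simp: hom_def)
    then show ?thesis
      using conjugates_amap[OF assms(1) that] assms(3) arrowsD(1,2)[OF that(1)] that(2) by metis
  qed
qed

lemma conjugates_unique:
  assumes "conjugates X0 s S" "conjugates X0 s T" "S \<in> endofunctors X0" "T \<in> endofunctors X0"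
    and "\<And>A. A \<in> objects X0 \<Longrightarrow> fst S A = fst T A"
  shows "S = T"
proof (rule prod_eqI)
  have ext: "fst R \<in> extensional (objects X0)" "snd R \<in> extensional (arrows X0)"
    if "R \<in> endofunctors X0" for R
    using that by (auto simp: endofunctors_def PiE_def)
  show fst: "fst S = fst T"
    by (rule extensionalityI[OF ext(1)[OF assms(3)] ext(1)[OF assms(4)]]) (rule assms(5))
  show "snd S = snd T"
  proof (rule extensionalityI[OF ext(2)[OF assms(3)] ext(2)[OF assms(4)]])
    fix m assume "m \<in> arrows X0"
    then show "snd S m = snd T m" using assms(1,2) fst by (simp add: conjugates_def)
  qed
qed

lemma fst_End_mult: "A \<in> objects X0 \<Longrightarrow> fst (S \<otimes>\<^bsub>End_Theta0 X0\<^esub> T) A = fst S (fst T A)"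
  by (simp add: End_Theta0_def compose_eq)

lemma amap_End_mult:
  assumes "T \<in> endofunctors X0" "(A, f, B) \<in> arrows X0"
  shows "amap (S \<otimes>\<^bsub>End_Theta0 X0\<^esub> T) A f B = amap S (fst T A) (amap T A f B) (fst T B)"
  using endo_arrow(1)[OF assms] assms(2) by (simp add: End_Theta0_def compose_eq amap_def)

lemma End_mult_closed:
  "\<lbrakk>S \<in> endofunctors X0; T \<in> endofunctors X0\<rbrakk> \<Longrightarrow> S \<otimes>\<^bsub>End_Theta0 X0\<^esub> T \<in> endofunctors X0"
  using monoid.m_closed[OF monoid_End_Theta0[of X0], of S T] by (simp add: End_Theta0_def)

lemma conjugates_mult:
  assumes "conjugates X0 s S" "conjugates X0 t T" "S \<in> endofunctors X0" "T \<in> endofunctors X0"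
  shows "conjugates X0 (\<lambda>A. s (fst T A) \<circ> t A) (S \<otimes>\<^bsub>End_Theta0 X0\<^esub> T)"
proof (rule conjugatesI)
  show "bij_betw (s (fst T A) \<circ> t A) (carrier A) (carrier (fst (S \<otimes>\<^bsub>End_Theta0 X0\<^esub> T) A))"
    if "A \<in> objects X0" for A
    unfolding fst_End_mult[OF that]
    using conjugates_bij[OF assms(2) that] conjugates_bij[OF assms(1) endo_object[OF assms(4) that]]
    by (rule bij_betw_trans)
  show "amap (S \<otimes>\<^bsub>End_Theta0 X0\<^esub> T) A f B ((s (fst T A) \<circ> t A) a) = (s (fst T B) \<circ> t B) (f a)"
    if "(A, f, B) \<in> arrows X0" "a \<in> carrier A" for A f B a
    using conjugates_amap[OF assms(1) endo_arrow(2)[OF assms(4) that(1)]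
        conjugates_in[OF assms(2) arrowsD(1)[OF that(1)] that(2)]]
      conjugates_amap[OF assms(2) that]
    by (simp add: amap_End_mult[OF assms(4) that(1)])
qed (rule End_mult_closed[OF assms(3,4)])

lemma one_End: "\<one>\<^bsub>End_Theta0 X0\<^esub> \<in> endofunctors X0"
  using monoid.one_closed[OF monoid_End_Theta0[of X0]] by (simp add: End_Theta0_def)

lemma conjugates_one: "conjugates X0 (\<lambda>A a. a) \<one>\<^bsub>End_Theta0 X0\<^esub>"
  by (rule conjugatesI[OF one_End]) (auto simp: End_Theta0_def amap_def arrows_def bij_betw_def)

lemma Aut_simps [simp]:
  "x \<otimes>\<^bsub>Aut_Theta0 X0\<^esub> y = x \<otimes>\<^bsub>End_Theta0 X0\<^esub> y" "\<one>\<^bsub>Aut_Theta0 X0\<^esub> = \<one>\<^bsub>End_Theta0 X0\<^esub>"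
  by (simp_all add: Aut_Theta0_def units_of_def)

lemma carrier_Aut:
  "S \<in> carrier (Aut_Theta0 X0) \<longleftrightarrow> S \<in> endofunctors X0 \<and>
     (\<exists>T \<in> endofunctors X0. S \<otimes>\<^bsub>End_Theta0 X0\<^esub> T = \<one>\<^bsub>End_Theta0 X0\<^esub> \<and> T \<otimes>\<^bsub>End_Theta0 X0\<^esub> S = \<one>\<^bsub>End_Theta0 X0\<^esub>)"
  by (auto simp: Aut_Theta0_def units_of_def Units_def End_Theta0_def)

lemma inner_auts_iff:
  "S \<in> inner_auts X0 \<longleftrightarrow> S \<in> carrier (Aut_Theta0 X0) \<and>
     (\<exists>s. conjugates X0 s S \<and> (\<forall>A \<in> objects X0. s A \<in> hom A (fst S A)))"
  by (cases S) (auto simp: inner_auts_def conjugates_def iso_def)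

lemma strongly_stable_auts_iff:
  "S \<in> strongly_stable_auts X0 \<longleftrightarrow> S \<in> carrier (Aut_Theta0 X0) \<and>
     (\<forall>A \<in> objects X0. fst S A = A) \<and>
     (\<exists>s. conjugates X0 s S \<and>
       (\<forall>X. finite X \<and> X \<subseteq> X0 \<longrightarrow> (\<forall>x \<in> X. s (free_grp X) (gen x) = gen x)))"
proof (cases S)
  case (Pair P Q)
  have "conjugates X0 s (P, Q) \<longleftrightarrow> (\<forall>A \<in> objects X0. bij_betw (s A) (carrier A) (carrier A)) \<and>
      (\<forall>m \<in> arrows X0. Q m = conj_arrow s P m)" if "\<forall>A \<in> objects X0. P A = A" for s
    using that by (simp add: conjugates_def)
  then show ?thesis
    unfolding strongly_stable_auts_def Pair by (simp cong: conj_cong)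
qed

lemma subgroup_inner_auts: "subgroup (inner_auts X0) (Aut_Theta0 X0)"
proof -
  interpret Aut: group "Aut_Theta0 X0" by (rule group_Aut_Theta0)
  show ?thesis
  proof (rule Aut.subgroupI)
    show "inner_auts X0 \<subseteq> carrier (Aut_Theta0 X0)" by (auto simp: inner_auts_iff)
    have "\<one>\<^bsub>Aut_Theta0 X0\<^esub> \<in> inner_auts X0"
      unfolding inner_auts_iff
      using conjugates_one[of X0] Aut.one_closed
      by (auto simp: End_Theta0_def hom_def intro!: exI[of _ "\<lambda>A a. a"])
    then show "inner_auts X0 \<noteq> {}" by blast
  next
    fix S T assume ST: "S \<in> inner_auts X0" "T \<in> inner_auts X0"
    then obtain s t where s: "conjugates X0 s S" "\<And>A. A \<in> objects X0 \<Longrightarrow> s A \<in> hom A (fst S A)"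
      and t: "conjugates X0 t T" "\<And>A. A \<in> objects X0 \<Longrightarrow> t A \<in> hom A (fst T A)"
      by (auto simp: inner_auts_iff)
    have E: "S \<in> endofunctors X0" "T \<in> endofunctors X0" using ST by (auto simp: inner_auts_iff carrier_Aut)
    have "s (fst T A) \<circ> t A \<in> hom A (fst (S \<otimes>\<^bsub>End_Theta0 X0\<^esub> T) A)" if "A \<in> objects X0" for A
      using s(2)[OF endo_object[OF E(2) that]] t(2)[OF that] that
      by (auto simp: fst_End_mult hom_def Pi_iff)
    moreover have "S \<otimes>\<^bsub>Aut_Theta0 X0\<^esub> T \<in> carrier (Aut_Theta0 X0)"
      using ST by (intro Aut.m_closed) (auto simp: inner_auts_iff)
    ultimately show "S \<otimes>\<^bsub>Aut_Theta0 X0\<^esub> T \<in> inner_auts X0"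
      using conjugates_mult[OF s(1) t(1) E] by (auto simp: inner_auts_iff)
  next
    fix S assume S: "S \<in> inner_auts X0"
    then obtain s where s: "conjugates X0 s S" "\<And>A. A \<in> objects X0 \<Longrightarrow> s A \<in> hom A (fst S A)"
      by (auto simp: inner_auts_iff)
    define T where "T = inv\<^bsub>Aut_Theta0 X0\<^esub> S"
    have SA: "S \<in> carrier (Aut_Theta0 X0)" using S by (simp add: inner_auts_iff)
    then have T: "T \<in> carrier (Aut_Theta0 X0)" by (simp add: T_def)
    have E: "S \<in> endofunctors X0" "T \<in> endofunctors X0" using SA T by (auto simp: carrier_Aut)
    have ST: "S \<otimes>\<^bsub>End_Theta0 X0\<^esub> T = \<one>\<^bsub>End_Theta0 X0\<^esub>" "T \<otimes>\<^bsub>End_Theta0 X0\<^esub> S = \<one>\<^bsub>End_Theta0 X0\<^esub>"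
      using Aut.r_inv[OF SA] Aut.l_inv[OF SA] by (simp_all add: T_def)
    define t where "t = (\<lambda>A. inv_into (carrier (fst T A)) (s (fst T A)))"
    have obj: "fst T A \<in> objects X0" "fst S (fst T A) = A" if "A \<in> objects X0" for A
      using endo_object[OF E(2) that] fst_End_mult[OF that, of S T] that ST(1)
      by (simp_all add: End_Theta0_def)
    have st: "t A a \<in> carrier (fst T A)" "s (fst T A) (t A a) = a" if "A \<in> objects X0" "a \<in> carrier A" for A a
      using conjugates_bij[OF s(1) obj(1)[OF that(1)]] that obj(2)[OF that(1)] unfolding t_def bij_betw_def
      by (auto intro: inv_into_into f_inv_into_f)
    have "conjugates X0 t T"
    proof (rule conjugatesI[OF E(2)])
      show "bij_betw (t A) (carrier A) (carrier (fst T A))" if "A \<in> objects X0" for A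
        using bij_betw_inv_into[OF conjugates_bij[OF s(1) obj(1)[OF that]]] obj(2)[OF that]
        by (simp add: t_def)
      show "amap T A f B (t A a) = t B (f a)" if "(A, f, B) \<in> arrows X0" "a \<in> carrier A" for A f B a
      proof -
        have AB: "A \<in> objects X0" "B \<in> objects X0" "f a \<in> carrier B"
          using arrowsD[OF that(1)] that(2) by (auto simp: hom_def)
        have "amap S (fst T A) (amap T A f B) (fst T B) = f"
          using amap_End_mult[OF E(2) that(1), of S] that(1) by (simp add: ST) (simp add: amap_def End_Theta0_def)
        then have "s (fst T B) (amap T A f B (t A a)) = s (fst T B) (t B (f a))"
          using conjugates_amap[OF s(1) endo_arrow(2)[OF E(2) that(1)] st(1)[OF AB(1) that(2)]] st AB that(2)
          by simp
        moreover have "amap T A f B (t A a) \<in> carrier (fst T B)"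
          using amap_hom[OF E(2) that(1)] st(1)[OF AB(1) that(2)] by (auto simp: hom_def)
        ultimately show ?thesis
          using conjugates_inj[OF s(1) obj(1)[OF AB(2)]] st(1)[OF AB(2,3)] by simp
      qed
    qed
    moreover have "t A \<in> hom A (fst T A)" if "A \<in> objects X0" for A
    proof -
      have "s (fst T A) \<in> iso (fst T A) A"
        using s(2)[OF obj(1)[OF that]] conjugates_bij[OF s(1) obj(1)[OF that]] obj(2)[OF that]
        by (simp add: iso_def)
      then show ?thesis
        using group.iso_set_sym[OF group_object[OF obj(1)[OF that]]] by (auto simp: t_def iso_def)
    qed
    ultimately show "inv\<^bsub>Aut_Theta0 X0\<^esub> S \<in> inner_auts X0"
      using T unfolding T_def[symmetric] by (auto simp: inner_auts_iff)
  qed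
qed

section \<open>The automorphisms given by twists\<close>

text \<open>The homomorphism \<open>s\<close> from \<open>F\<close> to its twist that fixes the generators is also a homomorphism from the
  twist to the double twist, which is \<open>F\<close>. Hence \<open>s \<circ> s\<close> is an endomorphism of \<open>F\<close> that fixes the
  generators, that is, the identity.\<close>

lemma ex_twist_bij:
  assumes n: "n \<le> 2"
  obtains s where "s \<in> hom (free_grp X) (twist n (free_grp X))"
    "\<And>x. x \<in> X \<Longrightarrow> s (gen x) = gen x" "\<And>a. a \<in> carrier (free_grp X) \<Longrightarrow> s (s a) = a"
proof -
  let ?F = "free_grp X"
  interpret F: theta_group ?F by (rule theta_group_free_grp)
  have T: "theta_group (twist n ?F)" by (rule F.theta_group_twist[OF n])
  define s where "s = free_hom X (twist n ?F) gen"
  have s: "s \<in> hom ?F (twist n ?F)" "\<And>x. x \<in> X \<Longrightarrow> s (gen x) = gen x"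
    unfolding s_def using T by (auto intro: free_hom_in_hom free_hom_gen simp: gen_in_free_grp)
  have in_F: "s a \<in> carrier ?F" if "a \<in> carrier ?F" for a
    using hom_in_carrier[OF s(1) that] by simp
  have "s \<in> hom (twist n ?F) (twist n (twist n ?F))"
    by (rule hom_twist[OF F.is_group _ s(1)]) (use T in \<open>simp add: theta_group_def\<close>)
  then have s': "s (a \<otimes>\<^bsub>twist n ?F\<^esub> b) = s a \<otimes>\<^bsub>?F\<^esub> s b"
    if "a \<in> carrier ?F" "b \<in> carrier ?F" for a b
    using that F.twist_twist[OF n in_F in_F] hom_mult[of s "twist n ?F" "twist n (twist n ?F)" a b]
    by (simp only: twist_simps(1))
  have "s \<circ> s \<in> hom ?F ?F"
    by (rule homI) (simp_all only: comp_apply in_F hom_mult[OF s(1)] s')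
  then have "s (s a) = a" if "a \<in> carrier ?F" for a
    using hom_free_eqI[OF F.theta_group_axioms, of "s \<circ> s" X "\<lambda>a. a"] that s(2)
    by (simp add: hom_def)
  then show ?thesis using that s by blast
qed

lemma star_iso_W_alpha_iff:
  assumes "theta_group H" and n: "n \<le> 2"
  shows "s \<in> star_iso (W_alpha n) H \<longleftrightarrow>
    bij_betw s (carrier H) (carrier H) \<and> s \<in> hom H (twist n H)"
proof -
  interpret theta_group H by fact
  interpret t: theta_group "twist n H" by (rule theta_group_twist[OF n])
  have T: "Theta_group H" using assms by (simp add: Theta_group_iff)
  show ?thesis
  proof (intro iffI conjI)
    assume s: "s \<in> star_iso (W_alpha n) H"
    then show "bij_betw s (carrier H) (carrier H)" by (simp add: star_iso_def)
    then have "s a \<in> carrier H" if "a \<in> carrier H" for a using that bij_betwE by blast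
    then show "s \<in> hom H (twist n H)"
      using s by (intro homI) (simp_all add: star_iso_def star_W_alpha[OF T])
  next
    assume s: "bij_betw s (carrier H) (carrier H) \<and> s \<in> hom H (twist n H)"
    then have in_H: "s a \<in> carrier H" if "a \<in> carrier H" for a using that bij_betwE by blast
    have mult: "s (a \<otimes>\<^bsub>H\<^esub> b) = s a \<otimes>\<^bsub>twist n H\<^esub> s b" if "a \<in> carrier H" "b \<in> carrier H" for a b
      using s that by (auto simp: hom_def)
    have one: "s \<one>\<^bsub>H\<^esub> = \<one>\<^bsub>H\<^esub>"
      using mult[of "\<one>\<^bsub>H\<^esub>" "\<one>\<^bsub>H\<^esub>"] in_H[of "\<one>\<^bsub>H\<^esub>"] by simp
    have inv_twist: "inv\<^bsub>twist n H\<^esub> a = inv\<^bsub>H\<^esub> a" if "a \<in> carrier H" for a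
    proof (rule t.inv_equality)
      have "gcomm H a (inv\<^bsub>H\<^esub> a) = \<one>\<^bsub>H\<^esub>" using that by (simp add: gcomm_eq_one_iff)
      then show "inv\<^bsub>H\<^esub> a \<otimes>\<^bsub>twist n H\<^esub> a = \<one>\<^bsub>twist n H\<^esub>" using that by simp
    qed (use that in simp_all)
    have inv: "s (inv\<^bsub>H\<^esub> a) = inv\<^bsub>H\<^esub> s a" if "a \<in> carrier H" for a
    proof -
      have "s (inv\<^bsub>H\<^esub> a) \<otimes>\<^bsub>twist n H\<^esub> s a = \<one>\<^bsub>twist n H\<^esub>"
        using mult[OF inv_closed[OF that] that] one that by (simp del: twist_simps(2))
      then have "inv\<^bsub>twist n H\<^esub> s a = s (inv\<^bsub>H\<^esub> a)"
        using in_H that by (intro t.inv_equality) simp_all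
      then show ?thesis using inv_twist in_H that by simp
    qed
    show "s \<in> star_iso (W_alpha n) H"
      using s one inv mult in_H
      by (simp add: star_iso_def star_W_alpha[OF T] star_W_alpha(1)[OF T one_closed one_closed])
  qed
qed

lemma applicable_W_alpha:
  assumes "n \<le> 2"
  shows "applicable X0 (W_alpha n)"
  unfolding applicable_def
proof (intro conjI allI impI)
  fix X assume "finite X \<and> X \<subseteq> X0"
  obtain s where s: "s \<in> hom (free_grp X) (twist n (free_grp X))"
    "\<And>x. x \<in> X \<Longrightarrow> s (gen x) = gen x" "\<And>a. a \<in> carrier (free_grp X) \<Longrightarrow> s (s a) = a"
    using ex_twist_bij[OF assms] by metis
  then have "bij_betw s (carrier (free_grp X)) (carrier (free_grp X))"
    by (intro bij_betwI[of _ _ _ s]) (auto simp: hom_def)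
  then show "\<exists>s \<in> star_iso (W_alpha n) (free_grp X). \<forall>x \<in> X. s (gen x) = gen x"
    using s(1,2) by (intro bexI[of _ s]) (simp_all add: star_iso_W_alpha_iff[OF theta_group_free_grp assms])
qed (rule is_word_system_W_alpha)

lemma word_bij_W_alpha:
  assumes n: "n \<le> 2" and X: "finite X" "X \<subseteq> X0"
  defines "b \<equiv> word_bij (W_alpha n) (free_grp X)"
  shows "b \<in> hom (free_grp X) (twist n (free_grp X))"
    and "\<And>x. x \<in> X \<Longrightarrow> b (gen x) = gen x"
    and "\<And>a. a \<in> carrier (free_grp X) \<Longrightarrow> b (b a) = a"
    and "bij_betw b (carrier (free_grp X)) (carrier (free_grp X))"
proof -
  let ?F = "free_grp X"
  have b: "b \<in> star_iso (W_alpha n) ?F" "\<And>x. x \<in> X \<Longrightarrow> b (gen x) = gen x"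
    unfolding b_def using word_bij[OF applicable_W_alpha[OF n] X] by simp_all
  then show bh: "b \<in> hom ?F (twist n ?F)" "bij_betw b (carrier ?F) (carrier ?F)"
    "\<And>x. x \<in> X \<Longrightarrow> b (gen x) = gen x"
    by (simp_all add: star_iso_W_alpha_iff[OF theta_group_free_grp \<open>n \<le> 2\<close>])
  obtain s where s: "s \<in> hom ?F (twist n ?F)"
    "\<And>x. x \<in> X \<Longrightarrow> s (gen x) = gen x" "\<And>a. a \<in> carrier ?F \<Longrightarrow> s (s a) = a"
    using ex_twist_bij[OF n] by metis
  have "b a = s a" if "a \<in> carrier ?F" for a
    using theta_group.theta_group_twist[OF theta_group_free_grp n] bh(1) s(1) _ that
    by (rule hom_free_eqI) (use bh(3) s(2) in simp)
  moreover have "s a \<in> carrier ?F" if "a \<in> carrier ?F" for a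
    using hom_in_carrier[OF s(1) that] by simp
  ultimately show "\<And>a. a \<in> carrier ?F \<Longrightarrow> b (b a) = a" using s(3) by simp
qed

lemma word_bij_unique:
  assumes n: "n \<le> 2" and X: "finite X" "X \<subseteq> X0"
    and s: "s \<in> hom (free_grp X) (twist n (free_grp X))" "\<And>x. x \<in> X \<Longrightarrow> s (gen x) = gen x"
    and a: "a \<in> carrier (free_grp X)"
  shows "s a = word_bij (W_alpha n) (free_grp X) a"
  using theta_group.theta_group_twist[OF theta_group_free_grp n] s(1) word_bij_W_alpha(1)[OF n X] _ a
  by (rule hom_free_eqI) (use word_bij_W_alpha(2)[OF n X] s(2) in simp)

text \<open>A homomorphism of groups is one of their twists, and the bijections identify the groups with their
  twists.\<close>

lemma word_bij_conj_hom:
  assumes n: "n \<le> 2" and f: "(A, f, B) \<in> arrows X0"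
  shows "(A, \<lambda>a \<in> carrier A. word_bij (W_alpha n) B (f (word_bij (W_alpha n) A a)), B) \<in> arrows X0"
proof -
  note A = arrowsD[OF f]
  obtain X Y where X: "A = free_grp X" "finite X" "X \<subseteq> X0" and Y: "B = free_grp Y" "finite Y" "Y \<subseteq> X0"
    using A(1,2) by (auto simp: objects_def)
  interpret A: theta_group A using theta_group_object[OF A(1)] .
  interpret B: theta_group B using theta_group_object[OF A(2)] .
  let ?a = "word_bij (W_alpha n) A" and ?b = "word_bij (W_alpha n) B"
  have a: "?a \<in> hom A (twist n A)" and b: "?b \<in> hom B (twist n B)"
    using word_bij_W_alpha(1)[OF n] X Y by simp_all
  have f': "f \<in> hom (twist n A) (twist n B)"
    by (rule hom_twist[OF A.is_group B.is_group A(3)])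
  have b': "?b \<in> hom (twist n B) (twist n (twist n B))"
    by (rule hom_twist[OF B.is_group _ b]) (use B.theta_group_twist[OF n] in \<open>simp add: theta_group_def\<close>)
  have in_A: "?a x \<in> carrier A" if "x \<in> carrier A" for x using hom_in_carrier[OF a that] by simp
  have in_B: "?b x \<in> carrier B" if "x \<in> carrier B" for x using hom_in_carrier[OF b that] by simp
  have in_f: "f x \<in> carrier B" if "x \<in> carrier A" for x using hom_in_carrier[OF A(3) that] .
  have "?b (f (?a (x \<otimes>\<^bsub>A\<^esub> y))) = ?b (f (?a x)) \<otimes>\<^bsub>B\<^esub> ?b (f (?a y))"
    if xy: "x \<in> carrier A" "y \<in> carrier A" for x y
  proof -
    have "?b (f (?a (x \<otimes>\<^bsub>A\<^esub> y))) = ?b (f (?a x \<otimes>\<^bsub>twist n A\<^esub> ?a y))"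
      using hom_mult[OF a xy] by simp
    also have "\<dots> = ?b (f (?a x) \<otimes>\<^bsub>twist n B\<^esub> f (?a y))"
      using hom_mult[OF f', of "?a x" "?a y"] in_A xy by simp
    also have "\<dots> = ?b (f (?a x)) \<otimes>\<^bsub>twist n (twist n B)\<^esub> ?b (f (?a y))"
      using hom_mult[OF b', of "f (?a x)" "f (?a y)"] in_A in_f xy by simp
    also have "\<dots> = ?b (f (?a x)) \<otimes>\<^bsub>B\<^esub> ?b (f (?a y))"
      using in_A in_f in_B xy by (intro B.twist_twist[OF n]) simp_all
    finally show ?thesis .
  qed
  then show ?thesis
    using A in_A in_B in_f by (intro arrowsI homI) simp_all
qed

lemma Phi_endofunctor:
  assumes n: "n \<le> 2"
  shows "Phi X0 n \<in> endofunctors X0"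
    and "\<And>A. A \<in> objects X0 \<Longrightarrow> fst (Phi X0 n) A = A"
    and "conjugates X0 (word_bij (W_alpha n)) (Phi X0 n)"
proof -
  let ?b = "word_bij (W_alpha n)"
  show fst: "fst (Phi X0 n) A = A" if "A \<in> objects X0" for A
    using that by (simp add: Phi_def word_aut_def)
  have b: "\<And>a. a \<in> carrier A \<Longrightarrow> ?b A a \<in> carrier A" "\<And>a. a \<in> carrier A \<Longrightarrow> ?b A (?b A a) = a"
    "bij_betw (?b A) (carrier A) (carrier A)"
    if A: "A \<in> objects X0" for A
  proof -
    obtain X where X: "A = free_grp X" "finite X" "X \<subseteq> X0" using A by (auto simp: objects_def)
    show "\<And>a. a \<in> carrier A \<Longrightarrow> ?b A (?b A a) = a" "bij_betw (?b A) (carrier A) (carrier A)"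
      using word_bij_W_alpha(3,4)[OF n X(2,3)] by (simp_all add: X(1))
    then show "\<And>a. a \<in> carrier A \<Longrightarrow> ?b A a \<in> carrier A" using bij_betwE by blast
  qed
  have snd: "snd (Phi X0 n) (A, f, B) = (A, \<lambda>a \<in> carrier A. ?b B (f (?b A a)), B)"
    if f: "(A, f, B) \<in> arrows X0" for A f B
  proof -
    have "inv_into (carrier A) (?b A) a = ?b A a" if "a \<in> carrier A" for a
      using b[OF arrowsD(1)[OF f]] that by (intro inv_into_f_eq) (auto simp: bij_betw_def)
    then show ?thesis using f by (auto simp: Phi_def word_aut_def conj_arrow_def intro!: restrict_ext)
  qed
  have ext: "fst (Phi X0 n) \<in> extensional (objects X0)" "snd (Phi X0 n) \<in> extensional (arrows X0)"
    by (simp_all add: Phi_def word_aut_def)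
  have arr: "snd (Phi X0 n) m \<in> arrows X0" "source (snd (Phi X0 n) m) = source m"
    "target (snd (Phi X0 n) m) = target m" if m: "m \<in> arrows X0" for m
  proof -
    obtain A f B where e: "m = (A, f, B)" by (cases m)
    show "snd (Phi X0 n) m \<in> arrows X0" "source (snd (Phi X0 n) m) = source m"
      "target (snd (Phi X0 n) m) = target m"
      using word_bij_conj_hom[OF n m[unfolded e]] snd[OF m[unfolded e]]
      by (simp_all add: e source_def target_def)
  qed
  have id: "snd (Phi X0 n) (id_arrow A) = id_arrow A" if A: "A \<in> objects X0" for A
    using id_arrow_in[OF A] b[OF A] by (auto simp: id_arrow_def snd intro!: restrict_ext)
  have comp: "snd (Phi X0 n) (comp_arrow k m) = comp_arrow (snd (Phi X0 n) k) (snd (Phi X0 n) m)"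
    if km: "m \<in> arrows X0" "k \<in> arrows X0" "source k = target m" for k m
  proof -
    obtain A f B C g where m: "m = (A, f, B)" and k: "k = (B, g, C)"
      using km(3) by (cases m; cases k) (auto simp: source_def target_def)
    have c: "(A, compose (carrier A) g f, C) \<in> arrows X0"
      using comp_arrow_in[OF km] by (simp add: m k comp_arrow_eq)
    have AB: "A \<in> objects X0" "B \<in> objects X0" using arrowsD km(1) m by blast+
    have fB: "f a \<in> carrier B" if "a \<in> carrier A" for a
      using hom_in_carrier[OF arrowsD(3)[OF km(1)[unfolded m]] that] .
    have "?b C (compose (carrier A) g f (?b A a)) = ?b C (g (?b B (?b B (f (?b A a)))))"
      "?b B (f (?b A a)) \<in> carrier B"
      if "a \<in> carrier A" for a
      using b[OF AB(1)] b[OF AB(2)] fB that by (simp_all add: compose_eq)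
    then show ?thesis
      unfolding m k comp_arrow_eq snd[OF c] snd[OF km(1)[unfolded m]] snd[OF km(2)[unfolded k]]
      by (auto simp: compose_def intro!: restrict_ext)
  qed
  show endo: "Phi X0 n \<in> endofunctors X0"
  proof -
    obtain P Q where PQ: "Phi X0 n = (P, Q)" by (cases "Phi X0 n")
    have "P \<in> objects X0 \<rightarrow>\<^sub>E objects X0" "Q \<in> arrows X0 \<rightarrow>\<^sub>E arrows X0"
      using ext fst arr(1) by (auto simp: PQ PiE_def Pi_def simp del: split_paired_All)
    moreover have "\<forall>m \<in> arrows X0. source (Q m) = P (source m) \<and> target (Q m) = P (target m)"
      using arr(2,3) fst[OF source_in] fst[OF target_in] unfolding PQ fst_conv snd_conv by simp
    moreover have "\<forall>A \<in> objects X0. Q (id_arrow A) = id_arrow (P A)"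
      using id fst unfolding PQ fst_conv snd_conv by simp
    moreover have "\<forall>m \<in> arrows X0. \<forall>k \<in> arrows X0. source k = target m \<longrightarrow>
        Q (comp_arrow k m) = comp_arrow (Q k) (Q m)"
      using comp unfolding PQ fst_conv snd_conv by blast
    ultimately show ?thesis
      unfolding PQ endofunctors_def by blast
  qed
  show "conjugates X0 ?b (Phi X0 n)"
  proof (rule conjugatesI[OF endo])
    show "bij_betw (?b A) (carrier A) (carrier (fst (Phi X0 n) A))" if "A \<in> objects X0" for A
      using b(3)[OF that] fst[OF that] by simp
    show "amap (Phi X0 n) A f B (?b A a) = ?b B (f a)" if "(A, f, B) \<in> arrows X0" "a \<in> carrier A"
      for A f B a
      using that b[OF arrowsD(1)[OF that(1)]] by (simp add: amap_def snd)
  qed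
qed

lemma Phi_square:
  assumes n: "n \<le> 2"
  shows "Phi X0 n \<otimes>\<^bsub>End_Theta0 X0\<^esub> Phi X0 n = \<one>\<^bsub>End_Theta0 X0\<^esub>"
proof (rule conjugates_unique)
  let ?P = "Phi X0 n"
  note P = Phi_endofunctor[OF n, where ?X0.0 = X0]
  show PP: "?P \<otimes>\<^bsub>End_Theta0 X0\<^esub> ?P \<in> endofunctors X0" by (rule End_mult_closed[OF P(1) P(1)])
  show "conjugates X0 (\<lambda>A a. a) (?P \<otimes>\<^bsub>End_Theta0 X0\<^esub> ?P)"
  proof (rule conjugates_cong[OF conjugates_mult[OF P(3,3,1,1)] PP])
    fix A a assume A: "A \<in> objects X0" "a \<in> carrier A"
    then obtain X where X: "A = free_grp X" "finite X" "X \<subseteq> X0" by (auto simp: objects_def)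
    show "a = (word_bij (W_alpha n) (fst ?P A) \<circ> word_bij (W_alpha n) A) a"
      using word_bij_W_alpha(3)[OF n X(2,3)] A P(2)[OF A(1)] by (simp add: X(1))
  qed
  show "fst (?P \<otimes>\<^bsub>End_Theta0 X0\<^esub> ?P) A = fst \<one>\<^bsub>End_Theta0 X0\<^esub> A" if "A \<in> objects X0" for A
    using that P(2) by (simp add: fst_End_mult) (simp add: End_Theta0_def)
qed (rule conjugates_one one_End)+

lemma Phi_in_Aut: "n \<le> 2 \<Longrightarrow> Phi X0 n \<in> carrier (Aut_Theta0 X0)"
  using Phi_endofunctor(1)[of n X0] Phi_square[of n X0] unfolding carrier_Aut by blast

section \<open>Inner strongly stable automorphisms\<close>

lemma free_grp_singleton:
  assumes "a \<in> carrier (free_grp {x})"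
  obtains k :: nat where "a = gen x [^]\<^bsub>free_grp {x}\<^esub> k"
proof -
  interpret theta_group "free_grp {x}" by (rule theta_group_free_grp)
  have x: "gen x \<in> carrier (free_grp {x})" by (simp add: gen_in_free_grp)
  have "a \<in> generate (free_grp {x}) {gen x, gen x}" using assms carrier_free_grp[of "{x}"] by simp
  then obtain i j k l m n p q :: nat
    where "a = gen x [^]\<^bsub>free_grp {x}\<^esub> i \<otimes>\<^bsub>free_grp {x}\<^esub> gen x [^]\<^bsub>free_grp {x}\<^esub> j
      \<otimes>\<^bsub>free_grp {x}\<^esub> kword (free_grp {x}) (gen x) (gen x) k l m n p q"
    using generate_normal_form[OF x x] by metis
  moreover have "kword (free_grp {x}) (gen x) (gen x) k l m n p q = \<one>\<^bsub>free_grp {x}\<^esub>"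
    using x by (simp add: kword_def)
  ultimately show ?thesis using x that[of "i + j"] by (simp add: nat_pow_mult)
qed

text \<open>If the same functor is conjugation by bijections \<open>s\<close> and by isomorphisms \<open>\<sigma>\<close>, the maps \<open>s\<^sup>-\<^sup>1\<sigma>\<close> commute with
  all homomorphisms. On the free group of rank one such a map sends the generator to a power, so it is
  \<open>a \<mapsto> a\<^sup>k\<close> on every object. By bijectivity \<open>k\<close> is odd, so that \<open>s\<close> is \<open>\<sigma>\<close> itself or \<open>\<sigma>\<close> preceded by
  inversion.\<close>

lemma inner_imp_hom_twist:
  assumes "infinite X0" and E: "S \<in> endofunctors X0" and obj: "\<And>A. A \<in> objects X0 \<Longrightarrow> fst S A = A"
    and s: "conjugates X0 s S" and \<sigma>: "conjugates X0 \<sigma> S"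
    and hom: "\<And>A. A \<in> objects X0 \<Longrightarrow> \<sigma> A \<in> hom A A"
  obtains n where "n \<le> 1" "\<And>A. A \<in> objects X0 \<Longrightarrow> s A \<in> hom A (twist n A)"
proof -
  obtain x where x: "x \<in> X0" using assms(1) by (metis ex_in_conv infinite_imp_nonempty)
  define U where "U = free_grp {x}"
  have U: "U \<in> objects X0" using x by (auto simp: U_def objects_def)
  interpret U: theta_group U by (rule theta_group_object[OF U])
  have g: "gen x \<in> carrier U" by (simp add: U_def gen_in_free_grp)
  have s_in: "s A a \<in> carrier A" and \<sigma>_in: "\<sigma> A a \<in> carrier A" if "A \<in> objects X0" "a \<in> carrier A" for A a
    using conjugates_in[OF s that] conjugates_in[OF \<sigma> that] obj[OF that(1)] by simp_all
  obtain u where u: "u \<in> carrier U" "s U u = \<sigma> U (gen x)"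
    using conjugates_surj[OF s U, of "\<sigma> U (gen x)"] \<sigma>_in[OF U g] obj[OF U] by auto
  obtain k :: nat where k: "u = gen x [^]\<^bsub>U\<^esub> k"
    using free_grp_singleton u(1) unfolding U_def by metis
  have pow: "\<sigma> A a = s A (a [^]\<^bsub>A\<^esub> k)" if A: "A \<in> objects X0" "a \<in> carrier A" for A a
  proof -
    let ?f = "free_hom {x} A (\<lambda>_. a)"
    have T: "theta_group A" by (rule theta_group_object[OF A(1)])
    have arr: "(U, ?f, A) \<in> arrows X0"
      unfolding U_def using x A by (intro arrow_free_hom) auto
    have fx: "?f (gen x) = a" using free_hom_gen[OF T, of "{x}" "\<lambda>_. a" x] A by simp
    interpret f: group_hom U A ?f
      using arrowsD(3)[OF arr] U.is_group T by (simp add: group_hom_def group_hom_axioms_def theta_group_def)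
    have "\<sigma> A a = amap S U ?f A (\<sigma> U (gen x))"
      using conjugates_amap[OF \<sigma> arr g] fx by simp
    also have "\<dots> = s A (?f u)"
      using conjugates_amap[OF s arr u(1)] u(2) by simp
    also have "?f u = a [^]\<^bsub>A\<^esub> k"
      using g by (simp add: k f.hom_nat_pow fx)
    finally show ?thesis .
  qed
  have "odd k"
  proof
    assume "even k"
    then obtain j where j: "k = 2 * j" by auto
    let ?a = "gen x \<otimes>\<^bsub>U\<^esub> gen x"
    have "?a [^]\<^bsub>U\<^esub> k = (gen x [^]\<^bsub>U\<^esub> (4::nat)) [^]\<^bsub>U\<^esub> j"
    proof -
      have "?a = gen x [^]\<^bsub>U\<^esub> (2::nat)" using g by (simp add: numeral_2_eq_2)
      then show ?thesis using g by (simp add: j U.nat_pow_pow)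
    qed
    then have "?a [^]\<^bsub>U\<^esub> k = \<one>\<^bsub>U\<^esub>" using g by (simp add: U.exponent4)
    then have "\<sigma> U ?a = \<sigma> U \<one>\<^bsub>U\<^esub>" using g by (simp add: pow[OF U])
    then have "?a = \<one>\<^bsub>U\<^esub>" using conjugates_inj[OF \<sigma> U, of ?a "\<one>\<^bsub>U\<^esub>"] g by simp
    moreover have f: "free_hom {x} M64 (\<lambda>_. Mx) \<in> hom U M64" "free_hom {x} M64 (\<lambda>_. Mx) (gen x) = Mx"
      unfolding U_def using theta_group_M64 by (auto intro: free_hom_in_hom free_hom_gen)
    moreover have "free_hom {x} M64 (\<lambda>_. Mx) \<one>\<^bsub>U\<^esub> = \<one>\<^bsub>M64\<^esub>"
      using group_hom.hom_one[of U M64 "free_hom {x} M64 (\<lambda>_. Mx)"] f(1) U.is_group theta_group_M64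
      by (simp add: group_hom_def group_hom_axioms_def theta_group_def)
    ultimately show False
      using hom_mult[OF f(1) g g] M64_distinct(4) by simp
  qed
  then have "k mod 4 = 1 \<or> k mod 4 = 3" by presburger
  then show ?thesis
  proof
    assume k1: "k mod 4 = 1"
    have eq: "s A a = \<sigma> A a" if A: "A \<in> objects X0" "a \<in> carrier A" for A a
    proof -
      interpret A: theta_group A by (rule theta_group_object[OF A(1)])
      show ?thesis using pow[OF A] A.pow_mod_4[of a k] k1 A(2) by simp
    qed
    have "s A \<in> hom A (twist 0 A)" if A: "A \<in> objects X0" for A
    proof -
      interpret A: group A by (rule group_object[OF A])
      show ?thesis
        using hom[OF A] \<sigma>_in[OF A] by (intro homI) (simp_all add: eq[OF A] hom_mult)
    qed
    then show ?thesis using that[of 0] by simp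
  next
    assume k3: "k mod 4 = 3"
    have eq: "s A a = \<sigma> A (inv\<^bsub>A\<^esub> a)" if A: "A \<in> objects X0" "a \<in> carrier A" for A a
    proof -
      interpret A: theta_group A by (rule theta_group_object[OF A(1)])
      have "(inv\<^bsub>A\<^esub> a) [^]\<^bsub>A\<^esub> k = a"
        using A.pow_mod_4[of "inv\<^bsub>A\<^esub> a" k] A.inv_eq_cube[of "inv\<^bsub>A\<^esub> a"] A(2) k3 by simp
      then show ?thesis using pow[OF A(1), of "inv\<^bsub>A\<^esub> a"] A(2) by simp
    qed
    have "s A \<in> hom A (twist 1 A)" if A: "A \<in> objects X0" for A
    proof -
      interpret A: theta_group A by (rule theta_group_object[OF A])
      show ?thesis
        using hom[OF A] \<sigma>_in[OF A] s_in[OF A]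
        by (intro homI) (simp_all add: eq[OF A] hom_mult A.inv_mult_group A.twist_1_mult
            del: twist_simps(2) One_nat_def)
    qed
    then show ?thesis using that[of 1] by simp
  qed
qed

text \<open>For \<open>n = 1\<close> the twist is the opposite group, so the bijection becomes an isomorphism when it is preceded
  by inversion, and inversion commutes with homomorphisms.\<close>

lemma Phi_inner:
  fixes X0 :: "'x set"
  assumes "n \<le> 1"
  shows "Phi X0 n \<in> inner_auts X0"
proof -
  have n: "n \<le> 2" using assms by simp
  note P = Phi_endofunctor[OF n, where ?X0.0 = X0]
  have w: "word_bij (W_alpha n) A \<in> hom A (twist n A)" "bij_betw (word_bij (W_alpha n) A) (carrier A) (carrier A)"
    if "A \<in> objects X0" for A
    using that word_bij_W_alpha(1,4)[OF n] by (auto simp: objects_def)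
  consider "n = 0" | "n = 1" using assms by linarith
  then show ?thesis
  proof cases
    case 1
    have "word_bij (W_alpha n) A \<in> hom A (fst (Phi X0 n) A)" if A: "A \<in> objects X0" for A
    proof -
      interpret group A by (rule group_object[OF A])
      show ?thesis using w(1)[OF A] 1 P(2)[OF A] by (auto simp: hom_def Pi_iff)
    qed
    then show ?thesis
      unfolding inner_auts_iff using Phi_in_Aut[OF n] P(3) by blast
  next
    case 2
    define t where "t = (\<lambda>(A :: 'x grp) a. word_bij (W_alpha n) A (inv\<^bsub>A\<^esub> a))"
    have "conjugates X0 t (Phi X0 n)"
    proof (rule conjugatesI[OF P(1)])
      fix A assume A: "A \<in> objects X0"
      interpret group A by (rule group_object[OF A])
      have "bij_betw (\<lambda>a. inv\<^bsub>A\<^esub> a) (carrier A) (carrier A)"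
        by (rule bij_betwI[of _ _ _ "\<lambda>a. inv\<^bsub>A\<^esub> a"]) auto
      from bij_betw_trans[OF this w(2)[OF A]]
      show "bij_betw (t A) (carrier A) (carrier (fst (Phi X0 n) A))"
        using P(2)[OF A] by (simp add: t_def comp_def)
    next
      fix A f B a assume f: "(A, f, B) \<in> arrows X0" "a \<in> carrier A"
      interpret f: group_hom A B f
        using arrowsD[OF f(1)] group_object by (auto simp: group_hom_def group_hom_axioms_def)
      show "amap (Phi X0 n) A f B (t A a) = t B (f a)"
        using conjugates_amap[OF P(3) f(1), of "inv\<^bsub>A\<^esub> a"] f(2) by (simp add: t_def)
    qed
    moreover have "t A \<in> hom A (fst (Phi X0 n) A)" if A: "A \<in> objects X0" for A
    proof -
      interpret theta_group A by (rule theta_group_object[OF A])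
      have "word_bij (W_alpha n) A a \<in> carrier A" if "a \<in> carrier A" for a
        using hom_in_carrier[OF w(1)[OF A] that] by simp
      moreover have "word_bij (W_alpha n) A (inv\<^bsub>A\<^esub> b \<otimes>\<^bsub>A\<^esub> inv\<^bsub>A\<^esub> a) =
          word_bij (W_alpha n) A (inv\<^bsub>A\<^esub> a) \<otimes>\<^bsub>A\<^esub> word_bij (W_alpha n) A (inv\<^bsub>A\<^esub> b)"
        if "a \<in> carrier A" "b \<in> carrier A" for a b
        using hom_mult[OF w(1)[OF A], of "inv\<^bsub>A\<^esub> b" "inv\<^bsub>A\<^esub> a"] that calculation
        by (simp only: 2 twist_1_mult inv_closed)
      ultimately show ?thesis
        using P(2)[OF A] by (intro homI) (simp_all add: t_def inv_mult_group)
    qed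
    ultimately show ?thesis
      unfolding inner_auts_iff using Phi_in_Aut[OF n] by blast
  qed
qed

lemma Phi_strongly_stable:
  assumes n: "n \<le> 2"
  shows "Phi X0 n \<in> strongly_stable_auts X0"
proof -
  have "word_bij (W_alpha n) (free_grp X) (gen x) = gen x" if "finite X" "X \<subseteq> X0" "x \<in> X" for X x
    by (rule word_bij_W_alpha(2)[OF n that])
  then show ?thesis
    unfolding strongly_stable_auts_iff
    using Phi_in_Aut[OF n, of X0] Phi_endofunctor[OF n, where ?X0.0 = X0] by blast
qed

lemma strongly_stable_inter_inner:
  assumes "infinite X0"
  shows "strongly_stable_auts X0 \<inter> inner_auts X0 = {Phi X0 0, Phi X0 1}"
proof
  show "{Phi X0 0, Phi X0 1} \<subseteq> strongly_stable_auts X0 \<inter> inner_auts X0"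
    using Phi_inner[of 0 X0] Phi_inner[of 1 X0] Phi_strongly_stable[of 0 X0] Phi_strongly_stable[of 1 X0]
    by simp
  show "strongly_stable_auts X0 \<inter> inner_auts X0 \<subseteq> {Phi X0 0, Phi X0 1}"
  proof
    fix S assume S: "S \<in> strongly_stable_auts X0 \<inter> inner_auts X0"
    then obtain s where E: "S \<in> endofunctors X0" and obj: "\<And>A. A \<in> objects X0 \<Longrightarrow> fst S A = A"
      and s: "conjugates X0 s S" "\<And>X x. finite X \<Longrightarrow> X \<subseteq> X0 \<Longrightarrow> x \<in> X \<Longrightarrow> s (free_grp X) (gen x) = gen x"
      by (auto simp: strongly_stable_auts_iff carrier_Aut)
    obtain \<sigma> where \<sigma>: "conjugates X0 \<sigma> S" "\<And>A. A \<in> objects X0 \<Longrightarrow> \<sigma> A \<in> hom A A"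
      using S obj by (auto simp: inner_auts_iff)
    obtain n where n: "n \<le> 1" "\<And>A. A \<in> objects X0 \<Longrightarrow> s A \<in> hom A (twist n A)"
      using inner_imp_hom_twist[OF assms E obj s(1) \<sigma>] by blast
    have n2: "n \<le> 2" using n(1) by simp
    note P = Phi_endofunctor[OF n2, where ?X0.0 = X0]
    have "conjugates X0 s (Phi X0 n)"
    proof (rule conjugates_cong[OF P(3,1)])
      fix A a assume A: "A \<in> objects X0" "a \<in> carrier A"
      then obtain X where X: "A = free_grp X" "finite X" "X \<subseteq> X0" by (auto simp: objects_def)
      show "s A a = word_bij (W_alpha n) A a"
        using word_bij_unique[OF n2 X(2,3), of "s A" a] n(2)[OF A(1)] s(2)[OF X(2,3)] A(2) by (simp add: X(1))
    qed
    then have "S = Phi X0 n"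
      using s(1) E P(1) obj P(2) by (intro conjugates_unique) auto
    moreover have "n = 0 \<or> n = 1" using n(1) by auto
    ultimately show "S \<in> {Phi X0 0, Phi X0 1}" by auto
  qed
qed

text \<open>Otherwise \<open>xy(y, x)\<^sup>2\<close> would equal \<open>xy\<close> or \<open>yx\<close> in the free group on \<open>x\<close>, \<open>y\<close>, and therefore in
  \<^const>\<open>M64\<close>.\<close>

lemma Phi_2_not_inner:
  assumes "infinite X0"
  shows "Phi X0 2 \<notin> inner_auts X0"
proof
  assume "Phi X0 2 \<in> inner_auts X0"
  note P = Phi_endofunctor[OF order.refl, where ?X0.0 = X0]
  obtain \<sigma> where \<sigma>: "conjugates X0 \<sigma> (Phi X0 2)" "\<And>A. A \<in> objects X0 \<Longrightarrow> \<sigma> A \<in> hom A A"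
    using \<open>Phi X0 2 \<in> inner_auts X0\<close> P(2) by (auto simp: inner_auts_iff)
  obtain n where n: "n \<le> 1" "\<And>A. A \<in> objects X0 \<Longrightarrow> word_bij (W_alpha 2) A \<in> hom A (twist n A)"
    using inner_imp_hom_twist[OF assms P(1,2,3) \<sigma>] by blast
  obtain x where x: "x \<in> X0" using assms by (metis ex_in_conv infinite_imp_nonempty)
  obtain y where y: "y \<in> X0" "y \<noteq> x" using assms by (metis finite.emptyI finite.insertI insertCI subsetI finite_subset)
  let ?F = "free_grp {x, y}" and ?b = "word_bij (W_alpha 2) (free_grp {x, y})"
  have X: "finite {x, y}" "{x, y} \<subseteq> X0" using x y by auto
  have F: "?F \<in> objects X0" using X by (auto simp: objects_def)
  have g: "gen x \<in> carrier ?F" "gen y \<in> carrier ?F" by (simp_all add: gen_in_free_grp)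
  have "?b (gen x \<otimes>\<^bsub>?F\<^esub> gen y) = gen x \<otimes>\<^bsub>twist m ?F\<^esub> gen y" if "?b \<in> hom ?F (twist m ?F)" for m
    using hom_mult[OF that g] word_bij_W_alpha(2)[OF order.refl X] by simp
  then have "gen x \<otimes>\<^bsub>twist 2 ?F\<^esub> gen y = gen x \<otimes>\<^bsub>twist n ?F\<^esub> gen y"
    using n(2)[OF F] word_bij_W_alpha(1)[OF order.refl X] by metis
  then have "Mx \<otimes>\<^bsub>twist 2 M64\<^esub> My = Mx \<otimes>\<^bsub>twist n M64\<^esub> My"
    using word_op_twist[OF theta_group_M64 Mxy_in_M64 y(2)[symmetric]] by metis
  moreover have "n = 0 \<or> n = 1" using n(1) by auto
  ultimately show False
  proof (elim disjE)
    interpret M64: theta_group M64 by (rule theta_group_M64)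
    show False if "Mx \<otimes>\<^bsub>twist 2 M64\<^esub> My = Mx \<otimes>\<^bsub>twist n M64\<^esub> My" "n = 0"
      using that M64_distinct(2) by (simp del: twist_simps(2)) (simp add: twist_def)
    show False if "Mx \<otimes>\<^bsub>twist 2 M64\<^esub> My = Mx \<otimes>\<^bsub>twist n M64\<^esub> My" "n = 1"
      using that M64_distinct(3) M64.twist_1_mult[OF Mxy_in_M64] by (simp del: twist_simps(2))
  qed
qed

section \<open>Arbitrary automorphisms\<close>

lemma amap_id:
  assumes "S \<in> endofunctors X0" "A \<in> objects X0"
  shows "amap S A (restrict (\<lambda>a. a) (carrier A)) A = restrict (\<lambda>a. a) (carrier (fst S A))"
proof -
  have "snd S (id_arrow A) = id_arrow (fst S A)"
    using assms by (cases S) (auto simp: endofunctors_def)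
  then show ?thesis by (simp add: id_arrow_def amap_def)
qed

context
  fixes X0 :: "'x set" and S :: "'x endofun"
  assumes S: "S \<in> carrier (Aut_Theta0 X0)"
begin

private lemma E: "S \<in> endofunctors X0" using S by (simp add: carrier_Aut)

lemma aut_object_surj:
  assumes "B \<in> objects X0"
  obtains A where "A \<in> objects X0" "fst S A = B"
proof -
  obtain T where T: "T \<in> endofunctors X0" "S \<otimes>\<^bsub>End_Theta0 X0\<^esub> T = \<one>\<^bsub>End_Theta0 X0\<^esub>"
    using S by (auto simp: carrier_Aut)
  have "fst S (fst T B) = B"
    using fst_End_mult[OF assms, of S T] T(2) assms by (simp add: End_Theta0_def)
  then show ?thesis using that endo_object[OF T(1) assms] by blast
qed

lemma aut_faithful:
  assumes "(A, f, B) \<in> arrows X0" "(A, g, B) \<in> arrows X0" "amap S A f B = amap S A g B"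
  shows "f = g"
proof -
  obtain T where T: "T \<in> endofunctors X0" "T \<otimes>\<^bsub>End_Theta0 X0\<^esub> S = \<one>\<^bsub>End_Theta0 X0\<^esub>"
    using S by (auto simp: carrier_Aut)
  have "amap (T \<otimes>\<^bsub>End_Theta0 X0\<^esub> S) A h B = h" if "(A, h, B) \<in> arrows X0" for h
    using that unfolding T(2) by (simp add: amap_def End_Theta0_def)
  then show ?thesis using amap_End_mult[OF E assms(1), of T] amap_End_mult[OF E assms(2), of T] assms by metis
qed

lemma aut_full:
  assumes "A \<in> objects X0" "B \<in> objects X0" "(fst S A, g, fst S B) \<in> arrows X0"
  obtains f where "(A, f, B) \<in> arrows X0" "amap S A f B = g"
proof -
  obtain T where T: "T \<in> endofunctors X0" "S \<otimes>\<^bsub>End_Theta0 X0\<^esub> T = \<one>\<^bsub>End_Theta0 X0\<^esub>"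
    "T \<otimes>\<^bsub>End_Theta0 X0\<^esub> S = \<one>\<^bsub>End_Theta0 X0\<^esub>"
    using S by (auto simp: carrier_Aut)
  have TS: "fst T (fst S C) = C" if "C \<in> objects X0" for C
    using fst_End_mult[OF that, of T S] T(3) that by (simp add: End_Theta0_def)
  have "(A, amap T (fst S A) g (fst S B), B) \<in> arrows X0"
    using endo_arrow(2)[OF T(1) assms(3)] TS assms by simp
  moreover have "amap S A (amap T (fst S A) g (fst S B)) B = g"
    using amap_End_mult[OF T(1) assms(3), of S] TS assms unfolding T(2) by (simp add: amap_def End_Theta0_def)
  ultimately show ?thesis using that by blast
qed

text \<open>A nontrivial object has an endomorphism other than the identity, and automorphisms are faithful.\<close>

lemma aut_nontrivial:
  assumes X: "finite X" "X \<subseteq> X0" "X \<noteq> {}" and Z: "fst S (free_grp X) = free_grp Z"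
  shows "Z \<noteq> {}"
proof
  assume "Z = {}"
  let ?F = "free_grp X"
  have F: "?F \<in> objects X0" using X by (auto simp: objects_def)
  interpret F: theta_group ?F by (rule theta_group_free_grp)
  obtain x where x: "x \<in> X" using X by blast
  let ?f = "restrict (\<lambda>_. \<one>\<^bsub>?F\<^esub>) (carrier ?F)" and ?g = "restrict (\<lambda>a. a) (carrier ?F)"
  have arr: "(?F, ?f, ?F) \<in> arrows X0" "(?F, ?g, ?F) \<in> arrows X0"
    using F by (auto intro!: arrowsI homI)
  have "amap S ?F ?f ?F = amap S ?F ?g ?F"
  proof (rule extensionalityI[OF amap_extensional[OF E arr(1)] amap_extensional[OF E arr(2)]])
    fix a assume "a \<in> carrier (fst S ?F)"
    then show "amap S ?F ?f ?F a = amap S ?F ?g ?F a"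
      using hom_free_eqI[OF theta_group_free_grp, of _ "{}" _ _ a] amap_hom[OF E arr(1)] amap_hom[OF E arr(2)]
      by (auto simp: Z \<open>Z = {}\<close>)
  qed
  then have "?f (gen x) = ?g (gen x)" using aut_faithful[OF arr] by metis
  then have one: "gen x = \<one>\<^bsub>?F\<^esub>" using x by (simp add: gen_in_free_grp)
  let ?e = "free_hom X M64 (\<lambda>_. Mx)"
  have e: "?e \<in> hom ?F M64" "?e (gen x) = Mx"
    using x theta_group_M64 by (auto intro: free_hom_in_hom free_hom_gen)
  interpret e: group_hom ?F M64 ?e
    using e(1) F.is_group theta_group_M64 by (simp add: group_hom_def group_hom_axioms_def theta_group_def)
  have "Mx = \<one>\<^bsub>M64\<^esub>" using e(2) one e.hom_one by simp
  then show False using M64_distinct(4) by (simp add: e.H.l_one)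
qed

end

lemma gens_commute_imp_eq:
  assumes "x \<in> X" "y \<in> X" "gen x \<otimes>\<^bsub>free_grp X\<^esub> gen y = gen y \<otimes>\<^bsub>free_grp X\<^esub> gen x"
  shows "x = y"
proof (rule ccontr)
  assume "x \<noteq> y"
  let ?e = "free_hom X M64 (\<lambda>z. if z = x then Mx else My)"
  have e: "?e \<in> hom (free_grp X) M64" "?e (gen x) = Mx" "?e (gen y) = My"
    using assms theta_group_M64 \<open>x \<noteq> y\<close> by (auto intro!: free_hom_in_hom simp: free_hom_gen)
  then have "Mx \<otimes>\<^bsub>M64\<^esub> My = My \<otimes>\<^bsub>M64\<^esub> Mx"
    using hom_mult[OF e(1), of "gen x" "gen y"] hom_mult[OF e(1), of "gen y" "gen x"] assms
    by (simp add: gen_in_free_grp)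
  then show False using M64_distinct(1) by simp
qed

text \<open>A free group of rank one is a retract of every nontrivial object, in particular of the object that \<open>S\<close>
  maps to it. So its image is a retract of a cyclic group, hence commutative, and \<^const>\<open>M64\<close> shows that free
  groups of larger rank are not commutative.\<close>

lemma aut_rank_one:
  assumes S: "S \<in> carrier (Aut_Theta0 X0)" and x: "x \<in> X0"
  obtains z where "z \<in> X0" "fst S (free_grp {x}) = free_grp {z}"
proof -
  interpret Aut: group "Aut_Theta0 X0" by (rule group_Aut_Theta0)
  let ?U = "free_grp {x}"
  have E: "S \<in> endofunctors X0" using S by (simp add: carrier_Aut)
  have U: "?U \<in> objects X0" using x by (auto simp: objects_def)
  obtain Z where Z: "fst S ?U = free_grp Z" "finite Z" "Z \<subseteq> X0"
    using endo_object[OF E U] by (auto simp: objects_def)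
  have "Z \<noteq> {}" using aut_nontrivial[OF S _ _ _ Z(1)] x by simp
  define T where "T = inv\<^bsub>Aut_Theta0 X0\<^esub> S"
  have T: "T \<in> carrier (Aut_Theta0 X0)" using S by (simp add: T_def)
  have ET: "T \<in> endofunctors X0" using T by (simp add: carrier_Aut)
  define B where "B = fst T ?U"
  have B: "B \<in> objects X0" "fst S B = ?U"
  proof -
    show "B \<in> objects X0" unfolding B_def by (rule endo_object[OF ET U])
    have "S \<otimes>\<^bsub>End_Theta0 X0\<^esub> T = \<one>\<^bsub>End_Theta0 X0\<^esub>" using Aut.r_inv[OF S] by (simp add: T_def)
    then show "fst S B = ?U" using fst_End_mult[OF U, of S T] U by (simp add: B_def End_Theta0_def)
  qed
  obtain Y where Y: "B = free_grp Y" "finite Y" "Y \<subseteq> X0" using B(1) by (auto simp: objects_def)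
  have "Y \<noteq> {}"
    by (rule aut_nontrivial[OF T, of "{x}"]) (use x Y(1) in \<open>simp_all add: B_def\<close>)
  then obtain y where y: "y \<in> Y" by blast
  \<comment> \<open>The retraction \<open>?r \<circ> ?i = id\<close> of \<open>B\<close> onto \<open>?U\<close>.\<close>
  let ?i = "free_hom {x} B (\<lambda>_. gen y)" and ?r = "free_hom Y ?U (\<lambda>_. gen x)"
  have gx: "gen x \<in> carrier ?U" by (simp add: gen_in_free_grp)
  have arr: "(?U, ?i, B) \<in> arrows X0" "(B, ?r, ?U) \<in> arrows X0"
    using arrow_free_hom[of "{x}" X0 B "\<lambda>_. gen y"] arrow_free_hom[of Y X0 ?U "\<lambda>_. gen x"] x y B(1) U Y gx
    by (simp_all add: gen_in_free_grp)
  let ?j = "restrict (\<lambda>a. a) (carrier ?U)"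
  have comp: "compose (carrier ?U) ?r ?i = ?j"
  proof (rule extensionalityI[of _ "carrier ?U"])
    fix a assume a: "a \<in> carrier ?U"
    define e where "e = ?r \<circ> ?i"
    have e_hom: "e \<in> hom ?U ?U"
      unfolding e_def using arrowsD(3)[OF arr(1)] arrowsD(3)[OF arr(2)] by (rule Group.hom_compose)
    have id_hom: "(\<lambda>a. a) \<in> hom ?U ?U" by (simp add: hom_def)
    have "gen y \<in> carrier B" using y by (simp add: Y(1) gen_in_free_grp)
    then have "?i (gen x) = gen y"
      by (rule free_hom_gen[OF theta_group_object[OF B(1)]]) simp
    moreover have "?r (gen y) = gen x"
      using gx y by (rule free_hom_gen[OF theta_group_free_grp])
    ultimately have e_gen: "e (gen x) = gen x" by (simp add: e_def)
    have "e a = a"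
      by (rule hom_free_eqI[OF theta_group_free_grp e_hom id_hom _ a]) (use e_gen in simp)
    moreover have "compose (carrier ?U) ?r ?i a = e a"
      unfolding e_def comp_apply using a by (rule compose_eq)
    ultimately show "compose (carrier ?U) ?r ?i a = ?j a"
      using a by (simp only: restrict_apply if_True)
  qed simp_all
  define \<iota> where "\<iota> = amap S ?U ?i B"
  define \<rho> where "\<rho> = amap S B ?r ?U"
  have \<iota>: "\<iota> \<in> hom (fst S ?U) ?U" and \<rho>: "\<rho> \<in> hom ?U (fst S ?U)"
    using amap_hom[OF E arr(1)] amap_hom[OF E arr(2)] B(2) by (simp_all add: \<iota>_def \<rho>_def)
  have ret: "\<rho> (\<iota> c) = c" if c: "c \<in> carrier (fst S ?U)" for c
  proof -
    have "amap S ?U ?j ?U = restrict (\<lambda>a. a) (carrier (fst S ?U))"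
      using amap_id[OF E U] .
    then have "compose (carrier (fst S ?U)) \<rho> \<iota> = restrict (\<lambda>a. a) (carrier (fst S ?U))"
      using amap_comp(2)[OF E arr] by (simp add: comp \<iota>_def \<rho>_def)
    from fun_cong[OF this, of c] show ?thesis using c by (simp add: compose_eq)
  qed
  interpret U: theta_group ?U by (rule theta_group_free_grp)
  have comm: "c \<otimes>\<^bsub>fst S ?U\<^esub> d = d \<otimes>\<^bsub>fst S ?U\<^esub> c" if cd: "c \<in> carrier (fst S ?U)" "d \<in> carrier (fst S ?U)" for c d
  proof -
    have in_U: "\<iota> c \<in> carrier ?U" "\<iota> d \<in> carrier ?U" using hom_in_carrier[OF \<iota>] cd by auto
    obtain k l :: nat where "\<iota> c = gen x [^]\<^bsub>?U\<^esub> k" "\<iota> d = gen x [^]\<^bsub>?U\<^esub> l"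
      using free_grp_singleton in_U by metis
    then have "\<iota> c \<otimes>\<^bsub>?U\<^esub> \<iota> d = \<iota> d \<otimes>\<^bsub>?U\<^esub> \<iota> c"
      using gx by (simp add: U.nat_pow_mult add.commute)
    then show ?thesis
      using hom_mult[OF \<rho> in_U] hom_mult[OF \<rho> in_U(2,1)] ret cd by simp
  qed
  obtain z where z: "z \<in> Z" using \<open>Z \<noteq> {}\<close> by blast
  have "Z = {z}"
  proof (intro equalityI subsetI)
    fix z' assume "z' \<in> Z"
    then have "z' = z"
      using z comm[unfolded Z(1), of "gen z'" "gen z"] gens_commute_imp_eq[of z' Z z]
      by (simp add: gen_in_free_grp)
    then show "z' \<in> {z}" by simp
  qed (use z in simp)
  then show ?thesis using that[of z] Z by simp
qed

text \<open>Elements of \<open>A\<close> are homomorphisms from a free group of rank one to \<open>A\<close>. The functor maps these bijectively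
  to the homomorphisms from another free group of rank one to the image of \<open>A\<close>, and naturality is
  functoriality.\<close>

lemma aut_is_conjugation:
  fixes X0 :: "'x set"
  assumes inf: "infinite X0" and S: "S \<in> carrier (Aut_Theta0 X0)"
  obtains s where "conjugates X0 s S"
proof -
  have E: "S \<in> endofunctors X0" using S by (simp add: carrier_Aut)
  obtain x where x: "x \<in> X0" using inf by (metis ex_in_conv infinite_imp_nonempty)
  obtain z where z: "z \<in> X0" "fst S (free_grp {x}) = free_grp {z}" using aut_rank_one[OF S x] .
  let ?U = "free_grp {x}"
  have U: "?U \<in> objects X0" using x by (auto simp: objects_def)
  have gx: "gen x \<in> carrier ?U" and gz: "gen z \<in> carrier (free_grp {z})" by (simp_all add: gen_in_free_grp)
  define p where "p = (\<lambda>(A :: 'x grp) a. free_hom {x} A (\<lambda>_. a))"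
  define s where "s = (\<lambda>A a. amap S ?U (p A a) A (gen z))"
  have p: "(?U, p A a, A) \<in> arrows X0" "p A a (gen x) = a" if "A \<in> objects X0" "a \<in> carrier A" for A a
    using that x theta_group_object[OF that(1)] arrow_free_hom[of "{x}" X0 A "\<lambda>_. a"]
    by (auto simp: p_def free_hom_gen)
  have p_unique: "f = p A a" if "(?U, f, A) \<in> arrows X0" "f (gen x) = a" for f A a
  proof -
    have A: "A \<in> objects X0" "a \<in> carrier A"
      using arrowsD[OF that(1)] hom_in_carrier[of f ?U A "gen x"] that(2) gx by auto
    show ?thesis
    proof (rule extensionalityI[OF arrowsD(4)[OF that(1)] arrowsD(4)[OF p(1)[OF A]]])
      show "f b = p A a b" if "b \<in> carrier ?U" for b
        using theta_group_object[OF A(1)] arrowsD(3)[OF \<open>(?U, f, A) \<in> arrows X0\<close>] arrowsD(3)[OF p(1)[OF A]] _ that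
        by (rule hom_free_eqI) (use p(2)[OF A] \<open>f (gen x) = a\<close> in simp)
    qed
  qed
  have s_in: "s A a \<in> carrier (fst S A)" if "A \<in> objects X0" "a \<in> carrier A" for A a
    using hom_in_carrier[OF amap_hom[OF E p(1)[OF that]]] gz by (simp add: s_def z(2))
  have "conjugates X0 s S"
  proof (rule conjugatesI[OF E])
    fix A assume A: "A \<in> objects X0"
    have SA: "fst S A \<in> objects X0" by (rule endo_object[OF E A])
    show "bij_betw (s A) (carrier A) (carrier (fst S A))"
      unfolding bij_betw_def
    proof (intro conjI inj_onI equalityI subsetI)
      fix a b assume ab: "a \<in> carrier A" "b \<in> carrier A" "s A a = s A b"
      have "amap S ?U (p A a) A = amap S ?U (p A b) A"
      proof (rule extensionalityI[OF amap_extensional[OF E p(1)[OF A ab(1)]] amap_extensional[OF E p(1)[OF A ab(2)]]])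
        fix c assume c: "c \<in> carrier (fst S ?U)"
        show "amap S ?U (p A a) A c = amap S ?U (p A b) A c"
          using theta_group_object[OF SA] amap_hom[OF E p(1)[OF A ab(1)], unfolded z(2)]
            amap_hom[OF E p(1)[OF A ab(2)], unfolded z(2)] _ c[unfolded z(2)]
          by (rule hom_free_eqI) (use ab(3) in \<open>simp add: s_def\<close>)
      qed
      then have "p A a = p A b" by (rule aut_faithful[OF S p(1)[OF A ab(1)] p(1)[OF A ab(2)]])
      from fun_cong[OF this, of "gen x"] show "a = b" unfolding p(2)[OF A ab(1)] p(2)[OF A ab(2)] .
    next
      fix b assume "b \<in> s A ` carrier A"
      then show "b \<in> carrier (fst S A)" by (elim imageE) (simp add: s_in[OF A])
    next
      fix b assume b: "b \<in> carrier (fst S A)"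
      let ?g = "free_hom {z} (fst S A) (\<lambda>_. b)"
      have "(fst S ?U, ?g, fst S A) \<in> arrows X0"
        unfolding z(2) using z(1) SA b by (intro arrow_free_hom) auto
      then obtain f where f: "(?U, f, A) \<in> arrows X0" "amap S ?U f A = ?g"
        using aut_full[OF S U A] by blast
      have "f (gen x) \<in> carrier A" using hom_in_carrier[OF arrowsD(3)[OF f(1)] gx] .
      moreover have "s A (f (gen x)) = b"
        using p_unique[OF f(1) HOL.refl, symmetric] f(2) free_hom_gen[OF theta_group_object[OF SA], of "{z}" "\<lambda>_. b" z] b
        by (simp add: s_def)
      ultimately show "b \<in> s A ` carrier A" by blast
    qed
  next
    fix A f B a assume f: "(A, f, B) \<in> arrows X0" "a \<in> carrier A"
    have A: "A \<in> objects X0" by (rule arrowsD(1)[OF f(1)])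
    have "compose (carrier ?U) f (p A a) = p B (f a)"
      using amap_comp(1)[OF E p(1)[OF A f(2)] f(1)] p(2)[OF A f(2)] gx
      by (intro p_unique) (simp_all add: compose_eq)
    then show "amap S A f B (s A a) = s B (f a)"
      using amap_comp(2)[OF E p(1)[OF A f(2)] f(1)] gz by (simp add: s_def z(2) compose_eq)
  qed
  then show ?thesis by (rule that)
qed

text \<open>It is to be shown that \<open>s (xy)\<close> is a word in \<open>s x\<close> and \<open>s y\<close>. As \<open>x\<close> and \<open>y\<close> are free generators, homomorphisms
  from the image of \<open>F\<close> are determined by their values on \<open>s x\<close>, \<open>s y\<close>, which can be prescribed. This yields
  mutually inverse homomorphisms between the image of \<open>F\<close> and \<open>F\<close> that match \<open>s x\<close>, \<open>s y\<close> with \<open>x\<close>, \<open>y\<close>.\<close>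

lemma aut_mult_word:
  assumes S: "S \<in> carrier (Aut_Theta0 X0)" and s: "conjugates X0 s S"
    and xy: "x \<in> X0" "y \<in> X0" "x \<noteq> y"
  obtains w where "w \<in> carrier (free_grp {x, y})"
    "\<And>A a b. A \<in> objects X0 \<Longrightarrow> a \<in> carrier A \<Longrightarrow> b \<in> carrier A \<Longrightarrow>
      s A (a \<otimes>\<^bsub>A\<^esub> b) = word_op x y w (fst S A) (s A a) (s A b)"
proof -
  have E: "S \<in> endofunctors X0" using S by (simp add: carrier_Aut)
  let ?F = "free_grp {x, y}"
  have F: "?F \<in> objects X0" using xy by (auto simp: objects_def)
  have SF: "fst S ?F \<in> objects X0" by (rule endo_object[OF E F])
  interpret F: theta_group ?F by (rule theta_group_free_grp)
  have g: "gen x \<in> carrier ?F" "gen y \<in> carrier ?F" by (simp_all add: gen_in_free_grp)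
  have pair: "\<exists>f. (?F, f, A) \<in> arrows X0 \<and> f (gen x) = a \<and> f (gen y) = b"
    if "A \<in> objects X0" "a \<in> carrier A" "b \<in> carrier A" for A a b
    using that xy arrow_free_hom[of "{x, y}" X0 A "\<lambda>z. if z = x then a else b"]
      free_hom_gen[OF theta_group_object[OF that(1)], of "{x, y}" "\<lambda>z. if z = x then a else b"]
    by (intro exI[of _ "free_hom {x, y} A (\<lambda>z. if z = x then a else b)"]) auto
  obtain B where B: "B \<in> objects X0" "fst S B = ?F" using aut_object_surj[OF S F] .
  obtain b1 where b1: "b1 \<in> carrier B" "s B b1 = gen x"
    using conjugates_surj[OF s B(1), of "gen x"] g B(2) by auto
  obtain b2 where b2: "b2 \<in> carrier B" "s B b2 = gen y"
    using conjugates_surj[OF s B(1), of "gen y"] g B(2) by auto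
  obtain \<psi> where \<psi>: "(?F, \<psi>, B) \<in> arrows X0" "\<psi> (gen x) = b1" "\<psi> (gen y) = b2"
    using pair[OF B(1) b1(1) b2(1)] by blast
  \<comment> \<open>\<open>\<theta>\<close> and \<open>\<eta>\<close> match \<open>s x\<close>, \<open>s y\<close> with the free generators; by fullness \<open>\<eta> \<circ> \<theta>\<close> comes from an
    endomorphism \<open>\<zeta>\<close> of \<open>F\<close>, which fixes the generators.\<close>
  define \<theta> where "\<theta> = amap S ?F \<psi> B"
  have \<theta>: "\<theta> \<in> hom (fst S ?F) ?F" "\<theta> (s ?F (gen x)) = gen x" "\<theta> (s ?F (gen y)) = gen y"
    using amap_hom[OF E \<psi>(1)] conjugates_amap[OF s \<psi>(1) g(1)] conjugates_amap[OF s \<psi>(1) g(2)]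
    by (simp_all add: \<theta>_def B(2) \<psi> b1 b2)
  have sg: "s ?F (gen x) \<in> carrier (fst S ?F)" "s ?F (gen y) \<in> carrier (fst S ?F)"
    using conjugates_in[OF s F] g by auto
  obtain \<eta> where \<eta>: "(?F, \<eta>, fst S ?F) \<in> arrows X0" "\<eta> (gen x) = s ?F (gen x)" "\<eta> (gen y) = s ?F (gen y)"
    using pair[OF SF sg] by blast
  have \<theta>_arrow: "(fst S ?F, \<theta>, ?F) \<in> arrows X0" using endo_arrow(2)[OF E \<psi>(1)] by (simp add: \<theta>_def B(2))
  have "comp_arrow (?F, \<eta>, fst S ?F) (fst S ?F, \<theta>, ?F) \<in> arrows X0"
    by (rule comp_arrow_in[OF \<theta>_arrow \<eta>(1)]) (simp add: source_def target_def)
  then obtain \<zeta> where \<zeta>: "(?F, \<zeta>, ?F) \<in> arrows X0" "amap S ?F \<zeta> ?F = compose (carrier (fst S ?F)) \<eta> \<theta>"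
    using aut_full[OF S F F] unfolding comp_arrow_eq by metis
  have sz: "s ?F (\<zeta> a) = \<eta> (\<theta> (s ?F a))" if "a \<in> carrier ?F" for a
    using conjugates_amap[OF s \<zeta>(1) that] conjugates_in[OF s F that] by (simp add: \<zeta>(2) compose_eq)
  have zeta_in: "\<zeta> a \<in> carrier ?F" if "a \<in> carrier ?F" for a
    using hom_in_carrier[OF arrowsD(3)[OF \<zeta>(1)] that] .
  have "\<zeta> (gen x) = gen x"
    using sz[OF g(1)] conjugates_inj[OF s F zeta_in[OF g(1)] g(1)] by (simp add: \<theta> \<eta>)
  moreover have "\<zeta> (gen y) = gen y"
    using sz[OF g(2)] conjugates_inj[OF s F zeta_in[OF g(2)] g(2)] by (simp add: \<theta> \<eta>)
  ultimately have "\<zeta> a = a" if "a \<in> carrier ?F" for a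
    using hom_free_eqI[OF F.theta_group_axioms arrowsD(3)[OF \<zeta>(1)], of "\<lambda>a. a" a] that by (auto simp: hom_def)
  then have \<eta>\<theta>: "\<eta> (\<theta> (s ?F a)) = s ?F a" if "a \<in> carrier ?F" for a
    using sz that by simp
  define w where "w = \<theta> (s ?F (gen x \<otimes>\<^bsub>?F\<^esub> gen y))"
  have w: "w \<in> carrier ?F"
    unfolding w_def using hom_in_carrier[OF \<theta>(1)] conjugates_in[OF s F] g by simp
  have word: "word_op x y w (fst S ?F) (s ?F (gen x)) (s ?F (gen y)) = s ?F (gen x \<otimes>\<^bsub>?F\<^esub> gen y)"
    using word_op_eqI[OF theta_group_object[OF SF] arrowsD(3)[OF \<eta>(1)] \<eta>(2,3) xy(3) w] \<eta>\<theta> g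
    by (simp add: w_def)
  show ?thesis
  proof (rule that[OF w])
    fix A a b assume A: "A \<in> objects X0" and ab: "a \<in> carrier A" "b \<in> carrier A"
    obtain f where f: "(?F, f, A) \<in> arrows X0" "f (gen x) = a" "f (gen y) = b"
      using pair[OF A ab] by blast
    have "s A (a \<otimes>\<^bsub>A\<^esub> b) = s A (f (gen x \<otimes>\<^bsub>?F\<^esub> gen y))"
      using hom_mult[OF arrowsD(3)[OF f(1)] g] by (simp add: f(2,3))
    also have "\<dots> = amap S ?F f A (word_op x y w (fst S ?F) (s ?F (gen x)) (s ?F (gen y)))"
      using conjugates_amap[OF s f(1)] g by (simp add: word)
    also have "\<dots> = word_op x y w (fst S A) (amap S ?F f A (s ?F (gen x))) (amap S ?F f A (s ?F (gen y)))"
      using theta_group_object[OF SF] theta_group_object[OF endo_object[OF E A]] amap_hom[OF E f(1)] sg xy(3) w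
      by (rule hom_word_op)
    also have "\<dots> = word_op x y w (fst S A) (s A a) (s A b)"
      using conjugates_amap[OF s f(1)] g by (simp add: f(2,3))
    finally show "s A (a \<otimes>\<^bsub>A\<^esub> b) = word_op x y w (fst S A) (s A a) (s A b)" .
  qed
qed

text \<open>The unit is the only element that is fixed by all endomorphisms of the group, and the functor induces a
  bijection between the endomorphisms of \<open>A\<close> and those of its image.\<close>

lemma aut_one:
  assumes S: "S \<in> carrier (Aut_Theta0 X0)" and s: "conjugates X0 s S" and A: "A \<in> objects X0"
  shows "s A \<one>\<^bsub>A\<^esub> = \<one>\<^bsub>fst S A\<^esub>"
proof -
  have E: "S \<in> endofunctors X0" using S by (simp add: carrier_Aut)
  let ?B = "fst S A"
  have B: "?B \<in> objects X0" by (rule endo_object[OF E A])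
  interpret A: group A by (rule group_object[OF A])
  interpret B: group ?B by (rule group_object[OF B])
  have "(?B, restrict (\<lambda>_. \<one>\<^bsub>?B\<^esub>) (carrier ?B), ?B) \<in> arrows X0"
    using B by (auto intro!: arrowsI homI)
  then obtain f where f: "(A, f, A) \<in> arrows X0" "amap S A f A = restrict (\<lambda>_. \<one>\<^bsub>?B\<^esub>) (carrier ?B)"
    using aut_full[OF S A A] by blast
  have "f \<one>\<^bsub>A\<^esub> = \<one>\<^bsub>A\<^esub>"
    using group_hom.hom_one[of A A f] arrowsD(3)[OF f(1)] A.is_group by (simp add: group_hom_def group_hom_axioms_def)
  then show ?thesis
    using conjugates_amap[OF s f(1) A.one_closed] conjugates_in[OF s A A.one_closed] by (simp add: f(2))
qed

text \<open>Transport along the bijections makes the operation of the word unital and associative on all objects, and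
  associativity on a free group of rank three passes to \<^const>\<open>M64\<close>.\<close>

lemma aut_hom_twist:
  assumes inf: "infinite X0" and S: "S \<in> carrier (Aut_Theta0 X0)" and s: "conjugates X0 s S"
  obtains n where "n < 4" "\<And>A. A \<in> objects X0 \<Longrightarrow> s A \<in> hom A (twist n (fst S A))"
proof -
  have E: "S \<in> endofunctors X0" using S by (simp add: carrier_Aut)
  obtain T where T: "finite T" "card T = 3" "T \<subseteq> X0"
    using infinite_arbitrarily_large[OF inf, of 3] by blast
  then obtain x y z where xyz: "T = {x, y, z}" "x \<noteq> y" "x \<noteq> z" "y \<noteq> z" by (auto simp: card_3_iff)
  then have X: "x \<in> X0" "y \<in> X0" "z \<in> X0" using T by auto
  obtain w where w: "w \<in> carrier (free_grp {x, y})"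
    "\<And>A a b. A \<in> objects X0 \<Longrightarrow> a \<in> carrier A \<Longrightarrow> b \<in> carrier A \<Longrightarrow>
      s A (a \<otimes>\<^bsub>A\<^esub> b) = word_op x y w (fst S A) (s A a) (s A b)"
    using aut_mult_word[OF S s X(1,2) xyz(2)] by blast
  let ?op = "\<lambda>A. word_op x y w A"
  have unit: "?op A a \<one>\<^bsub>A\<^esub> = a" "?op A \<one>\<^bsub>A\<^esub> a = a" if A: "A \<in> objects X0" "a \<in> carrier A" for A a
  proof -
    obtain B where B: "B \<in> objects X0" "fst S B = A" using aut_object_surj[OF S A(1)] .
    interpret B: group B by (rule group_object[OF B(1)])
    obtain b where b: "b \<in> carrier B" "s B b = a"
      using conjugates_surj[OF s B(1), of a] A(2) B(2) by auto
    show "?op A a \<one>\<^bsub>A\<^esub> = a" "?op A \<one>\<^bsub>A\<^esub> a = a"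
      using w(2)[OF B(1) b(1) B.one_closed] w(2)[OF B(1) B.one_closed b(1)] aut_one[OF S s B(1)] b
      by (simp_all add: B(2))
  qed
  have assoc: "?op A (?op A a b) c = ?op A a (?op A b c)"
    if A: "A \<in> objects X0" "a \<in> carrier A" "b \<in> carrier A" "c \<in> carrier A" for A a b c
  proof -
    obtain B where B: "B \<in> objects X0" "fst S B = A" using aut_object_surj[OF S A(1)] .
    interpret B: group B by (rule group_object[OF B(1)])
    have surj: "\<exists>d \<in> carrier B. s B d = e" if "e \<in> carrier A" for e
      using conjugates_surj[OF s B(1), of e] that B(2) by auto
    obtain a' where a': "a' \<in> carrier B" "s B a' = a" using surj[OF A(2)] by blast
    obtain b' where b': "b' \<in> carrier B" "s B b' = b" using surj[OF A(3)] by blast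
    obtain c' where c': "c' \<in> carrier B" "s B c' = c" using surj[OF A(4)] by blast
    note b = a' b' c'
    have "s B (a' \<otimes>\<^bsub>B\<^esub> b' \<otimes>\<^bsub>B\<^esub> c') = s B (a' \<otimes>\<^bsub>B\<^esub> (b' \<otimes>\<^bsub>B\<^esub> c'))"
      using b by (simp add: B.m_assoc)
    then show ?thesis using b by (simp add: w(2)[OF B(1)] B(2))
  qed
  let ?F = "free_grp {x, y}" and ?F3 = "free_grp {x, y, z}"
  have F: "?F \<in> objects X0" "?F3 \<in> objects X0" using X by (auto simp: objects_def)
  have assoc_M64: "?op M64 (?op M64 g h) k = ?op M64 g (?op M64 h k)"
    if M: "g \<in> carrier M64" "h \<in> carrier M64" "k \<in> carrier M64" for g h k
  proof -
    let ?v = "\<lambda>t. if t = x then g else if t = y then h else k"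
    define e where "e = free_hom {x, y, z} M64 ?v"
    have e: "e \<in> hom ?F3 M64" "e (gen x) = g" "e (gen y) = h" "e (gen z) = k"
      unfolding e_def using M xyz theta_group_M64 by (auto intro!: free_hom_in_hom simp: free_hom_gen)
    have g3: "gen x \<in> carrier ?F3" "gen y \<in> carrier ?F3" "gen z \<in> carrier ?F3" by (simp_all add: gen_in_free_grp)
    note h = hom_word_op[OF theta_group_free_grp theta_group_M64 e(1) _ _ xyz(2) w(1)]
    note c = word_op_closed[OF theta_group_free_grp _ _ xyz(2) w(1)]
    have "e (?op ?F3 (?op ?F3 (gen x) (gen y)) (gen z)) = e (?op ?F3 (gen x) (?op ?F3 (gen y) (gen z)))"
      using assoc[OF F(2) g3] by simp
    then show ?thesis using g3 by (simp add: h c e)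
  qed
  have g: "gen x \<in> carrier ?F" "gen y \<in> carrier ?F" by (simp_all add: gen_in_free_grp)
  obtain n where n: "n < 4" "w = gen x \<otimes>\<^bsub>twist n ?F\<^esub> gen y"
    using associative_word[OF xyz(2) w(1) unit(1)[OF F(1) g(1)] unit(2)[OF F(1) g(2)] assoc_M64] by blast
  show ?thesis
  proof (rule that[OF n(1)])
    fix A assume A: "A \<in> objects X0"
    show "s A \<in> hom A (twist n (fst S A))"
    proof (rule homI)
      fix a b assume ab: "a \<in> carrier A" "b \<in> carrier A"
      show "s A (a \<otimes>\<^bsub>A\<^esub> b) = s A a \<otimes>\<^bsub>twist n (fst S A)\<^esub> s A b"
        unfolding w(2)[OF A ab] unfolding n(2)
        using theta_group_object[OF endo_object[OF E A]] conjugates_in[OF s A ab(1)] conjugates_in[OF s A ab(2)] xyz(2)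
        by (rule word_op_twist)
    qed (use conjugates_in[OF s A] in simp)
  qed
qed

text \<open>Since \<open>xy(y, x) = yx\<close>, preceding the bijections by inversion lowers an odd \<open>n\<close> by one.\<close>

lemma aut_even_twist:
  fixes X0 :: "'x set"
  assumes inf: "infinite X0" and S: "S \<in> carrier (Aut_Theta0 X0)"
  obtains n s where "n = 0 \<or> n = 2" "conjugates X0 s S"
    "\<And>A. A \<in> objects X0 \<Longrightarrow> s A \<in> hom A (twist n (fst S A))"
proof -
  have E: "S \<in> endofunctors X0" using S by (simp add: carrier_Aut)
  obtain s where s: "conjugates X0 s S" using aut_is_conjugation[OF inf S] .
  obtain n where n: "n < 4" "\<And>A. A \<in> objects X0 \<Longrightarrow> s A \<in> hom A (twist n (fst S A))"
    using aut_hom_twist[OF inf S s] by blast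
  show ?thesis
  proof (cases "even n")
    case True
    then have "n = 0 \<or> n = 2" using n(1) by presburger
    then show ?thesis using that s n(2) by blast
  next
    case False
    define m where "m = n - 1"
    have m: "m = 0 \<and> n = 1 \<or> m = 2 \<and> n = 3" using False n(1) unfolding m_def by presburger
    define t where "t = (\<lambda>(A :: 'x grp) a. s A (inv\<^bsub>A\<^esub> a))"
    have "conjugates X0 t S"
    proof (rule conjugatesI[OF E])
      fix A assume A: "A \<in> objects X0"
      interpret group A by (rule group_object[OF A])
      have "bij_betw (\<lambda>a. inv\<^bsub>A\<^esub> a) (carrier A) (carrier A)"
        by (rule bij_betwI[of _ _ _ "\<lambda>a. inv\<^bsub>A\<^esub> a"]) auto
      from bij_betw_trans[OF this conjugates_bij[OF s A]]
      show "bij_betw (t A) (carrier A) (carrier (fst S A))" by (simp add: t_def comp_def)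
    next
      fix A f B a assume f: "(A, f, B) \<in> arrows X0" "a \<in> carrier A"
      interpret f: group_hom A B f
        using arrowsD[OF f(1)] group_object by (auto simp: group_hom_def group_hom_axioms_def)
      show "amap S A f B (t A a) = t B (f a)"
        using conjugates_amap[OF s f(1), of "inv\<^bsub>A\<^esub> a"] f(2) by (simp add: t_def)
    qed
    moreover have "t A \<in> hom A (twist m (fst S A))" if A: "A \<in> objects X0" for A
    proof (rule homI)
      interpret A: group A by (rule group_object[OF A])
      interpret B: theta_group "fst S A" by (rule theta_group_object[OF endo_object[OF E A]])
      have t: "t A a \<in> carrier (fst S A)" if "a \<in> carrier A" for a
        using conjugates_in[OF s A] that by (simp add: t_def)
      then show "t A a \<in> carrier (twist m (fst S A))" if "a \<in> carrier A" for a using that by simp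
      fix a b assume ab: "a \<in> carrier A" "b \<in> carrier A"
      have "t A (a \<otimes>\<^bsub>A\<^esub> b) = t A b \<otimes>\<^bsub>twist n (fst S A)\<^esub> t A a"
        using hom_mult[OF n(2)[OF A], of "inv\<^bsub>A\<^esub> b" "inv\<^bsub>A\<^esub> a"] ab by (simp only: t_def A.inv_mult_group A.inv_closed)
      also have "\<dots> = t A a \<otimes>\<^bsub>twist m (fst S A)\<^esub> t A b"
        using m
      proof
        assume "m = 0 \<and> n = 1"
        then show ?thesis using B.twist_1_mult[of "t A b" "t A a"] t[OF ab(1)] t[OF ab(2)] by simp
      next
        assume "m = 2 \<and> n = 3"
        then show ?thesis
          using B.twist_3_mult[of "t A b" "t A a"] B.twist_2_mult[of "t A a" "t A b"] t[OF ab(1)] t[OF ab(2)]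
            B.commsq_sym[of "t A a" "t A b"] by simp
      qed
      finally show "t A (a \<otimes>\<^bsub>A\<^esub> b) = t A a \<otimes>\<^bsub>twist m (fst S A)\<^esub> t A b" .
    qed
    ultimately show ?thesis using that[of m t] m by blast
  qed
qed

text \<open>The bijections of \<open>Phi X0 2\<close> undo the twist for \<open>n = 2\<close>.\<close>

lemma aut_cases:
  assumes inf: "infinite X0" and S: "S \<in> carrier (Aut_Theta0 X0)"
  shows "S \<in> inner_auts X0 \<or> S \<otimes>\<^bsub>Aut_Theta0 X0\<^esub> Phi X0 2 \<in> inner_auts X0"
proof -
  interpret Aut: group "Aut_Theta0 X0" by (rule group_Aut_Theta0)
  have E: "S \<in> endofunctors X0" using S by (simp add: carrier_Aut)
  obtain n s where n: "n = 0 \<or> n = 2" and s: "conjugates X0 s S"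
    "\<And>A. A \<in> objects X0 \<Longrightarrow> s A \<in> hom A (twist n (fst S A))"
    using aut_even_twist[OF inf S] by blast
  show ?thesis
    using n
  proof
    assume n: "n = 0"
    have "s A \<in> hom A (fst S A)" if A: "A \<in> objects X0" for A
    proof -
      interpret B: group "fst S A" by (rule group_object[OF endo_object[OF E A]])
      show ?thesis using s(2)[OF A] n by (auto simp: hom_def Pi_iff)
    qed
    then show ?thesis using s(1) S by (auto simp: inner_auts_iff)
  next
    assume n: "n = 2"
    have n2: "(2::nat) \<le> 2" by simp
    note P = Phi_endofunctor[OF n2, where ?X0.0 = X0]
    let ?b = "\<lambda>A. word_bij (W_alpha 2) A"
    have "s A \<circ> ?b A \<in> hom A (fst S A)" if A: "A \<in> objects X0" for A
    proof (rule homI)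
      obtain X where X: "A = free_grp X" "finite X" "X \<subseteq> X0" using A by (auto simp: objects_def)
      have b: "?b A \<in> hom A (twist 2 A)" using word_bij_W_alpha(1)[OF n2 X(2,3)] by (simp add: X(1))
      interpret B: theta_group "fst S A" by (rule theta_group_object[OF endo_object[OF E A]])
      have s': "s A \<in> hom (twist 2 A) (twist 2 (twist 2 (fst S A)))"
        using s(2)[OF A] n B.theta_group_twist[OF n2] group_object[OF A]
        by (intro hom_twist) (auto simp: theta_group_def)
      have in_b: "?b A a \<in> carrier A" if "a \<in> carrier A" for a using hom_in_carrier[OF b that] by simp
      have in_s: "s A a \<in> carrier (fst S A)" if "a \<in> carrier A" for a using conjugates_in[OF s(1) A that] .
      show "(s A \<circ> ?b A) a \<in> carrier (fst S A)" if "a \<in> carrier A" for a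
        using that in_b in_s by simp
      fix a c assume ac: "a \<in> carrier A" "c \<in> carrier A"
      have "s A (?b A (a \<otimes>\<^bsub>A\<^esub> c)) = s A (?b A a) \<otimes>\<^bsub>twist 2 (twist 2 (fst S A))\<^esub> s A (?b A c)"
        using hom_mult[OF b ac] hom_mult[OF s', of "?b A a" "?b A c"] in_b ac by (simp only: twist_simps(1))
      also have "\<dots> = s A (?b A a) \<otimes>\<^bsub>fst S A\<^esub> s A (?b A c)"
        using in_b in_s ac by (intro B.twist_twist[OF n2]) simp_all
      finally show "(s A \<circ> ?b A) (a \<otimes>\<^bsub>A\<^esub> c) = (s A \<circ> ?b A) a \<otimes>\<^bsub>fst S A\<^esub> (s A \<circ> ?b A) c" by simp
    qed
    then have "s (fst (Phi X0 2) A) \<circ> ?b A \<in> hom A (fst (S \<otimes>\<^bsub>End_Theta0 X0\<^esub> Phi X0 2) A)"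
      if "A \<in> objects X0" for A
      using that by (simp add: fst_End_mult P(2))
    moreover have "S \<otimes>\<^bsub>Aut_Theta0 X0\<^esub> Phi X0 2 \<in> carrier (Aut_Theta0 X0)"
      using S Phi_in_Aut[OF n2, of X0] by (intro Aut.m_closed)
    ultimately show ?thesis
      using conjugates_mult[OF s(1) P(3) E P(1)] unfolding inner_auts_iff Aut_simps by blast
  qed
qed

lemma order_Aut_Mod_inner:
  assumes inf: "infinite X0"
  shows "order (Aut_Theta0 X0 Mod inner_auts X0) = 2"
proof -
  let ?A = "Aut_Theta0 X0" and ?Y = "inner_auts X0" and ?P = "Phi X0 2"
  interpret Aut: group ?A by (rule group_Aut_Theta0)
  have Y: "subgroup ?Y ?A" by (rule subgroup_inner_auts)
  have P: "?P \<in> carrier ?A" by (rule Phi_in_Aut) simp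
  have PP: "?P \<otimes>\<^bsub>?A\<^esub> ?P = \<one>\<^bsub>?A\<^esub>" using Phi_square[of 2 X0] by simp
  have cases: "?Y #>\<^bsub>?A\<^esub> S = ?Y \<or> ?Y #>\<^bsub>?A\<^esub> S = ?Y #>\<^bsub>?A\<^esub> ?P" if S: "S \<in> carrier ?A" for S
    using aut_cases[OF inf S]
  proof
    assume "S \<in> ?Y"
    then show ?thesis using Aut.coset_join2[OF S Y] by simp
  next
    assume SP: "S \<otimes>\<^bsub>?A\<^esub> ?P \<in> ?Y"
    have "S \<otimes>\<^bsub>?A\<^esub> ?P \<otimes>\<^bsub>?A\<^esub> ?P = S"
      using S P PP by (simp only: Aut.m_assoc Aut.r_one)
    then have "S \<in> ?Y #>\<^bsub>?A\<^esub> ?P" using SP by (force simp: r_coset_def simp del: Aut_simps)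
    then show ?thesis using Aut.repr_independence[OF _ P Y] by simp
  qed
  have one: "?Y #>\<^bsub>?A\<^esub> \<one>\<^bsub>?A\<^esub> = ?Y"
    using Aut.coset_join2[OF Aut.one_closed Y] Y by (simp add: subgroup.one_closed del: Aut_simps)
  have "rcosets\<^bsub>?A\<^esub> ?Y = {?Y, ?Y #>\<^bsub>?A\<^esub> ?P}"
    using cases P one Aut.one_closed unfolding RCOSETS_def by blast
  moreover have "?Y \<noteq> ?Y #>\<^bsub>?A\<^esub> ?P"
    using Aut.rcos_self[OF P Y] Phi_2_not_inner[OF inf] by blast
  ultimately show ?thesis by (simp add: order_def FactGroup_def)
qed

theorem theorem9p1:
  fixes X0 :: "'x set"
  assumes "countable X0" and "infinite X0"
  shows "strongly_stable_auts X0 \<inter> inner_auts X0 = {Phi X0 0, Phi X0 1} \<and>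
         order (Aut_Theta0 X0 Mod inner_auts X0) = 2"
  using strongly_stable_inter_inner[OF assms(2)] order_Aut_Mod_inner[OF assms(2)] by simp

end
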